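(* Let $\beta>0$ and let $(\lambda_k)_{k\in\mathbb Z}$ be the points of the $\operatorname{Sine}_\beta$ process. Then almost surely the principal value sum $\lim_{r\to\infty}\sum_{|\lambda_k|\le r}\lambda_k^{-1}$ exists, and it has the Cauchy distribution with density $\frac{1}{2\pi(x^2+1/4)}$, $x\in\mathbb R$.
   Context: The $\operatorname{Sine}_\beta$ process is the point process on $\mathbb R$ obtained as the bulk scaling limit of $\beta$-ensembles; equivalently the $n\to\infty$ distributional limit of $\{n\theta_j\}$ where $e^{i\theta_j}$ ($\theta_j\in(-\pi,\pi]$) are the points of the size-$n$ circular $\beta$-ensemble (joint density proportional to $\prod_{j<k}|z_j-z_k|^\beta$ on the unit circle). It is translation invariant, symmetric in law under $x\mapsto -x$, and has intensity $1/(2\pi)$. *)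

theory Defs
  imports "HOL-Probability.Probability"
begin

text \<open>Unnormalised joint density of the size-n circular beta ensemble in the
  angle coordinates theta_0..theta_(n-1) in (-pi,pi]:
  product over j<k of |e^(i theta_j) - e^(i theta_k)|^beta.\<close>
definition cbe_weight :: "real \<Rightarrow> nat \<Rightarrow> (nat \<Rightarrow> real) \<Rightarrow> real" where
  "cbe_weight \<beta> n \<theta> =
     (\<Prod>j<n. \<Prod>k\<in>{j<..<n}. (cmod (cis (\<theta> j) - cis (\<theta> k))) powr \<beta>)"

definition cbe_space :: "nat \<Rightarrow> (nat \<Rightarrow> real) measure" where
  "cbe_space n = (\<Pi>\<^sub>M j\<in>{..<n}. restrict_space lborel {-pi<..pi})"

definition cbe_expectation :: "real \<Rightarrow> nat \<Rightarrow> ((nat \<Rightarrow> real) \<Rightarrow> real) \<Rightarrow> real" where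
  "cbe_expectation \<beta> n F =
     (\<integral>\<theta>. F \<theta> * cbe_weight \<beta> n \<theta> \<partial>cbe_space n) / (\<integral>\<theta>. cbe_weight \<beta> n \<theta> \<partial>cbe_space n)"

definition cc_nonneg :: "(real \<Rightarrow> real) \<Rightarrow> bool" where
  "cc_nonneg f \<longleftrightarrow> continuous_on UNIV f \<and> (\<forall>x. 0 \<le> f x) \<and> bounded {x. f x \<noteq> 0}"

text \<open>A random (simple, locally finite) point configuration Lambda on the probability
  space M is a Sine_beta process iff it is the distributional limit (vague topology)
  of the rescaled circular beta ensembles {n theta_j}; convergence in distribution of
  point processes is expressed by convergence of Laplace functionals
  E exp(- sum f(x)) for all nonnegative continuous compactly supported f.\<close>
definition sine_beta_process :: "real \<Rightarrow> 'a measure \<Rightarrow> ('a \<Rightarrow> real set) \<Rightarrow> bool" where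
  "sine_beta_process \<beta> M \<Lambda> \<longleftrightarrow>
     prob_space M \<and>
     (AE \<omega> in M. \<forall>a b. finite (\<Lambda> \<omega> \<inter> {a..b})) \<and>
     (\<forall>a b. (\<lambda>\<omega>. card (\<Lambda> \<omega> \<inter> {a..b})) \<in> measurable M (count_space UNIV)) \<and>
     (\<forall>f. cc_nonneg f \<longrightarrow>
        ((\<lambda>n. cbe_expectation \<beta> n (\<lambda>\<theta>. exp (- (\<Sum>j<n. f (real n * \<theta> j)))))
          \<longlongrightarrow> (\<integral>\<omega>. exp (- (\<Sum>x\<in>{x\<in>\<Lambda> \<omega>. f x \<noteq> 0}. f x)) \<partial>M)) sequentially)"

end

theory Submission
  imports Defs
begin

text \<open>Write \<open>z\<^sub>j = e^(i \<theta>\<^sub>j)\<close> for the points of the circular ensemble, \<open>H\<^sub>j(w) = (z\<^sub>j + w) / (z\<^sub>j - w)\<close>, and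
  \<open>S(w)\<close> for the mean of the \<open>H\<^sub>j(w)\<close>. The vector field with components \<open>H\<^sub>j(w)\<close> turns the
  pair interaction into products, \<open>(H\<^sub>j - H\<^sub>k) cot ((\<theta>\<^sub>j - \<theta>\<^sub>k)/2) = - i (H\<^sub>j H\<^sub>k - 1)\<close>, so its divergence with
  respect to the ensemble is a multiple of \<open>S(w)\<^sup>2 - 1\<close> up to a small error. Integrating by parts twice
  bounds the second moment of this divergence, and since \<open>Re S > 0\<close> one obtains
  \<open>E |S(w) - 1| \<le> C / (n (1 - |w|))\<close> uniformly in \<open>n\<close>. As \<open>Re S\<close> is a Poisson average of the
  points, this yields \<open>E |N(I) - |I|/2\<pi>| \<le> C |I|^(2/3)\<close> for the number of rescaled points
  \<open>n \<theta>\<^sub>j\<close> in an interval \<open>I\<close>. Summation by parts then makes the tail of the sum of the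
  reciprocals uniformly small in \<open>n\<close>, and almost surely convergent in the limit.

  The law of the limit is exact already for finite \<open>n\<close>: by rotation invariance and analyticity
  \<open>E exp (- \<xi> S(\<rho>))\<close> does not depend on \<open>\<rho> < 1\<close>, hence equals \<open>exp (- \<xi>)\<close>, and letting \<open>\<rho>\<close> tend to \<open>1\<close> shows
  that \<open>(1/n) \<Sum> cot (\<theta>\<^sub>j / 2)\<close> has the standard Cauchy characteristic function. The case \<open>n = 1\<close>
  identifies it with the Cauchy density.\<close>

section \<open>Ward identities for the circular ensemble\<close>

text \<open>Convergence to the limit process is expressed only through Laplace functionals of
  nonnegative continuous test functions. An odd statistic is therefore split as
  \<open>L f - L g\<close> with \<open>g x = f (- x)\<close>, and whatever passes to the limit is
  written as a continuous function of \<open>exp (- L f)\<close> and \<open>exp (- L g)\<close>,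
  whose mixed moments are again Laplace functionals. The same limits yield the measurability of
  \<open>L f\<close> and a nonzero partition function for large \<open>n\<close>. The exponent 2/3
  balances three errors for a window of \<open>p^3\<close> rescaled units seen from distance
  \<open>p\<close>: the error \<open>1/p\<close> of \<open>S\<close> integrated over the window, the
  fraction \<open>1/p\<close> of its mass that each point loses outside, and the margin
  \<open>p^2\<close> that keeps this loss small. All are of order \<open>p^2\<close>. Any exponent
  below 1 would do, since summation by parts weighs the discrepancy at distance \<open>s\<close> by
  \<open>s^(-2)\<close>. The singularity of \<open>1/x\<close> at 0 is cut off at \<epsilon>: for
  finite \<open>n\<close> a closer point has probability O(\<epsilon>) by the intensity, and a
  locally finite limit configuration has a gap around 0.\<close>

lemma measurable_cbe_component [measurable]:
  "j < n \<Longrightarrow> (\<lambda>\<theta>. \<theta> j) \<in> borel_measurable (cbe_space n)"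
proof -
  assume j: "j < n"
  have "(\<lambda>\<theta>. \<theta> j) \<in> measurable (cbe_space n) (restrict_space lborel {-pi<..pi})"
    unfolding cbe_space_def using j by (intro measurable_component_singleton) auto
  moreover have "(\<lambda>x::real. x) \<in> measurable (restrict_space lborel {-pi<..pi}) borel"
    by (intro measurable_restrict_space1) auto
  ultimately show ?thesis
    by (rule measurable_compose)
qed

lemma space_cbe_space: "space (cbe_space n) = (\<Pi>\<^sub>E j\<in>{..<n}. {-pi<..pi})"
  unfolding cbe_space_def by (simp add: space_PiM space_restrict_space)

lemma emeasure_circle: "emeasure (restrict_space lborel {-pi<..pi}) A \<noteq> \<infinity>"
proof -
  have "emeasure (restrict_space lborel {-pi<..pi}) A \<le> emeasure (restrict_space lborel {-pi<..pi}) (space (restrict_space lborel {-pi<..pi}))"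
    by (rule emeasure_space)
  also have "\<dots> = emeasure lborel {-pi<..pi}"
    by (subst emeasure_restrict_space) (auto simp: space_restrict_space)
  also have "\<dots> < \<infinity>" by (simp add: emeasure_lborel_Ioc)
  finally show ?thesis by auto
qed

lemma finite_measure_circle: "finite_measure (restrict_space lborel {-pi<..pi})"
  by (rule finite_measureI) (rule emeasure_circle)

lemma product_sigma_finite_circle: "product_sigma_finite (\<lambda>_::nat. restrict_space lborel {-pi<..pi})"
  unfolding product_sigma_finite_def
  using finite_measure_circle by (simp add: finite_measure_def)

lemma finite_measure_cbe_space: "finite_measure (cbe_space n)"
proof -
  interpret product_sigma_finite "\<lambda>_::nat. restrict_space lborel {-pi<..pi}"
    by (rule product_sigma_finite_circle)
  show ?thesis
  proof (rule finite_measureI)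
    have "emeasure (cbe_space n) (space (cbe_space n)) =
       (\<Prod>j<n. emeasure (restrict_space lborel {-pi<..pi}) (space (restrict_space lborel {-pi<..pi})))"
      unfolding cbe_space_def space_PiM
      by (rule emeasure_PiM[where A="\<lambda>_. space (restrict_space lborel {-pi<..pi})"]) (auto intro: sets.top simp del: space_restrict_space2)
    then show "emeasure (cbe_space n) (space (cbe_space n)) \<noteq> \<infinity>"
      using emeasure_circle[of "{-pi<..pi}"] by (simp add: power_eq_top_ennreal)
  qed
qed

lemma cbe_integrable_bounded:
  fixes f :: "(nat \<Rightarrow> real) \<Rightarrow> 'b::{banach, second_countable_topology}"
  assumes "f \<in> borel_measurable (cbe_space n)"
    and "\<And>\<theta>. (\<And>j. j < n \<Longrightarrow> \<theta> j \<in> {-pi..pi}) \<Longrightarrow> norm (f \<theta>) \<le> B"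
  shows "integrable (cbe_space n) f"
proof (rule finite_measure.integrable_const_bound[OF finite_measure_cbe_space])
  show "AE \<theta> in cbe_space n. norm (f \<theta>) \<le> B"
    by (rule AE_I2, rule assms) (force simp: space_cbe_space PiE_iff)
qed fact

lemma integral_circle:
  fixes f :: "real \<Rightarrow> 'b::{banach, second_countable_topology}"
  shows "(\<integral>x. f x \<partial>restrict_space lborel {-pi<..pi}) = (\<integral>x. indicator {-pi<..pi} x *\<^sub>R f x \<partial>lborel)"
  by (rule integral_restrict_space) auto

text \<open>By Fubini the coordinate \<open>i\<close> is integrated first; the fundamental theorem
  of calculus then leaves \<Psi> at the two ends of \<open>{-pi..pi}\<close>, where it agrees by
  periodicity. The bound on \<open>D\<close> supplies the integrability that Fubini asks
  for.\<close>

lemma cbe_space_integral_partial_derivative: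
  fixes \<Psi> D :: "(nat \<Rightarrow> real) \<Rightarrow> 'b::euclidean_space"
  assumes i: "i < n"
    and deriv: "\<And>\<theta> t. t \<in> {-pi..pi} \<Longrightarrow>
      ((\<lambda>t. \<Psi> (\<theta>(i := t))) has_vector_derivative D (\<theta>(i := t))) (at t within {-pi..pi})"
    and per: "\<And>\<theta>. \<Psi> (\<theta>(i := pi)) = \<Psi> (\<theta>(i := -pi))"
    and meas: "D \<in> borel_measurable (cbe_space n)"
    and bnd: "\<And>\<theta>. (\<And>j. j < n \<Longrightarrow> \<theta> j \<in> {-pi..pi}) \<Longrightarrow> norm (D \<theta>) \<le> B"
  shows "(\<integral>\<theta>. D \<theta> \<partial>cbe_space n) = 0"
proof -
  interpret product_sigma_finite "\<lambda>_::nat. restrict_space lborel {-pi<..pi}"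
    by (rule product_sigma_finite_circle)
  have ins: "{..<n} = insert i ({..<n} - {i})" using i by auto
  have int: "integrable (Pi\<^sub>M (insert i ({..<n} - {i})) (\<lambda>_. restrict_space lborel {-pi<..pi})) D"
    using cbe_integrable_bounded[OF meas bnd] unfolding cbe_space_def ins[symmetric] .
  have "(\<integral>\<theta>. D \<theta> \<partial>cbe_space n) =
     (\<integral>\<theta>. (\<integral>t. D (\<theta>(i := t)) \<partial>restrict_space lborel {-pi<..pi})
        \<partial>Pi\<^sub>M ({..<n} - {i}) (\<lambda>_. restrict_space lborel {-pi<..pi}))"
    unfolding cbe_space_def by (subst ins, rule product_integral_insert[OF _ _ int]) auto
  also have "\<dots> = (\<integral>\<theta>. 0 \<partial>Pi\<^sub>M ({..<n} - {i}) (\<lambda>_. restrict_space lborel {-pi<..pi}))"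
  proof (rule Bochner_Integration.integral_cong[OF refl])
    fix \<theta> assume \<theta>: "\<theta> \<in> space (Pi\<^sub>M ({..<n} - {i}) (\<lambda>_. restrict_space lborel {-pi<..pi}))"
    let ?g = "\<lambda>t. indicator {-pi<..pi} t *\<^sub>R D (\<theta>(i := t))"
    have mm: "(\<lambda>t. D (\<theta>(i := t))) \<in> borel_measurable (restrict_space lborel {-pi<..pi})"
      using measurable_comp[OF measurable_component_update[OF \<theta>, of i] borel_measurable_integrable[OF int]]
      unfolding comp_def by auto
    then have m: "?g \<in> borel_measurable lborel"
      by (subst (asm) borel_measurable_restrict_space_iff) auto
    have "integrable lborel ?g"
    proof (rule Bochner_Integration.integrable_bound)
      show "integrable lborel (\<lambda>t. indicator {-pi<..pi} t *\<^sub>R B)" by simp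
      have "norm (D (\<theta>(i := t))) \<le> B" if "t \<in> {-pi<..pi}" for t
      proof (rule bnd)
        fix j assume "j < n"
        then show "(\<theta>(i := t)) j \<in> {-pi..pi}"
          using \<theta> that by (cases "j = i") (auto simp: space_PiM space_restrict_space PiE_iff less_imp_le)
      qed
      then show "AE t in lborel. norm (?g t) \<le> norm (indicator {-pi<..pi} t *\<^sub>R B)"
        by (intro AE_I2) (auto simp: indicator_def intro: order_trans[OF _ abs_ge_self])
    qed (use m in auto)
    then have "(?g has_integral (\<integral>t. ?g t \<partial>lborel)) UNIV" by (rule has_integral_integral_lborel)
    moreover have "((\<lambda>t. D (\<theta>(i := t))) has_integral \<Psi> (\<theta>(i := pi)) - \<Psi> (\<theta>(i := - pi))) {-pi..pi}"
      by (intro fundamental_theorem_of_calculus deriv) auto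
    \<comment> \<open>The space omits \<open>-pi\<close> while the antiderivative lives on the
      closed interval; the two differ by one null point.\<close>
    then have "(?g has_integral 0) {-pi..pi}"
      unfolding per by (subst has_integral_spike_eq[where S="{-pi}" and g="\<lambda>t. D (\<theta>(i := t))"])
        (auto simp: indicator_def)
    then have "(?g has_integral 0) UNIV"
      by (intro has_integral_on_superset[where T=UNIV and S="{-pi..pi}"]) auto
    ultimately show "(\<integral>t. D (\<theta>(i := t)) \<partial>restrict_space lborel {-pi<..pi}) = 0"
      unfolding integral_circle by (rule has_integral_unique)
  qed
  finally show ?thesis by simp
qed

text \<open>For \<open>\<beta> < 1\<close> the partial derivatives of the density are unbounded near the diagonal.
  Replacing the squared distances \<open>2 - 2 cos (\<theta>\<^sub>j - \<theta>\<^sub>k)\<close> by \<open>2 - 2 cos (\<theta>\<^sub>j - \<theta>\<^sub>k) + e\<close> makes the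
  integration by parts elementary.\<close>
definition reg_weight :: "real \<Rightarrow> nat \<Rightarrow> real \<Rightarrow> (nat \<Rightarrow> real) \<Rightarrow> real" where
  "reg_weight \<beta> n e \<theta> = exp (\<beta> / 2 * (\<Sum>j<n. \<Sum>k\<in>{j<..<n}. ln (2 - 2 * cos (\<theta> j - \<theta> k) + e)))"

lemma two_minus_two_cos: "0 \<le> 2 - 2 * cos x" "2 - 2 * cos (x::real) \<le> 4"
  using cos_le_one[of x] cos_ge_minus_one[of x] by linarith+

lemma cmod_cis_diff_sq: "(cmod (cis a - cis b))\<^sup>2 = 2 - 2 * cos (a - b)"
proof -
  have "(cmod (cis a - cis b))\<^sup>2 = (cos a - cos b)\<^sup>2 + (sin a - sin b)\<^sup>2"
    by (simp add: cmod_power2)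
  also have "\<dots> = ((sin a)\<^sup>2 + (cos a)\<^sup>2) + ((sin b)\<^sup>2 + (cos b)\<^sup>2) - 2 * (cos a * cos b + sin a * sin b)"
    by algebra
  finally show ?thesis
    unfolding cos_diff using sin_cos_squared_add[of a] sin_cos_squared_add[of b] by linarith
qed

lemma reg_weight_eq_prod:
  assumes "0 < e"
  shows "reg_weight \<beta> n e \<theta> = (\<Prod>j<n. \<Prod>k\<in>{j<..<n}. (2 - 2 * cos (\<theta> j - \<theta> k) + e) powr (\<beta> / 2))"
proof -
  have "0 < 2 - 2 * cos x + e" for x :: real
    using two_minus_two_cos[of x] assms by linarith
  then have "2 - 2 * cos x + e \<noteq> 0" for x :: real by (metis less_irrefl)
  then show ?thesis
    unfolding reg_weight_def by (simp add: exp_sum sum_distrib_left powr_def)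
qed

lemma cbe_weight_eq_prod:
  "cbe_weight \<beta> n \<theta> = (\<Prod>j<n. \<Prod>k\<in>{j<..<n}. (2 - 2 * cos (\<theta> j - \<theta> k)) powr (\<beta> / 2))"
  unfolding cbe_weight_def
proof (intro prod.cong refl)
  fix j k
  have "cmod (cis (\<theta> j) - cis (\<theta> k)) powr \<beta> = ((cmod (cis (\<theta> j) - cis (\<theta> k)))\<^sup>2) powr (\<beta> / 2)"
    by (simp add: powr_powr powr_realpow[symmetric] flip: powr_numeral)
  then show "cmod (cis (\<theta> j) - cis (\<theta> k)) powr \<beta> = (2 - 2 * cos (\<theta> j - \<theta> k)) powr (\<beta> / 2)"
    by (simp add: cmod_cis_diff_sq)
qed

lemma measurable_reg_weight [measurable]: "reg_weight \<beta> n e \<in> borel_measurable (cbe_space n)"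
  unfolding reg_weight_def by measurable

lemma measurable_cbe_weight [measurable]: "cbe_weight \<beta> n \<in> borel_measurable (cbe_space n)"
  unfolding cbe_weight_eq_prod by measurable

lemma cbe_weight_nonneg: "0 \<le> cbe_weight \<beta> n \<theta>"
  unfolding cbe_weight_def by (intro prod_nonneg) auto

lemma reg_weight_nonneg: "0 \<le> reg_weight \<beta> n e \<theta>"
  unfolding reg_weight_def by simp

text \<open>Independent of \<open>e\<close>, so that it can serve as a dominating bound when
  \<open>e\<close> tends to 0. The base 5 is 4 + 1.\<close>

lemma reg_weight_le:
  assumes "0 < e" "e \<le> 1" "0 < \<beta>"
  shows "reg_weight \<beta> n e \<theta> \<le> (\<Prod>j<n. \<Prod>k\<in>{j<..<n}. 5 powr (\<beta> / 2))"
  unfolding reg_weight_eq_prod[OF assms(1)]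
proof (intro prod_mono conjI prod_nonneg powr_mono2 ballI)
  fix j k show "2 - 2 * cos (\<theta> j - \<theta> k) + e \<le> 5"
    using two_minus_two_cos[of "\<theta> j - \<theta> k"] assms by linarith
  show "0 \<le> 2 - 2 * cos (\<theta> j - \<theta> k) + e"
    using two_minus_two_cos[of "\<theta> j - \<theta> k"] assms by linarith
qed (use assms in auto)

lemma cbe_weight_le:
  assumes "0 < \<beta>"
  shows "cbe_weight \<beta> n \<theta> \<le> (\<Prod>j<n. \<Prod>k\<in>{j<..<n}. 4 powr (\<beta> / 2))"
  unfolding cbe_weight_eq_prod
  by (intro prod_mono conjI prod_nonneg powr_mono2 ballI two_minus_two_cos) (use assms in auto)

lemma reg_weight_tendsto:
  assumes "0 < \<beta>"
  shows "(\<lambda>N. reg_weight \<beta> n (1 / real (Suc N)) \<theta>) \<longlonglongrightarrow> cbe_weight \<beta> n \<theta>"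
proof -
  have "(\<lambda>N. \<Prod>j<n. \<Prod>k\<in>{j<..<n}. (2 - 2 * cos (\<theta> j - \<theta> k) + 1 / real (Suc N)) powr (\<beta> / 2))
     \<longlonglongrightarrow> (\<Prod>j<n. \<Prod>k\<in>{j<..<n}. (2 - 2 * cos (\<theta> j - \<theta> k) + 0) powr (\<beta> / 2))"
  proof (intro tendsto_prod tendsto_powr' tendsto_add tendsto_const)
    show "(\<lambda>N. 1 / real (Suc N)) \<longlonglongrightarrow> 0"
      using LIMSEQ_inverse_real_of_nat by (simp add: inverse_eq_divide)
  next
    fix j k
    \<comment> \<open>For coincident points the base tends to 0 through nonnegative values, where
      \<open>powr\<close> is continuous because the exponent \<open>\<beta> / 2\<close> is
      positive.\<close>
    show "2 - 2 * cos (\<theta> j - \<theta> k) + 0 \<noteq> 0 \<or> 0 < \<beta> / 2 \<and>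
       (\<forall>\<^sub>F N in sequentially. 0 \<le> 2 - 2 * cos (\<theta> j - \<theta> k) + 1 / real (Suc N))"
      using assms two_minus_two_cos[of "\<theta> j - \<theta> k"] by (auto intro!: always_eventually add_nonneg_nonneg)
  qed
  then show ?thesis
    by (simp add: reg_weight_eq_prod cbe_weight_eq_prod)
qed

text \<open>The variable \<open>t\<close> enters a pair \<open>(j, k)\<close> through
  \<open>j = i\<close> or through \<open>k = i\<close>, with opposite signs; the difference of the
  two \<open>of_bool\<close> terms records which.\<close>

lemma reg_weight_partial_derivative:
  assumes "0 < e"
  shows "((\<lambda>t. reg_weight \<beta> n e (\<theta>(i := t))) has_field_derivative
     reg_weight \<beta> n e (\<theta>(i := t)) * (\<beta> / 2 * (\<Sum>j<n. \<Sum>k\<in>{j<..<n}.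
        2 * sin ((\<theta>(i := t)) j - (\<theta>(i := t)) k) / (2 - 2 * cos ((\<theta>(i := t)) j - (\<theta>(i := t)) k) + e)
          * (of_bool (j = i) - of_bool (k = i))))) (at t within X)"
proof -
  have pos: "0 < 2 - 2 * cos x + e" for x :: real
    using two_minus_two_cos[of x] assms by linarith
  have c: "((\<lambda>t. (\<theta>(i := t)) j) has_field_derivative of_bool (j = i)) (at t within X)" for j
    by (cases "j = i") auto
  have "((\<lambda>t. ln (2 - 2 * cos ((\<theta>(i := t)) j - (\<theta>(i := t)) k) + e)) has_field_derivative
       2 * sin ((\<theta>(i := t)) j - (\<theta>(i := t)) k) / (2 - 2 * cos ((\<theta>(i := t)) j - (\<theta>(i := t)) k) + e)
          * (of_bool (j = i) - of_bool (k = i))) (at t within X)" for j k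
    by (rule derivative_eq_intros c refl pos | simp only: divide_inverse)+ (simp add: algebra_simps)
  then have "((\<lambda>t. (\<Sum>j<n. \<Sum>k\<in>{j<..<n}. ln (2 - 2 * cos ((\<theta>(i := t)) j - (\<theta>(i := t)) k) + e))) has_field_derivative
     (\<Sum>j<n. \<Sum>k\<in>{j<..<n}.
        2 * sin ((\<theta>(i := t)) j - (\<theta>(i := t)) k) / (2 - 2 * cos ((\<theta>(i := t)) j - (\<theta>(i := t)) k) + e)
          * (of_bool (j = i) - of_bool (k = i)))) (at t within X)"
    by (intro DERIV_sum) auto
  from DERIV_chain2[OF DERIV_exp DERIV_cmult[OF this, of "\<beta> / 2"]]
  show ?thesis unfolding reg_weight_def .
qed

text \<open>\<open>v\<close> is a vector field on the circle, and the integrand is the divergence of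
  \<open>G v\<close> with respect to the weight. The logarithmic derivative of the weight
  contributes \<open>(v a - v b) cot ((a - b) / 2)\<close>. Since
  \<open>cot (x / 2) = sin x / (1 - cos x)\<close>, the assumption on \<open>q\<close> says that
  \<open>q\<close> is this product, stated without a division and so without a condition where the
  two points coincide.\<close>

theorem ward_identity:
  fixes v v' :: "real \<Rightarrow> complex" and q :: "real \<Rightarrow> real \<Rightarrow> complex"
    and G :: "(nat \<Rightarrow> real) \<Rightarrow> complex" and G' :: "nat \<Rightarrow> (nat \<Rightarrow> real) \<Rightarrow> complex"
  assumes beta: "0 < \<beta>"
    and v: "\<And>t. t \<in> {-pi..pi} \<Longrightarrow> (v has_vector_derivative v' t) (at t within {-pi..pi})" "v pi = v (-pi)"
    and q: "\<And>a b. (v a - v b) * of_real (sin (a - b)) = q a b * of_real (1 - cos (a - b))"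
    and G: "\<And>\<theta> i t. i < n \<Longrightarrow> t \<in> {-pi..pi} \<Longrightarrow>
         ((\<lambda>t. G (\<theta>(i := t))) has_vector_derivative G' i (\<theta>(i := t))) (at t within {-pi..pi})"
      "\<And>\<theta> i. i < n \<Longrightarrow> G (\<theta>(i := pi)) = G (\<theta>(i := -pi))"
    and meas [measurable]: "v \<in> borel_measurable borel" "v' \<in> borel_measurable borel"
      "(\<lambda>(a, b). q a b) \<in> borel_measurable (borel \<Otimes>\<^sub>M borel)"
      "G \<in> borel_measurable (cbe_space n)" "\<And>i. i < n \<Longrightarrow> G' i \<in> borel_measurable (cbe_space n)"
    and bnd: "\<And>t. t \<in> {-pi..pi} \<Longrightarrow> norm (v t) \<le> B" "\<And>t. t \<in> {-pi..pi} \<Longrightarrow> norm (v' t) \<le> B"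
      "\<And>a b. a \<in> {-pi..pi} \<Longrightarrow> b \<in> {-pi..pi} \<Longrightarrow> norm (q a b) \<le> B"
      "\<And>\<theta>. (\<And>j. j < n \<Longrightarrow> \<theta> j \<in> {-pi..pi}) \<Longrightarrow> norm (G \<theta>) \<le> B"
      "\<And>\<theta> i. i < n \<Longrightarrow> (\<And>j. j < n \<Longrightarrow> \<theta> j \<in> {-pi..pi}) \<Longrightarrow> norm (G' i \<theta>) \<le> B"
  shows "(\<integral>\<theta>. cbe_weight \<beta> n \<theta> *\<^sub>R
     (G \<theta> * ((\<Sum>i<n. v' (\<theta> i)) + complex_of_real (\<beta> / 2) * (\<Sum>j<n. \<Sum>k\<in>{j<..<n}. q (\<theta> j) (\<theta> k)))
      + (\<Sum>i<n. v (\<theta> i) * G' i \<theta>)) \<partial>cbe_space n) = 0"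
proof -
  have B0: "0 \<le> B" using bnd(1)[of 0] by (smt (verit) norm_ge_zero pi_ge_zero atLeastAtMost_iff)
  define K where "K = (\<Prod>j<n. \<Prod>k\<in>{j<..<n}. 5 powr (\<beta> / 2))"
  have K0: "0 \<le> K" unfolding K_def by (intro prod_nonneg) auto
  \<comment> \<open>\<open>\<phi>\<close> is the regularised cotangent, bounded only by
    \<open>2 / e\<close>. Multiplied by \<open>v (\<theta> j) - v (\<theta> k)\<close> it becomes
    \<open>R\<close> times \<open>q\<close>, and \<open>R\<close> stays in \<open>{0..1}\<close> for
    every \<open>e\<close>. This uniform bound is what allows \<open>e\<close> to tend to 0 under
    the integral.\<close>
  define \<phi> :: "real \<Rightarrow> (nat \<Rightarrow> real) \<Rightarrow> nat \<Rightarrow> nat \<Rightarrow> real" where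
    "\<phi> e \<theta> j k = 2 * sin (\<theta> j - \<theta> k) / (2 - 2 * cos (\<theta> j - \<theta> k) + e)" for e \<theta> j k
  define R :: "real \<Rightarrow> (nat \<Rightarrow> real) \<Rightarrow> nat \<Rightarrow> nat \<Rightarrow> real" where
    "R e \<theta> j k = (2 - 2 * cos (\<theta> j - \<theta> k)) / (2 - 2 * cos (\<theta> j - \<theta> k) + e)" for e \<theta> j k
  have [measurable]: "(\<lambda>\<theta>. \<phi> e \<theta> j k) \<in> borel_measurable (cbe_space n)" "(\<lambda>\<theta>. R e \<theta> j k) \<in> borel_measurable (cbe_space n)"
    if "j < n" "k < n" for e j k
    using that unfolding \<phi>_def R_def by measurable
  have [measurable]: "(\<lambda>\<theta>. q (\<theta> j) (\<theta> k)) \<in> borel_measurable (cbe_space n)" if "j < n" "k < n" for j k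
  proof -
    have "(\<lambda>\<theta>. (\<lambda>(a, b). q a b) (\<theta> j, \<theta> k)) \<in> borel_measurable (cbe_space n)"
      using that by measurable
    then show ?thesis by simp
  qed
  have R01: "0 \<le> R e \<theta> j k" "R e \<theta> j k \<le> 1" if "0 < e" for e \<theta> j k
    unfolding R_def using two_minus_two_cos(1)[of "\<theta> j - \<theta> k"] that
    by (auto simp del: diff_ge_0_iff_ge intro!: divide_nonneg_nonneg divide_le_eq_1[THEN iffD2])
  have Rnorm: "\<bar>R e \<theta> j k\<bar> \<le> 1" if "0 < e" for e \<theta> j k
    using R01[OF that] by simp
  define T where "T e \<theta> = reg_weight \<beta> n e \<theta> *\<^sub>R
     (G \<theta> * ((\<Sum>i<n. v' (\<theta> i)) + complex_of_real (\<beta> / 2) * (\<Sum>j<n. \<Sum>k\<in>{j<..<n}. R e \<theta> j k *\<^sub>R q (\<theta> j) (\<theta> k)))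
      + (\<Sum>i<n. v (\<theta> i) * G' i \<theta>))" for e \<theta>
  have [measurable]: "T e \<in> borel_measurable (cbe_space n)" for e
    unfolding T_def by measurable
  have T0: "(\<integral>\<theta>. T e \<theta> \<partial>cbe_space n) = 0" if e: "0 < e" "e \<le> 1" for e
  proof -
    define D where "D i \<theta> = reg_weight \<beta> n e \<theta> *\<^sub>R (v (\<theta> i) * G' i \<theta> + v' (\<theta> i) * G \<theta>) +
       (reg_weight \<beta> n e \<theta> * (\<beta> / 2 * (\<Sum>j<n. \<Sum>k\<in>{j<..<n}. \<phi> e \<theta> j k * (of_bool (j = i) - of_bool (k = i)))))
          *\<^sub>R (v (\<theta> i) * G \<theta>)" for i \<theta>
    have [measurable]: "D i \<in> borel_measurable (cbe_space n)" if "i < n" for i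
      using that unfolding D_def by measurable
    have phib: "\<bar>\<phi> e \<theta> j k\<bar> \<le> 2 / e" for \<theta> j k
    proof -
      have "\<bar>2 * sin (\<theta> j - \<theta> k)\<bar> \<le> 2"
        using abs_sin_le_one[of "\<theta> j - \<theta> k"] by (simp add: abs_mult)
      moreover have "e \<le> \<bar>2 - 2 * cos (\<theta> j - \<theta> k) + e\<bar>"
        using two_minus_two_cos[of "\<theta> j - \<theta> k"] e by linarith
      ultimately show ?thesis
        unfolding \<phi>_def abs_divide using e by (intro frac_le) auto
    qed
    define B' where "B' = K * (B * B + B * B) + K * (\<beta> / 2 * (\<Sum>j<n. \<Sum>k\<in>{j<..<n}. 2 / e)) * (B * B)"
    have Db: "norm (D i \<theta>) \<le> B'" if i: "i < n" and box: "\<And>j. j < n \<Longrightarrow> \<theta> j \<in> {-pi..pi}" for i \<theta>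
    proof -
      have W: "\<bar>reg_weight \<beta> n e \<theta>\<bar> \<le> K"
        using reg_weight_nonneg reg_weight_le[OF e beta] unfolding K_def by auto
      have "\<bar>\<Sum>j<n. \<Sum>k\<in>{j<..<n}. \<phi> e \<theta> j k * (of_bool (j = i) - of_bool (k = i))\<bar> \<le> (\<Sum>j<n. \<Sum>k\<in>{j<..<n}. 2 / e)"
      proof (intro order_trans[OF sum_abs] sum_mono)
        fix j k
        have "\<bar>\<phi> e \<theta> j k * (of_bool (j = i) - of_bool (k = i))\<bar> \<le> 2 / e * 1"
          unfolding abs_mult using e by (intro mult_mono phib) auto
        then show "\<bar>\<phi> e \<theta> j k * (of_bool (j = i) - of_bool (k = i))\<bar> \<le> 2 / e" by simp
      qed
      then have S: "\<bar>\<beta> / 2 * (\<Sum>j<n. \<Sum>k\<in>{j<..<n}. \<phi> e \<theta> j k * (of_bool (j = i) - of_bool (k = i)))\<bar>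
           \<le> \<beta> / 2 * (\<Sum>j<n. \<Sum>k\<in>{j<..<n}. 2 / e)"
        using beta by (simp add: abs_mult)
      have S0: "0 \<le> \<beta> / 2 * (\<Sum>j<n. \<Sum>k\<in>{j<..<n}. 2 / e)" using S by linarith
      note b = bnd(1)[OF box[OF i]] bnd(2)[OF box[OF i]] bnd(4)[OF box] bnd(5)[OF i box]
      show ?thesis
        unfolding D_def B'_def
        by (intro order_trans[OF norm_triangle_ineq] add_mono)
          (simp_all only: norm_scaleR abs_mult norm_mult,
           (intro mult_mono add_mono order_trans[OF norm_triangle_ineq] W S[unfolded abs_mult] b
            order_trans[OF eq_refl[OF norm_mult]] B0 K0 S0 mult_nonneg_nonneg | simp)+)
    qed
    have Dint: "(\<integral>\<theta>. D i \<theta> \<partial>cbe_space n) = 0" if i: "i < n" for i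
    proof (rule cbe_space_integral_partial_derivative[where \<Psi> = "\<lambda>\<theta>. reg_weight \<beta> n e \<theta> *\<^sub>R (v (\<theta> i) * G \<theta>)", OF i])
      fix \<theta> t assume t: "t \<in> {-pi..pi}"
      have "((\<lambda>t. v t * G (\<theta>(i := t))) has_vector_derivative
          v t * G' i (\<theta>(i := t)) + v' t * G (\<theta>(i := t))) (at t within {-pi..pi})"
        by (intro has_vector_derivative_mult v G i t)
      from has_vector_derivative_scaleR[OF reg_weight_partial_derivative[OF e(1), where i = i and \<theta> = \<theta> and n = n and \<beta> = \<beta>] this]
      show "((\<lambda>t. reg_weight \<beta> n e (\<theta>(i := t)) *\<^sub>R (v ((\<theta>(i := t)) i) * G (\<theta>(i := t)))) has_vector_derivative
          D i (\<theta>(i := t))) (at t within {-pi..pi})"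
        unfolding D_def \<phi>_def by simp
    next
      fix \<theta>
      have "reg_weight \<beta> n e (\<theta>(i := pi)) = reg_weight \<beta> n e (\<theta>(i := -pi))"
        unfolding reg_weight_def by (auto intro!: sum.cong arg_cong[where f = exp] arg_cong[where f = ln] simp: cos_diff)
      then show "reg_weight \<beta> n e (\<theta>(i := pi)) *\<^sub>R (v ((\<theta>(i := pi)) i) * G (\<theta>(i := pi))) =
           reg_weight \<beta> n e (\<theta>(i := -pi)) *\<^sub>R (v ((\<theta>(i := -pi)) i) * G (\<theta>(i := -pi)))"
        using v(2) G(2)[OF i] by simp
    qed (use i Db in auto)
    have "T e \<theta> = (\<Sum>i<n. D i \<theta>)" for \<theta>
    proof -
      have R: "R e \<theta> j k *\<^sub>R q (\<theta> j) (\<theta> k) = \<phi> e \<theta> j k *\<^sub>R (v (\<theta> j) - v (\<theta> k))" for j k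
      proof -
        let ?d = "2 - 2 * cos (\<theta> j - \<theta> k) + e"
        have "R e \<theta> j k *\<^sub>R q (\<theta> j) (\<theta> k) = (2 / ?d) *\<^sub>R (q (\<theta> j) (\<theta> k) * of_real (1 - cos (\<theta> j - \<theta> k)))"
          unfolding R_def scaleR_conv_of_real by (simp add: algebra_simps)
        also have "\<dots> = (2 / ?d) *\<^sub>R ((v (\<theta> j) - v (\<theta> k)) * of_real (sin (\<theta> j - \<theta> k)))"
          by (simp only: q)
        also have "\<dots> = \<phi> e \<theta> j k *\<^sub>R (v (\<theta> j) - v (\<theta> k))"
          unfolding \<phi>_def scaleR_conv_of_real by (simp add: algebra_simps diff_divide_distrib)
        finally show ?thesis .
      qed
      \<comment> \<open>A pair \<open>(j, k)\<close> acts on coordinate \<open>j\<close> with plus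
        and on coordinate \<open>k\<close> with minus, so the sum over all coordinates pairs the
        singular factor with the difference of \<open>v\<close> at the two points.\<close>
      have "(\<Sum>i<n. (\<Sum>j<n. \<Sum>k\<in>{j<..<n}. \<phi> e \<theta> j k * (of_bool (j = i) - of_bool (k = i))) *\<^sub>R v (\<theta> i)) =
        (\<Sum>i<n. \<Sum>j<n. \<Sum>k\<in>{j<..<n}. \<phi> e \<theta> j k *\<^sub>R ((of_bool (j = i) - of_bool (k = i)) *\<^sub>R v (\<theta> i)))"
        by (simp add: scaleR_sum_left)
      also have "\<dots> = (\<Sum>j<n. \<Sum>k\<in>{j<..<n}. \<Sum>i<n. \<phi> e \<theta> j k *\<^sub>R ((of_bool (j = i) - of_bool (k = i)) *\<^sub>R v (\<theta> i)))"
        by (rule trans[OF sum.swap]) (rule sum.cong[OF refl], rule sum.swap)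
      also have "\<dots> = (\<Sum>j<n. \<Sum>k\<in>{j<..<n}. \<phi> e \<theta> j k *\<^sub>R (v (\<theta> j) - v (\<theta> k)))"
      proof (intro sum.cong refl)
        fix j k assume jk: "j \<in> {..<n}" "k \<in> {j<..<n}"
        have "(\<Sum>i<n. (of_bool (j = i) - of_bool (k = i)) *\<^sub>R v (\<theta> i)) =
          (\<Sum>i<n. (if i = j then v (\<theta> i) else 0)) - (\<Sum>i<n. (if i = k then v (\<theta> i) else 0))"
          by (simp only: sum_subtractf[symmetric]) (intro sum.cong, auto)
        then have "(\<Sum>i<n. (of_bool (j = i) - of_bool (k = i)) *\<^sub>R v (\<theta> i)) = v (\<theta> j) - v (\<theta> k)"
          using jk by simp
        then show "(\<Sum>i<n. \<phi> e \<theta> j k *\<^sub>R ((of_bool (j = i) - of_bool (k = i)) *\<^sub>R v (\<theta> i))) = \<phi> e \<theta> j k *\<^sub>R (v (\<theta> j) - v (\<theta> k))"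
          by (simp only: scaleR_sum_right[symmetric])
      qed
      finally have E: "(\<Sum>j<n. \<Sum>k\<in>{j<..<n}. R e \<theta> j k *\<^sub>R q (\<theta> j) (\<theta> k)) =
         (\<Sum>i<n. (\<Sum>j<n. \<Sum>k\<in>{j<..<n}. \<phi> e \<theta> j k * (of_bool (j = i) - of_bool (k = i))) *\<^sub>R v (\<theta> i))"
        by (simp add: R)
      show ?thesis
        unfolding T_def E D_def
        by (simp add: sum.distrib scaleR_conv_of_real sum_distrib_left sum_distrib_right algebra_simps)
    qed
    then have "(\<integral>\<theta>. T e \<theta> \<partial>cbe_space n) = (\<integral>\<theta>. (\<Sum>i<n. D i \<theta>) \<partial>cbe_space n)" by simp
    also have "\<dots> = (\<Sum>i<n. \<integral>\<theta>. D i \<theta> \<partial>cbe_space n)"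
      by (rule Bochner_Integration.integral_sum, rule cbe_integrable_bounded[where B = B']) (use Db in auto)
    finally show ?thesis using Dint by simp
  qed
  define T' where "T' \<theta> = cbe_weight \<beta> n \<theta> *\<^sub>R
     (G \<theta> * ((\<Sum>i<n. v' (\<theta> i)) + complex_of_real (\<beta> / 2) * (\<Sum>j<n. \<Sum>k\<in>{j<..<n}. q (\<theta> j) (\<theta> k)))
      + (\<Sum>i<n. v (\<theta> i) * G' i \<theta>))" for \<theta>
  have [measurable]: "T' \<in> borel_measurable (cbe_space n)"
    unfolding T'_def by measurable
  \<comment> \<open>Unlike the bound used for a single \<open>D i\<close>, this one does not involve
    \<open>e\<close>.\<close>
  define B' where "B' = K * (B * ((\<Sum>i<n. B) + \<beta> / 2 * (\<Sum>j<n. \<Sum>k\<in>{j<..<n}. B)) + (\<Sum>i<n. B * B))"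
  have Tb: "norm (T e \<theta>) \<le> B'" if e: "0 < e" "e \<le> 1" and box: "\<And>j. j < n \<Longrightarrow> \<theta> j \<in> {-pi..pi}" for e \<theta>
  proof -
    have W: "\<bar>reg_weight \<beta> n e \<theta>\<bar> \<le> K"
      using reg_weight_nonneg reg_weight_le[OF e beta] unfolding K_def by auto
    have 1: "norm (\<Sum>j<n. \<Sum>k\<in>{j<..<n}. R e \<theta> j k *\<^sub>R q (\<theta> j) (\<theta> k)) \<le> (\<Sum>j<n. \<Sum>k\<in>{j<..<n}. B)"
    proof (intro sum_norm_le)
      fix j k assume "j \<in> {..<n}" "k \<in> {j<..<n}"
      then have "\<bar>R e \<theta> j k\<bar> * norm (q (\<theta> j) (\<theta> k)) \<le> 1 * B"
        by (intro mult_mono Rnorm e bnd(3) box) auto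
      then show "norm (R e \<theta> j k *\<^sub>R q (\<theta> j) (\<theta> k)) \<le> B" by simp
    qed
    have "norm (complex_of_real (\<beta> / 2) * (\<Sum>j<n. \<Sum>k\<in>{j<..<n}. R e \<theta> j k *\<^sub>R q (\<theta> j) (\<theta> k))) =
        \<beta> / 2 * norm (\<Sum>j<n. \<Sum>k\<in>{j<..<n}. R e \<theta> j k *\<^sub>R q (\<theta> j) (\<theta> k))"
      using beta by (simp add: norm_mult)
    also have "\<dots> \<le> \<beta> / 2 * (\<Sum>j<n. \<Sum>k\<in>{j<..<n}. B)"
      using beta by (intro mult_left_mono 1) auto
    finally have 2: "norm (complex_of_real (\<beta> / 2) * (\<Sum>j<n. \<Sum>k\<in>{j<..<n}. R e \<theta> j k *\<^sub>R q (\<theta> j) (\<theta> k))) \<le> \<dots>" .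
    have 3: "norm (\<Sum>i<n. v' (\<theta> i)) \<le> (\<Sum>i<n. B)"
      by (intro sum_norm_le bnd box) auto
    have 4: "norm (\<Sum>i<n. v (\<theta> i) * G' i \<theta>) \<le> (\<Sum>i<n. B * B)"
      unfolding norm_mult by (intro sum_norm_le order_trans[OF eq_refl[OF norm_mult]] mult_mono bnd box B0) auto
    have "norm (G \<theta> * ((\<Sum>i<n. v' (\<theta> i)) + complex_of_real (\<beta> / 2) * (\<Sum>j<n. \<Sum>k\<in>{j<..<n}. R e \<theta> j k *\<^sub>R q (\<theta> j) (\<theta> k)))
      + (\<Sum>i<n. v (\<theta> i) * G' i \<theta>)) \<le> B * ((\<Sum>i<n. B) + \<beta> / 2 * (\<Sum>j<n. \<Sum>k\<in>{j<..<n}. B)) + (\<Sum>i<n. B * B)"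
    proof (rule order_trans[OF norm_triangle_ineq add_mono[OF _ 4]])
      show "norm (G \<theta> * ((\<Sum>i<n. v' (\<theta> i)) + complex_of_real (\<beta> / 2) * (\<Sum>j<n. \<Sum>k\<in>{j<..<n}. R e \<theta> j k *\<^sub>R q (\<theta> j) (\<theta> k))))
        \<le> B * ((\<Sum>i<n. B) + \<beta> / 2 * (\<Sum>j<n. \<Sum>k\<in>{j<..<n}. B))"
        unfolding norm_mult
        by (rule mult_mono[OF bnd(4)[OF box] order_trans[OF norm_triangle_ineq add_mono[OF 3 2]] B0 norm_ge_zero]) auto
    qed
    then show ?thesis
      unfolding T_def B'_def norm_scaleR using W K0 by (intro mult_mono) auto
  qed
  have lim: "(\<lambda>N. T (1 / real (Suc N)) \<theta>) \<longlonglongrightarrow> T' \<theta>" for \<theta>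
  proof -
    note W = reg_weight_tendsto[OF beta, of n \<theta>]
    have "(\<lambda>N. reg_weight \<beta> n (1 / real (Suc N)) \<theta> *\<^sub>R (R (1 / real (Suc N)) \<theta> j k *\<^sub>R q (\<theta> j) (\<theta> k)))
        \<longlonglongrightarrow> cbe_weight \<beta> n \<theta> *\<^sub>R q (\<theta> j) (\<theta> k)" if jk: "j < n" "k \<in> {j<..<n}" for j k
    proof (cases "2 - 2 * cos (\<theta> j - \<theta> k) = 0")
      case True
      \<comment> \<open>On the diagonal \<open>R\<close> is 0 for every \<open>N\<close> instead of
        tending to 1, but there the weight vanishes as well, so both sides are 0.\<close>
      then have "cbe_weight \<beta> n \<theta> = 0"
        unfolding cbe_weight_eq_prod using jk by (intro prod_zero bexI[of _ j] bexI[of _ k]) auto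
      moreover have "R (1 / real (Suc N)) \<theta> j k = 0" for N
        unfolding R_def True by simp
      ultimately show ?thesis by simp
    next
      case False
      have "(\<lambda>N. 1 / real (Suc N)) \<longlonglongrightarrow> 0"
        using LIMSEQ_inverse_real_of_nat by (simp add: inverse_eq_divide)
      then have "(\<lambda>N. R (1 / real (Suc N)) \<theta> j k) \<longlonglongrightarrow> (2 - 2 * cos (\<theta> j - \<theta> k)) / (2 - 2 * cos (\<theta> j - \<theta> k) + 0)"
        unfolding R_def using False by (intro tendsto_divide tendsto_add tendsto_const) auto
      then have "(\<lambda>N. R (1 / real (Suc N)) \<theta> j k) \<longlonglongrightarrow> 1" using False by simp
      from tendsto_scaleR[OF W tendsto_scaleR[OF this tendsto_const]]
      show ?thesis by simp
    qed
    then have "(\<lambda>N. \<Sum>j<n. \<Sum>k\<in>{j<..<n}. reg_weight \<beta> n (1 / real (Suc N)) \<theta> *\<^sub>R (R (1 / real (Suc N)) \<theta> j k *\<^sub>R q (\<theta> j) (\<theta> k)))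
        \<longlonglongrightarrow> (\<Sum>j<n. \<Sum>k\<in>{j<..<n}. cbe_weight \<beta> n \<theta> *\<^sub>R q (\<theta> j) (\<theta> k))"
      by (intro tendsto_sum) auto
    then have *: "(\<lambda>N. reg_weight \<beta> n (1 / real (Suc N)) \<theta> *\<^sub>R (\<Sum>j<n. \<Sum>k\<in>{j<..<n}. R (1 / real (Suc N)) \<theta> j k *\<^sub>R q (\<theta> j) (\<theta> k)))
        \<longlonglongrightarrow> cbe_weight \<beta> n \<theta> *\<^sub>R (\<Sum>j<n. \<Sum>k\<in>{j<..<n}. q (\<theta> j) (\<theta> k))"
      by (simp only: scaleR_sum_right)
    have "(\<lambda>N. reg_weight \<beta> n (1 / real (Suc N)) \<theta> *\<^sub>R (G \<theta> * (\<Sum>i<n. v' (\<theta> i)) + (\<Sum>i<n. v (\<theta> i) * G' i \<theta>)) +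
       (\<beta> / 2 * G \<theta>) * (reg_weight \<beta> n (1 / real (Suc N)) \<theta> *\<^sub>R (\<Sum>j<n. \<Sum>k\<in>{j<..<n}. R (1 / real (Suc N)) \<theta> j k *\<^sub>R q (\<theta> j) (\<theta> k))))
       \<longlonglongrightarrow> cbe_weight \<beta> n \<theta> *\<^sub>R (G \<theta> * (\<Sum>i<n. v' (\<theta> i)) + (\<Sum>i<n. v (\<theta> i) * G' i \<theta>)) +
       (\<beta> / 2 * G \<theta>) * (cbe_weight \<beta> n \<theta> *\<^sub>R (\<Sum>j<n. \<Sum>k\<in>{j<..<n}. q (\<theta> j) (\<theta> k)))"
      by (intro tendsto_intros W *)
    then show ?thesis
      unfolding T_def T'_def by (simp add: algebra_simps scaleR_conv_of_real)
  qed
  have "(\<lambda>N. \<integral>\<theta>. T (1 / real (Suc N)) \<theta> \<partial>cbe_space n) \<longlonglongrightarrow> (\<integral>\<theta>. T' \<theta> \<partial>cbe_space n)"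
  proof (rule integral_dominated_convergence[where w = "\<lambda>_. B'"])
    show "integrable (cbe_space n) (\<lambda>_. B')"
      by (rule finite_measure.integrable_const[OF finite_measure_cbe_space])
    fix N
    show "AE \<theta> in cbe_space n. norm (T (1 / real (Suc N)) \<theta>) \<le> B'"
      by (rule AE_I2, rule Tb) (force simp: space_cbe_space PiE_iff)+
  qed (use lim in auto)
  then have "(\<integral>\<theta>. T' \<theta> \<partial>cbe_space n) = 0"
    using T0 by (simp add: LIMSEQ_const_iff)
  then show ?thesis unfolding T'_def .
qed

section \<open>Concentration of the Herglotz transform\<close>

definition herglotz_kernel :: "complex \<Rightarrow> real \<Rightarrow> complex" where
  "herglotz_kernel w t = (cis t + w) / (cis t - w)"

text \<open>The derivative of the kernel in the angle, written as a polynomial in the kernel so that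
  it has the same shape as the pair terms \<open>H j * H k - 1\<close> and can be combined with
  them.\<close>

definition herglotz_kernel' :: "complex \<Rightarrow> real \<Rightarrow> complex" where
  "herglotz_kernel' w t = - (\<i> / 2) * ((herglotz_kernel w t)\<^sup>2 - 1)"

lemma cis_neq_interior: "cmod w < 1 \<Longrightarrow> cis t - w \<noteq> 0"
  by (metis norm_cis right_minus_eq less_irrefl)

lemma continuous_on_herglotz_kernel: "cmod w < 1 \<Longrightarrow> continuous_on X (herglotz_kernel w)"
  unfolding herglotz_kernel_def using cis_neq_interior[of w]
  by (auto intro!: continuous_intros)

lemma continuous_on_herglotz_kernel': "cmod w < 1 \<Longrightarrow> continuous_on X (herglotz_kernel' w)"
  unfolding herglotz_kernel'_def by (intro continuous_intros continuous_on_herglotz_kernel)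

lemma measurable_herglotz_kernel: "cmod w < 1 \<Longrightarrow> herglotz_kernel w \<in> borel_measurable borel"
  by (intro borel_measurable_continuous_onI continuous_on_herglotz_kernel)

lemma measurable_herglotz_kernel': "cmod w < 1 \<Longrightarrow> herglotz_kernel' w \<in> borel_measurable borel"
  by (intro borel_measurable_continuous_onI continuous_on_herglotz_kernel')

lemma herglotz_kernel_sq_minus_1:
  assumes "cmod w < 1"
  shows "(herglotz_kernel w t)\<^sup>2 - 1 = 4 * cis t * w / (cis t - w)\<^sup>2"
  using cis_neq_interior[OF assms, of t] unfolding herglotz_kernel_def
  by (simp add: divide_simps power2_eq_square) (simp add: algebra_simps)

lemma herglotz_kernel_deriv:
  assumes "cmod w < 1"
  shows "(herglotz_kernel w has_vector_derivative herglotz_kernel' w t) (at t within X)"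
proof -
  have nz: "cis t - w \<noteq> 0" using cis_neq_interior[OF assms] .
  have "(cis has_vector_derivative \<i> * cis t) (at t within X)"
    unfolding has_vector_derivative_complex_iff by (auto intro!: derivative_eq_intros)
  then have c: "(cis has_derivative (\<lambda>h. h *\<^sub>R (\<i> * cis t))) (at t within X)"
    by (simp add: has_vector_derivative_def)
  have "(herglotz_kernel w has_vector_derivative ((\<i> * cis t) * (cis t - w) - (cis t + w) * (\<i> * cis t)) / (cis t - w)\<^sup>2) (at t within X)"
    unfolding herglotz_kernel_def has_vector_derivative_def
    by (rule derivative_eq_intros c nz refl)+
       (use nz in \<open>auto simp: fun_eq_iff scaleR_conv_of_real divide_simps power2_eq_square algebra_simps\<close>)
  moreover have "((\<i> * cis t) * (cis t - w) - (cis t + w) * (\<i> * cis t)) / (cis t - w)\<^sup>2 = herglotz_kernel' w t"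
    unfolding herglotz_kernel'_def herglotz_kernel_sq_minus_1[OF assms]
    using nz by (simp add: divide_simps power2_eq_square) (simp add: algebra_simps)
  ultimately show ?thesis by simp
qed

text \<open>The division-free form that the Ward identity requires of \<open>q\<close>. Over the
  common denominator \<open>(x - w) * (y - w)\<close> both sides reduce to a polynomial identity,
  free of \<open>w\<close>, in two unimodular numbers and their inverses \<open>x'\<close> and
  \<open>y'\<close>.\<close>

lemma herglotz_kernel_diff_sin:
  assumes "cmod w < 1"
  shows "(herglotz_kernel w a - herglotz_kernel w b) * of_real (sin (a - b)) =
    - \<i> * (herglotz_kernel w a * herglotz_kernel w b - 1) * of_real (1 - cos (a - b))"
proof -
  have nz: "cis a - w \<noteq> 0" "cis b - w \<noteq> 0" using cis_neq_interior[OF assms] by auto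
  define x where "x = cis a" define y where "y = cis b" define y' where "y' = cnj y" define x' where "x' = cnj x"
  have xy: "x * x' = 1" "y * y' = 1" unfolding x_def y_def x'_def y'_def by (simp_all add: cis_cnj cis_mult)
  have s: "of_real (sin (a - b)) = (x * y' - x' * y) / (2 * \<i>)"
    unfolding x_def y_def x'_def y'_def
    by (simp add: complex_eq_iff sin_diff cos_diff) (simp add: algebra_simps diff_divide_distrib)
  have d: "of_real (1 - cos (a - b)) = (2 - x * y' - x' * y) / 2"
    unfolding x_def y_def x'_def y'_def
    by (simp add: complex_eq_iff sin_diff cos_diff)
  have e1: "herglotz_kernel w a - herglotz_kernel w b = 2 * w * (y - x) / ((x - w) * (y - w))"
    using nz unfolding herglotz_kernel_def x_def y_def by (simp add: divide_simps) (simp add: algebra_simps)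
  have e2: "herglotz_kernel w a * herglotz_kernel w b - 1 = 2 * w * (x + y) / ((x - w) * (y - w))"
    using nz unfolding herglotz_kernel_def x_def y_def by (simp add: divide_simps) (simp add: algebra_simps)
  have "(y - x) * (x * y' - x' * y) = (x + y) * (2 - x * y' - x' * y)"
    using xy by algebra
  then have "2 * w * (y - x) * (x * y' - x' * y) = 2 * w * (x + y) * (2 - x * y' - x' * y)"
    by (simp only: mult.assoc)
  then show ?thesis
    unfolding s d e1 e2 by (simp add: divide_simps)
qed

section \<open>Positivity and size of the Herglotz kernel\<close>

lemma Re_herglotz_kernel:
  assumes "cmod w < 1"
  shows "Re (herglotz_kernel w t) = (1 - (cmod w)\<^sup>2) / (cmod (cis t - w))\<^sup>2"
proof -
  have "(sin t)\<^sup>2 + (cos t)\<^sup>2 = 1" by simp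
  then show ?thesis
    unfolding herglotz_kernel_def Re_divide cmod_power2
    by (simp add: divide_simps power2_eq_square algebra_simps)
qed

lemma Re_herglotz_kernel_pos:
  assumes "cmod w < 1"
  shows "0 < Re (herglotz_kernel w t)"
  unfolding Re_herglotz_kernel[OF assms]
  using assms cis_neq_interior[OF assms, of t] by (auto intro!: divide_pos_pos simp: power_less_one_iff)

lemma cmod_herglotz_kernel_le:
  assumes "cmod w < 1"
  shows "cmod (herglotz_kernel w t) \<le> 2 / (1 - cmod w)"
proof -
  have "cmod (cis t + w) \<le> 2" using norm_triangle_ineq[of "cis t" w] assms by simp
  moreover have "1 - cmod w \<le> cmod (cis t - w)" using norm_triangle_ineq2[of "cis t" w] by simp
  ultimately show ?thesis
    unfolding herglotz_kernel_def norm_divide using assms by (intro frac_le) auto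
qed

text \<open>The bound is by the real part because real parts are positive and add up to
  \<open>n * Re S\<close>: summed over all points it costs a single factor
  \<open>1 / (1 - cmod w)\<close>. The only loss is
  \<open>2 * cmod w \<le> 1 + cmod w\<close>.\<close>

lemma cmod_herglotz_kernel'_le:
  assumes "cmod w < 1"
  shows "cmod (herglotz_kernel' w t) \<le> Re (herglotz_kernel w t) / (1 - cmod w)"
proof -
  have "cmod (herglotz_kernel' w t) = 2 * cmod w / (cmod (cis t - w))\<^sup>2"
    unfolding herglotz_kernel'_def herglotz_kernel_sq_minus_1[OF assms]
    by (simp add: norm_mult norm_divide norm_power)
  also have "\<dots> \<le> (1 + cmod w) / (cmod (cis t - w))\<^sup>2"
    using assms by (intro divide_right_mono) auto
  also have "\<dots> = Re (herglotz_kernel w t) / (1 - cmod w)"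
    unfolding Re_herglotz_kernel[OF assms] using assms
    by (simp add: divide_simps power2_eq_square) (simp add: algebra_simps)
  finally show ?thesis .
qed

text \<open>The square of the sum contains each pair twice and the diagonal once. Applied to the
  kernel values it turns the pair interaction into \<open>S^2 - 1\<close>, up to a diagonal
  sum.\<close>

lemma sum_pairs_product:
  fixes x :: "nat \<Rightarrow> 'a::comm_ring_1"
  shows "2 * (\<Sum>j<n. \<Sum>k\<in>{j<..<n}. x j * x k - 1) = (\<Sum>j<n. x j)\<^sup>2 - (of_nat n)\<^sup>2 - (\<Sum>j<n. (x j)\<^sup>2 - 1)"
proof (induction n)
  case (Suc n)
  have "(\<Sum>j<Suc n. \<Sum>k\<in>{j<..<Suc n}. x j * x k - 1) = (\<Sum>j<n. \<Sum>k\<in>{j<..<Suc n}. x j * x k - 1)"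
  proof -
    have "{n<..<Suc n} = {}" by auto
    then show ?thesis by simp
  qed
  also have "\<dots> = (\<Sum>j<n. (\<Sum>k\<in>{j<..<n}. x j * x k - 1) + (x j * x n - 1))"
  proof (intro sum.cong refl)
    fix j assume "j \<in> {..<n}"
    then have "{j<..<Suc n} = insert n {j<..<n}" by auto
    then show "(\<Sum>k\<in>{j<..<Suc n}. x j * x k - 1) = (\<Sum>k\<in>{j<..<n}. x j * x k - 1) + (x j * x n - 1)"
      by simp
  qed
  also have "\<dots> = (\<Sum>j<n. \<Sum>k\<in>{j<..<n}. x j * x k - 1) + (\<Sum>j<n. x j) * x n - of_nat n"
    by (simp add: sum.distrib sum_subtractf sum_distrib_right)
  finally have *: "(\<Sum>j<Suc n. \<Sum>k\<in>{j<..<Suc n}. x j * x k - 1) =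
     (\<Sum>j<n. \<Sum>k\<in>{j<..<n}. x j * x k - 1) + (\<Sum>j<n. x j) * x n - of_nat n" .
  show ?case
    unfolding * distrib_left right_diff_distrib Suc.IH by (simp add: power2_eq_square algebra_simps)
qed simp

text \<open>If the partition function vanishes, division by zero makes this the zero measure and
  \<open>cbe_expectation\<close> equal to 0, so the two agree unconditionally.\<close>

definition cbe_measure :: "real \<Rightarrow> nat \<Rightarrow> (nat \<Rightarrow> real) measure" where
  "cbe_measure \<beta> n = density (cbe_space n)
     (\<lambda>\<theta>. ennreal (cbe_weight \<beta> n \<theta> / (\<integral>\<theta>. cbe_weight \<beta> n \<theta> \<partial>cbe_space n)))"

lemma sets_cbe_measure [simp, measurable_cong]: "sets (cbe_measure \<beta> n) = sets (cbe_space n)"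
  unfolding cbe_measure_def by simp

lemma space_cbe_measure [simp]: "space (cbe_measure \<beta> n) = space (cbe_space n)"
  unfolding cbe_measure_def by simp

lemma integral_cbe_measure:
  fixes F :: "(nat \<Rightarrow> real) \<Rightarrow> 'b::{banach, second_countable_topology}"
  assumes [measurable]: "F \<in> borel_measurable (cbe_space n)"
  shows "(\<integral>\<theta>. F \<theta> \<partial>cbe_measure \<beta> n) =
     (\<integral>\<theta>. cbe_weight \<beta> n \<theta> *\<^sub>R F \<theta> \<partial>cbe_space n) /\<^sub>R (\<integral>\<theta>. cbe_weight \<beta> n \<theta> \<partial>cbe_space n)"
proof -
  define Z where "Z = (\<integral>\<theta>. cbe_weight \<beta> n \<theta> \<partial>cbe_space n)"
  have "0 \<le> Z" unfolding Z_def by (intro integral_nonneg_AE) (auto simp: cbe_weight_nonneg)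
  then have "(\<integral>\<theta>. F \<theta> \<partial>cbe_measure \<beta> n) = (\<integral>\<theta>. (cbe_weight \<beta> n \<theta> / Z) *\<^sub>R F \<theta> \<partial>cbe_space n)"
    unfolding cbe_measure_def Z_def[symmetric]
    by (intro integral_density) (auto intro!: AE_I2 divide_nonneg_nonneg cbe_weight_nonneg)
  also have "\<dots> = (\<integral>\<theta>. (1 / Z) *\<^sub>R (cbe_weight \<beta> n \<theta> *\<^sub>R F \<theta>) \<partial>cbe_space n)"
    by simp
  finally show ?thesis
    unfolding Z_def[symmetric] by (simp only: integral_scaleR_right inverse_eq_divide)
qed

lemma cbe_expectation_eq:
  assumes "F \<in> borel_measurable (cbe_space n)"
  shows "cbe_expectation \<beta> n F = (\<integral>\<theta>. F \<theta> \<partial>cbe_measure \<beta> n)"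
  unfolding cbe_expectation_def integral_cbe_measure[OF assms] by (simp add: field_simps)

text \<open>A nonzero partition function is an assumption here. It is verified where the locale is
  entered: by direct integration for \<open>n = 1\<close>, and for large \<open>n\<close> from the
  convergence of the Laplace functionals.\<close>

locale circular_beta =
  fixes \<beta> :: real and n :: nat
  assumes beta: "0 < \<beta>" and n_pos: "0 < n"
    and partition: "(\<integral>\<theta>. cbe_weight \<beta> n \<theta> \<partial>cbe_space n) \<noteq> 0"
begin

abbreviation P where "P \<equiv> cbe_measure \<beta> n"

lemma prob_space_cbe: "prob_space P"
proof
  define Z where "Z = (\<integral>\<theta>. cbe_weight \<beta> n \<theta> \<partial>cbe_space n)"
  have Z: "0 \<le> Z" unfolding Z_def by (intro integral_nonneg_AE) (auto simp: cbe_weight_nonneg)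
  have W: "integrable (cbe_space n) (cbe_weight \<beta> n)"
    using cbe_weight_le[OF beta] cbe_weight_nonneg by (intro cbe_integrable_bounded) auto
  have "emeasure P (space P) = (\<integral>\<^sup>+ \<theta>. ennreal (cbe_weight \<beta> n \<theta> / Z) \<partial>cbe_space n)"
    unfolding cbe_measure_def Z_def[symmetric] by (subst emeasure_density) (auto intro!: nn_integral_cong)
  also have "\<dots> = ennreal (\<integral>\<theta>. cbe_weight \<beta> n \<theta> / Z \<partial>cbe_space n)"
    using W Z by (intro nn_integral_eq_integral) (auto simp: cbe_weight_nonneg)
  also have "\<dots> = 1"
    using partition unfolding Z_def by simp
  finally show "emeasure P (space P) = 1" .
qed

sublocale prob_space P by (rule prob_space_cbe)

lemma integrable_bounded:
  fixes f :: "(nat \<Rightarrow> real) \<Rightarrow> 'b::{banach, second_countable_topology}"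
  assumes "f \<in> borel_measurable (cbe_space n)"
    and "\<And>\<theta>. (\<And>j. j < n \<Longrightarrow> \<theta> j \<in> {-pi..pi}) \<Longrightarrow> norm (f \<theta>) \<le> B"
  shows "integrable P f"
proof (rule integrable_const_bound)
  show "AE \<theta> in P. norm (f \<theta>) \<le> B"
    by (rule AE_I2, rule assms) (force simp: space_cbe_space PiE_iff)
  show "f \<in> borel_measurable P" using assms(1) by simp
qed

end

lemma borel_measurable_cnj [measurable (raw)]:
  "f \<in> borel_measurable M \<Longrightarrow> (\<lambda>x. cnj (f x)) \<in> borel_measurable M"
  by (rule measurable_compose[OF _ borel_measurable_continuous_onI[OF continuous_on_cnj[OF continuous_on_id]]])

definition mean_herglotz :: "nat \<Rightarrow> complex \<Rightarrow> (nat \<Rightarrow> real) \<Rightarrow> complex" where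
  "mean_herglotz n w \<theta> = (\<Sum>j<n. herglotz_kernel w (\<theta> j)) / of_nat n"

lemma measurable_mean_herglotz [measurable]:
  assumes "cmod w < 1"
  shows "mean_herglotz n w \<in> borel_measurable (cbe_space n)"
proof -
  have [measurable]: "herglotz_kernel w \<in> borel_measurable borel"
    by (rule measurable_herglotz_kernel[OF assms])
  show ?thesis unfolding mean_herglotz_def by measurable
qed

lemma cmod_mean_herglotz_le:
  assumes "cmod w < 1"
  shows "cmod (mean_herglotz n w \<theta>) \<le> 2 / (1 - cmod w)"
proof (cases "n = 0")
  case False
  have "cmod (\<Sum>j<n. herglotz_kernel w (\<theta> j)) \<le> (\<Sum>j<n. 2 / (1 - cmod w))"
    by (intro sum_norm_le cmod_herglotz_kernel_le assms)
  then have "cmod (\<Sum>j<n. herglotz_kernel w (\<theta> j)) \<le> 2 / (1 - cmod w) * real n" by (simp add: mult.commute)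
  moreover have "0 < real n" using False by simp
  ultimately show ?thesis
    unfolding mean_herglotz_def norm_divide by (simp only: norm_of_nat pos_divide_le_eq)
qed (use assms in \<open>simp add: mean_herglotz_def\<close>)

lemma Re_mean_herglotz:
  "Re (mean_herglotz n w \<theta>) = (\<Sum>j<n. Re (herglotz_kernel w (\<theta> j))) / real n"
  unfolding mean_herglotz_def by (simp add: Re_divide_of_nat)

text \<open>\<open>K\<close> is the constant in
  \<open>E |S^2 - 1|^2 \<le> d^2 K (E |S|^2 + 1)\<close>; its two summands stem from the second
  moment of the divergence and from the diagonal correction. The quadratic in \<open>K\<close>
  results from eliminating \<open>E |S|^2\<close> and then passing to
  \<open>E |S - 1|\<close>.\<close>

definition herglotz_bound :: "real \<Rightarrow> real" where
  "herglotz_bound \<beta> = (let K = 32 * (2 + 2 * \<beta>) / \<beta>\<^sup>2 + 8 * (2 / \<beta> + 1)\<^sup>2 in (K\<^sup>2 + 4 * K + 1) / 2)"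

context circular_beta
begin

lemma ward_identity_cbe:
  fixes v v' :: "real \<Rightarrow> complex" and q :: "real \<Rightarrow> real \<Rightarrow> complex"
    and G :: "(nat \<Rightarrow> real) \<Rightarrow> complex" and G' :: "nat \<Rightarrow> (nat \<Rightarrow> real) \<Rightarrow> complex"
  assumes v: "\<And>t. t \<in> {-pi..pi} \<Longrightarrow> (v has_vector_derivative v' t) (at t within {-pi..pi})" "v pi = v (-pi)"
    and q: "\<And>a b. (v a - v b) * of_real (sin (a - b)) = q a b * of_real (1 - cos (a - b))"
    and G: "\<And>\<theta> i t. i < n \<Longrightarrow> t \<in> {-pi..pi} \<Longrightarrow>
         ((\<lambda>t. G (\<theta>(i := t))) has_vector_derivative G' i (\<theta>(i := t))) (at t within {-pi..pi})"
      "\<And>\<theta> i. i < n \<Longrightarrow> G (\<theta>(i := pi)) = G (\<theta>(i := -pi))"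
    and meas [measurable]: "v \<in> borel_measurable borel" "v' \<in> borel_measurable borel"
      "(\<lambda>(a, b). q a b) \<in> borel_measurable (borel \<Otimes>\<^sub>M borel)"
      "G \<in> borel_measurable (cbe_space n)" "\<And>i. i < n \<Longrightarrow> G' i \<in> borel_measurable (cbe_space n)"
    and bnd: "\<And>t. t \<in> {-pi..pi} \<Longrightarrow> norm (v t) \<le> B1" "\<And>t. t \<in> {-pi..pi} \<Longrightarrow> norm (v' t) \<le> B2"
      "\<And>a b. a \<in> {-pi..pi} \<Longrightarrow> b \<in> {-pi..pi} \<Longrightarrow> norm (q a b) \<le> B3"
      "\<And>\<theta>. (\<And>j. j < n \<Longrightarrow> \<theta> j \<in> {-pi..pi}) \<Longrightarrow> norm (G \<theta>) \<le> B4"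
      "\<And>\<theta> i. i < n \<Longrightarrow> (\<And>j. j < n \<Longrightarrow> \<theta> j \<in> {-pi..pi}) \<Longrightarrow> norm (G' i \<theta>) \<le> B5"
  shows "(\<integral>\<theta>. G \<theta> * ((\<Sum>i<n. v' (\<theta> i)) + complex_of_real (\<beta> / 2) * (\<Sum>j<n. \<Sum>k\<in>{j<..<n}. q (\<theta> j) (\<theta> k)))
      + (\<Sum>i<n. v (\<theta> i) * G' i \<theta>) \<partial>P) = 0"
proof -
  define B where "B = max B1 (max B2 (max B3 (max B4 B5)))"
  have B: "B1 \<le> B" "B2 \<le> B" "B3 \<le> B" "B4 \<le> B" "B5 \<le> B" unfolding B_def by auto
  have [measurable]: "(\<lambda>\<theta>. q (\<theta> j) (\<theta> k)) \<in> borel_measurable (cbe_space n)" if "j < n" "k < n" for j k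
  proof -
    have "(\<lambda>\<theta>. (\<lambda>(a, b). q a b) (\<theta> j, \<theta> k)) \<in> borel_measurable (cbe_space n)"
      using that by measurable
    then show ?thesis by simp
  qed
  have "(\<integral>\<theta>. cbe_weight \<beta> n \<theta> *\<^sub>R
     (G \<theta> * ((\<Sum>i<n. v' (\<theta> i)) + complex_of_real (\<beta> / 2) * (\<Sum>j<n. \<Sum>k\<in>{j<..<n}. q (\<theta> j) (\<theta> k)))
      + (\<Sum>i<n. v (\<theta> i) * G' i \<theta>)) \<partial>cbe_space n) = 0"
    by (rule ward_identity[OF beta v q G meas order_trans[OF bnd(1) B(1)] order_trans[OF bnd(2) B(2)]
        order_trans[OF bnd(3) B(3)] order_trans[OF bnd(4) B(4)] order_trans[OF bnd(5) B(5)]])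
  then show ?thesis by (subst integral_cbe_measure) auto
qed

text \<open>The integrand is \<open>|A|\<^sup>2 / n\<^sup>4\<close>, where \<open>A\<close> is the divergence of the vector field \<open>H\<^sub>j(w)\<close>
  with respect to the ensemble; the Ward identity tested with the conjugate of \<open>A\<close> itself
  gives \<open>E |A|\<^sup>2\<close> in terms of first derivatives of \<open>A\<close>.\<close>
lemma herglotz_second_moment:
  assumes w: "cmod w < 1"
  defines "d \<equiv> 1 / (real n * (1 - cmod w))"
  assumes d1: "d \<le> 1"
  defines "S \<equiv> mean_herglotz n w"
  shows "(\<integral>\<theta>. (cmod (complex_of_real (\<beta> / 4) * ((S \<theta>)\<^sup>2 - 1 + (2 / \<beta> - 1) / (of_nat n)\<^sup>2 * (\<Sum>j<n. (herglotz_kernel w (\<theta> j))\<^sup>2 - 1))))\<^sup>2 \<partial>P)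
     \<le> d\<^sup>2 * (2 + 2 * \<beta>) * (\<integral>\<theta>. (cmod (S \<theta>))\<^sup>2 + 1 \<partial>P)"
proof -
  let ?H = "herglotz_kernel w" and ?H' = "herglotz_kernel' w"
  have [measurable]: "?H \<in> borel_measurable borel" "?H' \<in> borel_measurable borel" "S \<in> borel_measurable (cbe_space n)"
    using measurable_herglotz_kernel[OF w] measurable_herglotz_kernel'[OF w] measurable_mean_herglotz[OF w] unfolding S_def by auto
  have d0: "0 < d" unfolding d_def using w n_pos by simp
  have d_eq: "1 / (1 - cmod w) = real n * d" unfolding d_def using n_pos by simp
  have Hb: "cmod (?H t) \<le> 2 * (real n * d)" for t
    using cmod_herglotz_kernel_le[OF w, of t] unfolding d_eq[symmetric] by simp
  have H'b: "cmod (?H' t) \<le> (real n * d) * Re (?H t)" for t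
    using cmod_herglotz_kernel'_le[OF w, of t] unfolding d_eq[symmetric] by simp
  have ReH: "0 < Re (?H t)" for t by (rule Re_herglotz_kernel_pos[OF w])
  have H'b': "cmod (?H' t) \<le> (real n * d) * (2 * (real n * d))" for t
    using order_trans[OF H'b mult_left_mono[OF order_trans[OF complex_Re_le_cmod Hb]]] d0 by simp
  have Sb: "cmod (S \<theta>) \<le> 2 * (real n * d)" for \<theta>
    using cmod_mean_herglotz_le[OF w, of n \<theta>] unfolding d_eq[symmetric] S_def by simp
  have nS: "(\<Sum>j<n. ?H (\<theta> j)) = of_nat n * S \<theta>" for \<theta>
    unfolding S_def mean_herglotz_def using n_pos by simp
  \<comment> \<open>Written in power sums of the kernel instead of pairs, so that partial
    derivatives are immediate; \<open>A_eq\<close> identifies it with the divergence.\<close>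
  define A where "A \<theta> = - (\<i> / 2) * (\<Sum>j<n. (?H (\<theta> j))\<^sup>2 - 1)
      - \<i> * complex_of_real (\<beta> / 4) * ((\<Sum>j<n. ?H (\<theta> j))\<^sup>2 - (of_nat n)\<^sup>2 - (\<Sum>j<n. (?H (\<theta> j))\<^sup>2 - 1))" for \<theta>
  have A_eq: "A \<theta> = (\<Sum>j<n. ?H' (\<theta> j)) + complex_of_real (\<beta> / 2) * (\<Sum>j<n. \<Sum>k\<in>{j<..<n}. - \<i> * (?H (\<theta> j) * ?H (\<theta> k) - 1))" for \<theta>
  proof -
    have "complex_of_real (\<beta> / 2) * (\<Sum>j<n. \<Sum>k\<in>{j<..<n}. - \<i> * (?H (\<theta> j) * ?H (\<theta> k) - 1)) =
       - \<i> * complex_of_real (\<beta> / 4) * (2 * (\<Sum>j<n. \<Sum>k\<in>{j<..<n}. ?H (\<theta> j) * ?H (\<theta> k) - 1))"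
      by (simp only: sum_distrib_left[symmetric]) simp
    also have "\<dots> = - \<i> * complex_of_real (\<beta> / 4) * ((\<Sum>j<n. ?H (\<theta> j))\<^sup>2 - (of_nat n)\<^sup>2 - (\<Sum>j<n. (?H (\<theta> j))\<^sup>2 - 1))"
      by (simp only: sum_pairs_product)
    finally show ?thesis
      unfolding A_def herglotz_kernel'_def by (simp only: sum_distrib_left[symmetric]) simp
  qed
  define dA where "dA i \<theta> = - \<i> * ?H' (\<theta> i) * (complex_of_real (\<beta> / 2) * (\<Sum>j<n. ?H (\<theta> j)) + complex_of_real (1 - \<beta> / 2) * ?H (\<theta> i))" for i \<theta>
  have [measurable]: "A \<in> borel_measurable (cbe_space n)" unfolding A_def by measurable
  have dAm[measurable]: "dA i \<in> borel_measurable (cbe_space n)" if "i < n" for i using that unfolding dA_def by measurable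
  have A_deriv: "((\<lambda>t. A (\<theta>(i := t))) has_vector_derivative dA i (\<theta>(i := t))) (at t within X)" if i: "i < n" for \<theta> i t X
  proof -
    have c: "((\<lambda>t. ?H ((\<theta>(i := t)) j)) has_vector_derivative (if j = i then ?H' t else 0)) (at t within X)" for j
      using herglotz_kernel_deriv[OF w] by (cases "j = i") auto
    have c1: "((\<lambda>t. (\<Sum>j<n. ?H ((\<theta>(i := t)) j))) has_vector_derivative ?H' t) (at t within X)"
      by (rule has_vector_derivative_eq_rhs, rule has_vector_derivative_sum, rule c) (use i in simp)
    have c2: "((\<lambda>t. (?H ((\<theta>(i := t)) j))\<^sup>2 - 1) has_vector_derivative (if j = i then 2 * ?H t * ?H' t else 0)) (at t within X)" for j
      unfolding power2_eq_square
      by (rule has_vector_derivative_eq_rhs, (rule derivative_intros has_vector_derivative_mult c)+) (auto simp: algebra_simps)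
    have c3: "((\<lambda>t. (\<Sum>j<n. (?H ((\<theta>(i := t)) j))\<^sup>2 - 1)) has_vector_derivative 2 * ?H t * ?H' t) (at t within X)"
      by (rule has_vector_derivative_eq_rhs, rule has_vector_derivative_sum, rule c2) (use i in simp)
    show ?thesis
      unfolding A_def power2_eq_square[of "sum _ _"]
      by (rule has_vector_derivative_eq_rhs,
          (rule derivative_intros has_vector_derivative_mult has_vector_derivative_mult_right c1 c3)+)
        (simp add: dA_def algebra_simps)
  qed
  have Ab: "cmod (A \<theta>) \<le> 1/2 * (n * ((2 * (real n * d))\<^sup>2 + 1)) + \<beta> / 4 * ((n * (2 * (real n * d)))\<^sup>2 + n\<^sup>2 + n * ((2 * (real n * d))\<^sup>2 + 1))" for \<theta>
  proof -
    have 1: "cmod (\<Sum>j<n. (?H (\<theta> j))\<^sup>2 - 1) \<le> n * ((2 * (real n * d))\<^sup>2 + 1)"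
    proof (rule order_trans[OF sum_norm_le[where g = "\<lambda>_. (2 * (real n * d))\<^sup>2 + 1"]])
      fix j
      have "cmod ((?H (\<theta> j))\<^sup>2 - 1) \<le> cmod ((?H (\<theta> j))\<^sup>2) + 1" using norm_triangle_ineq4[of "(?H (\<theta> j))\<^sup>2" 1] by simp
      also have "\<dots> \<le> (2 * (real n * d))\<^sup>2 + 1" unfolding norm_power by (intro add_mono power_mono Hb) auto
      finally show "cmod ((?H (\<theta> j))\<^sup>2 - 1) \<le> (2 * (real n * d))\<^sup>2 + 1" .
    qed simp
    have 2: "cmod ((\<Sum>j<n. ?H (\<theta> j))\<^sup>2) \<le> (n * (2 * (real n * d)))\<^sup>2"
      unfolding norm_power nS norm_mult using Sb by (intro power_mono mult_mono) auto
    have "cmod ((\<Sum>j<n. ?H (\<theta> j))\<^sup>2 - (of_nat n)\<^sup>2 - (\<Sum>j<n. (?H (\<theta> j))\<^sup>2 - 1)) \<le> (n * (2 * (real n * d)))\<^sup>2 + n\<^sup>2 + n * ((2 * (real n * d))\<^sup>2 + 1)"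
      using 1 2 by (intro order_trans[OF norm_triangle_ineq4] add_mono) (auto simp: norm_power)
    then show ?thesis
      unfolding A_def using 1 beta
      by (intro order_trans[OF norm_triangle_ineq4] add_mono) (simp_all add: norm_mult)
  qed
  \<comment> \<open>The factor \<open>?H'\<close> is bounded by the real part of \<open>?H\<close>,
    whose sum over \<open>i\<close> is only \<open>n * Re (S \<theta>)\<close>. The right-hand side
    is therefore of order \<open>n^4 d^2\<close>, and \<open>n^4\<close> is exactly the square of
    the size \<open>n^2\<close> of \<open>A\<close>.\<close>
  have dA_bound: "(\<Sum>i<n. cmod (?H (\<theta> i)) * cmod (dA i \<theta>)) \<le> real n ^ 4 * (d\<^sup>2 * (2 + 2 * \<beta>) * ((cmod (S \<theta>))\<^sup>2 + 1))" for \<theta>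
  proof -
    define s where "s = cmod (S \<theta>)"
    have s0: "0 \<le> s" unfolding s_def by simp
    have f: "cmod (complex_of_real (\<beta> / 2) * (\<Sum>j<n. ?H (\<theta> j)) + complex_of_real (1 - \<beta> / 2) * ?H (\<theta> i)) \<le> real n * (\<beta> / 2 * s + (2 + \<beta>))" for i
    proof -
      have "cmod (complex_of_real (\<beta> / 2) * (\<Sum>j<n. ?H (\<theta> j))) = real n * (\<beta> / 2 * s)"
        unfolding nS s_def using beta by (simp add: norm_mult)
      moreover have "cmod (complex_of_real (1 - \<beta> / 2) * ?H (\<theta> i)) \<le> (1 + \<beta> / 2) * (2 * (real n * 1))"
        unfolding norm_mult norm_of_real using beta d1 d0 by (intro mult_mono order_trans[OF Hb]) auto
      ultimately show ?thesis
        by (intro order_trans[OF norm_triangle_ineq]) (simp add: algebra_simps)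
    qed
    have "cmod (?H (\<theta> i)) * cmod (dA i \<theta>) \<le> (2 * (real n * d)) * (((real n * d) * Re (?H (\<theta> i))) * (real n * (\<beta> / 2 * s + (2 + \<beta>))))" for i
    proof (rule mult_mono[OF Hb])
      have "cmod (dA i \<theta>) = cmod (?H' (\<theta> i)) * cmod (complex_of_real (\<beta> / 2) * (\<Sum>j<n. ?H (\<theta> j)) + complex_of_real (1 - \<beta> / 2) * ?H (\<theta> i))"
        unfolding dA_def norm_mult[of "_ * _" "_ + _"] by (simp add: norm_mult)
      also have "\<dots> \<le> ((real n * d) * Re (?H (\<theta> i))) * (real n * (\<beta> / 2 * s + (2 + \<beta>)))"
        by (rule mult_mono[OF H'b f]) (use d0 less_imp_le[OF ReH] in auto)
      finally show "cmod (dA i \<theta>) \<le> \<dots>" .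
    qed (use d0 in auto)
    then have "(\<Sum>i<n. cmod (?H (\<theta> i)) * cmod (dA i \<theta>)) \<le> (\<Sum>i<n. (2 * (real n * d)) * (((real n * d) * Re (?H (\<theta> i))) * (real n * (\<beta> / 2 * s + (2 + \<beta>)))))"
      by (intro sum_mono)
    also have "\<dots> = 2 * real n ^ 3 * d\<^sup>2 * (\<beta> / 2 * s + (2 + \<beta>)) * (\<Sum>i<n. Re (?H (\<theta> i)))"
      unfolding sum_distrib_left by (intro sum.cong) (simp_all add: power2_eq_square power3_eq_cube)
    also have "(\<Sum>i<n. Re (?H (\<theta> i))) = Re (\<Sum>i<n. ?H (\<theta> i))" by simp
    also have "\<dots> = real n * Re (S \<theta>)" unfolding nS by simp
    also have "2 * real n ^ 3 * d\<^sup>2 * (\<beta> / 2 * s + (2 + \<beta>)) * (real n * Re (S \<theta>)) \<le> 2 * real n ^ 3 * d\<^sup>2 * (\<beta> / 2 * s + (2 + \<beta>)) * (real n * s)"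
      using beta d0 s0 unfolding s_def by (intro mult_left_mono complex_Re_le_cmod mult_nonneg_nonneg) auto
    also have "\<dots> = real n ^ 4 * (d\<^sup>2 * (\<beta> * s\<^sup>2 + (2 + \<beta>) * (2 * s)))"
      by (simp add: power2_eq_square algebra_simps power_numeral_reduce)
    also have "\<dots> \<le> real n ^ 4 * (d\<^sup>2 * (\<beta> * s\<^sup>2 + (2 + \<beta>) * (s\<^sup>2 + 1)))"
    proof -
      have "2 * s \<le> s\<^sup>2 + 1" using zero_le_power2[of "s - 1"] by (simp add: power2_diff)
      then show ?thesis using beta by (intro mult_left_mono add_left_mono) auto
    qed
    also have "\<dots> \<le> real n ^ 4 * (d\<^sup>2 * ((2 + 2 * \<beta>) * (s\<^sup>2 + 1)))"
      using beta by (intro mult_left_mono) (auto simp: algebra_simps)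
    finally show ?thesis unfolding s_def by (simp add: mult.assoc)
  qed
  \<comment> \<open>A crude uniform bound, serving only boundedness and integrability.\<close>
  have dAb: "cmod (dA i \<theta>) \<le> (real n * d) * (2 * (real n * d)) * ((\<beta> / 2) * (n * (2 * (real n * d))) + \<bar>1 - \<beta> / 2\<bar> * (2 * (real n * d)))" for i \<theta>
  proof -
    have 1: "cmod (complex_of_real (\<beta> / 2) * (\<Sum>j<n. ?H (\<theta> j))) \<le> (\<beta> / 2) * (n * (2 * (real n * d)))"
      unfolding nS norm_mult norm_of_real using beta d0 by (intro mult_mono Sb) auto
    have 2: "cmod (complex_of_real (1 - \<beta> / 2) * ?H (\<theta> i)) \<le> \<bar>1 - \<beta> / 2\<bar> * (2 * (real n * d))"
      unfolding norm_mult norm_of_real by (intro mult_left_mono Hb) auto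
    have "cmod (dA i \<theta>) = cmod (?H' (\<theta> i)) * cmod (complex_of_real (\<beta> / 2) * (\<Sum>j<n. ?H (\<theta> j)) + complex_of_real (1 - \<beta> / 2) * ?H (\<theta> i))"
      unfolding dA_def norm_mult[of "_ * _" "_ + _"] by (simp add: norm_mult)
    also have "\<dots> \<le> (real n * d) * (2 * (real n * d)) * ((\<beta> / 2) * (n * (2 * (real n * d))) + \<bar>1 - \<beta> / 2\<bar> * (2 * (real n * d)))"
      by (rule mult_mono[OF H'b' order_trans[OF norm_triangle_ineq add_mono[OF 1 2]]]) (use d0 in auto)
    finally show ?thesis .
  qed
  \<comment> \<open>With the conjugate of the divergence as test function the first term is the
    square of its modulus, and the second contains only first derivatives of
    \<open>A\<close>.\<close>
  have "(\<integral>\<theta>. cnj (A \<theta>) * ((\<Sum>j<n. ?H' (\<theta> j)) + complex_of_real (\<beta> / 2) * (\<Sum>j<n. \<Sum>k\<in>{j<..<n}. - \<i> * (?H (\<theta> j) * ?H (\<theta> k) - 1)))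
      + (\<Sum>i<n. ?H (\<theta> i) * cnj (dA i \<theta>)) \<partial>P) = 0"
  proof (rule ward_identity_cbe[OF herglotz_kernel_deriv[OF w] _ herglotz_kernel_diff_sin[OF w]])
    show "?H pi = ?H (- pi)" unfolding herglotz_kernel_def by (simp add: cis.code)
    show "((\<lambda>t. cnj (A (\<theta>(i := t)))) has_vector_derivative cnj (dA i (\<theta>(i := t)))) (at t within {-pi..pi})" if "i < n" for \<theta> i t
      by (rule bounded_linear.has_vector_derivative[OF bounded_linear_cnj A_deriv[OF that]])
    show "cnj (A (\<theta>(i := pi))) = cnj (A (\<theta>(i := -pi)))" for \<theta> i
    proof -
      have "?H ((\<theta>(i := pi)) j) = ?H ((\<theta>(i := -pi)) j)" for j
        unfolding herglotz_kernel_def by (simp add: cis.code)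
      then show ?thesis unfolding A_def by (simp only:)
    qed
    show "cmod (- \<i> * (?H a * ?H b - 1)) \<le> (2 * (real n * d)) * (2 * (real n * d)) + 1" for a b
    proof -
      have "cmod (?H a * ?H b - 1) \<le> cmod (?H a * ?H b) + 1"
        using norm_triangle_ineq4[of "?H a * ?H b" 1] by simp
      also have "\<dots> \<le> (2 * (real n * d)) * (2 * (real n * d)) + 1"
        unfolding norm_mult using d0 by (intro add_mono mult_mono Hb) auto
      finally show ?thesis by (simp add: norm_mult)
    qed
    show "(\<lambda>\<theta>. cnj (dA i \<theta>)) \<in> borel_measurable (cbe_space n)" if "i < n" for i
      using dAm[OF that] by (rule borel_measurable_cnj)
    show "cmod (?H t) \<le> 2 * (real n * d)" for t by (rule Hb)
    show "cmod (?H' t) \<le> (real n * d) * (2 * (real n * d))" for t by (rule H'b')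
    show "cmod (cnj (A \<theta>)) \<le> 1/2 * (n * ((2 * (real n * d))\<^sup>2 + 1)) + \<beta> / 4 * ((n * (2 * (real n * d)))\<^sup>2 + n\<^sup>2 + n * ((2 * (real n * d))\<^sup>2 + 1))" for \<theta>
      unfolding complex_mod_cnj by (rule Ab)
    show "cmod (cnj (dA i \<theta>)) \<le> (real n * d) * (2 * (real n * d)) * ((\<beta> / 2) * (n * (2 * (real n * d))) + \<bar>1 - \<beta> / 2\<bar> * (2 * (real n * d)))" for i \<theta>
      unfolding complex_mod_cnj by (rule dAb)
  qed measurable
  then have eq: "(\<integral>\<theta>. cnj (A \<theta>) * A \<theta> + (\<Sum>i<n. ?H (\<theta> i) * cnj (dA i \<theta>)) \<partial>P) = 0"
    by (simp only: A_eq)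
  have i1: "integrable P (\<lambda>\<theta>. cnj (A \<theta>) * A \<theta>)"
    by (rule integrable_bounded, measurable, unfold norm_mult complex_mod_cnj, rule mult_mono[OF Ab Ab])
       (use order_trans[OF norm_ge_zero Ab] in auto)
  have i2: "integrable P (\<lambda>\<theta>. \<Sum>i<n. ?H (\<theta> i) * cnj (dA i \<theta>))"
    by (rule integrable_bounded, measurable, rule sum_norm_le, unfold norm_mult complex_mod_cnj, rule mult_mono[OF Hb dAb])
       (use d0 in auto)
  have i3: "integrable P (\<lambda>\<theta>. (cmod (S \<theta>))\<^sup>2 + 1)"
  proof (rule Bochner_Integration.integrable_add)
    show "integrable P (\<lambda>\<theta>. (cmod (S \<theta>))\<^sup>2)"
      by (rule integrable_bounded, measurable, simp, rule power_mono[OF Sb]) simp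
  qed simp
  have "complex_of_real (\<integral>\<theta>. (cmod (A \<theta>))\<^sup>2 \<partial>P) = (\<integral>\<theta>. cnj (A \<theta>) * A \<theta> \<partial>P)"
    by (subst integral_complex_of_real[symmetric], rule Bochner_Integration.integral_cong)
      (simp_all only: complex_norm_square mult.commute)
  also have "\<dots> = - (\<integral>\<theta>. (\<Sum>i<n. ?H (\<theta> i) * cnj (dA i \<theta>)) \<partial>P)"
    using eq Bochner_Integration.integral_add[OF i1 i2] by (simp add: add_eq_0_iff2)
  finally have fe: "complex_of_real (\<integral>\<theta>. (cmod (A \<theta>))\<^sup>2 \<partial>P) = - (\<integral>\<theta>. (\<Sum>i<n. ?H (\<theta> i) * cnj (dA i \<theta>)) \<partial>P)" .
  have "(\<integral>\<theta>. (cmod (A \<theta>))\<^sup>2 \<partial>P) \<le> cmod (complex_of_real (\<integral>\<theta>. (cmod (A \<theta>))\<^sup>2 \<partial>P))"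
    by (simp only: norm_of_real abs_ge_self)
  also have "\<dots> = cmod (\<integral>\<theta>. (\<Sum>i<n. ?H (\<theta> i) * cnj (dA i \<theta>)) \<partial>P)"
    by (simp only: fe norm_minus_cancel)
  also have "\<dots> \<le> (\<integral>\<theta>. cmod (\<Sum>i<n. ?H (\<theta> i) * cnj (dA i \<theta>)) \<partial>P)"
    by (rule integral_norm_bound)
  also have "\<dots> \<le> (\<integral>\<theta>. real n ^ 4 * (d\<^sup>2 * (2 + 2 * \<beta>) * ((cmod (S \<theta>))\<^sup>2 + 1)) \<partial>P)"
  proof (rule integral_mono)
    fix \<theta>
    have "cmod (\<Sum>i<n. ?H (\<theta> i) * cnj (dA i \<theta>)) \<le> (\<Sum>i<n. cmod (?H (\<theta> i)) * cmod (dA i \<theta>))"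
      by (rule sum_norm_le) (simp add: norm_mult)
    then show "cmod (\<Sum>i<n. ?H (\<theta> i) * cnj (dA i \<theta>)) \<le> real n ^ 4 * (d\<^sup>2 * (2 + 2 * \<beta>) * ((cmod (S \<theta>))\<^sup>2 + 1))"
      using dA_bound by (rule order_trans)
  qed (use i2 i3 in \<open>auto simp del: integrable_add\<close>)
  also have "\<dots> = real n ^ 4 * (d\<^sup>2 * (2 + 2 * \<beta>) * (\<integral>\<theta>. (cmod (S \<theta>))\<^sup>2 + 1 \<partial>P))" by simp
  finally have main: "(\<integral>\<theta>. (cmod (A \<theta>))\<^sup>2 \<partial>P) \<le> real n ^ 4 * (d\<^sup>2 * (2 + 2 * \<beta>) * (\<integral>\<theta>. (cmod (S \<theta>))\<^sup>2 + 1 \<partial>P))" .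
  \<comment> \<open>Dividing by \<open>n^2\<close> isolates \<open>S^2 - 1\<close>. The diagonal sum
    survives with a factor \<open>1 / n^2\<close> and the coefficient
    \<open>2 / \<beta> - 1\<close>, which vanishes for \<beta> = 2.\<close>
  have A_eq2: "A \<theta> = - \<i> * (of_nat n)\<^sup>2 * (complex_of_real (\<beta> / 4) * ((S \<theta>)\<^sup>2 - 1 + (2 / \<beta> - 1) / (of_nat n)\<^sup>2 * (\<Sum>j<n. (?H (\<theta> j))\<^sup>2 - 1)))" (is "_ = - \<i> * (of_nat n)\<^sup>2 * ?Y \<theta>") for \<theta>
  proof -
    define r where "r = (\<Sum>j<n. (?H (\<theta> j))\<^sup>2 - 1)"
    have "complex_of_real (\<beta> / 4) * ((2 / \<beta> - 1) / (of_nat n)\<^sup>2 * r) * (of_nat n)\<^sup>2 = (1/2 - complex_of_real (\<beta> / 4)) * r"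
      using beta n_pos by (simp add: field_simps)
    then have "- \<i> * (of_nat n)\<^sup>2 * (complex_of_real (\<beta> / 4) * ((S \<theta>)\<^sup>2 - 1 + (2 / \<beta> - 1) / (of_nat n)\<^sup>2 * r)) =
       - \<i> * complex_of_real (\<beta> / 4) * ((of_nat n * S \<theta>)\<^sup>2 - (of_nat n)\<^sup>2) - \<i> * ((1/2 - complex_of_real (\<beta> / 4)) * r)"
      by (simp only: power_mult_distrib) algebra
    then show ?thesis
      unfolding A_def nS r_def[symmetric] by (simp add: algebra_simps)
  qed
  have "(\<integral>\<theta>. (cmod (A \<theta>))\<^sup>2 \<partial>P) = (\<integral>\<theta>. real n ^ 4 * (cmod (?Y \<theta>))\<^sup>2 \<partial>P)"
    by (rule Bochner_Integration.integral_cong[OF refl],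
        simp only: A_eq2 norm_mult norm_minus_cancel norm_ii norm_power norm_of_nat mult_1 power_mult_distrib power_mult[symmetric]) simp
  with main show ?thesis using n_pos by simp
qed


lemma prob_space_cbe_space [simp]: "prob (space (cbe_space n)) = 1"
  using prob_space by simp

text \<open>The second moment bound has \<open>E |S|^2\<close> on its right, which in turn is at
  most \<open>E |S^2 - 1| + 1\<close>. Closing this loop gives
  \<open>E |S^2 - 1|^2 = O(d^2)\<close>. Finally \<open>Re S \<ge> 0\<close> forces
  \<open>|S + 1| \<ge> 1\<close>, hence \<open>|S - 1| \<le> |S^2 - 1|\<close>.\<close>

lemma mean_herglotz_near_1:
  assumes w: "cmod w < 1"
  defines "d \<equiv> 1 / (real n * (1 - cmod w))"
  assumes d1: "d \<le> 1"
  shows "(\<integral>\<theta>. cmod (mean_herglotz n w \<theta> - 1) \<partial>P) \<le> herglotz_bound \<beta> * d"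
proof -
  define K where "K = 32 * (2 + 2 * \<beta>) / \<beta>\<^sup>2 + 8 * (2 / \<beta> + 1)\<^sup>2"
  have hb: "herglotz_bound \<beta> = (K\<^sup>2 + 4 * K + 1) / 2" unfolding herglotz_bound_def K_def by (simp add: Let_def)
  have K0: "0 < K" unfolding K_def using beta by (intro add_pos_nonneg divide_pos_pos) auto
  let ?H = "herglotz_kernel w" and ?H' = "herglotz_kernel' w"
  define S where "S = mean_herglotz n w"
  have [measurable]: "?H \<in> borel_measurable borel" "S \<in> borel_measurable (cbe_space n)"
    using measurable_herglotz_kernel[OF w] measurable_mean_herglotz[OF w] unfolding S_def by auto
  have d0: "0 < d" unfolding d_def using w n_pos by simp
  have d_eq: "1 / (1 - cmod w) = real n * d" unfolding d_def using n_pos by simp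
  have Sb: "cmod (S \<theta>) \<le> 2 * (real n * d)" for \<theta>
    using cmod_mean_herglotz_le[OF w, of n \<theta>] unfolding d_eq[symmetric] S_def by simp
  define r where "r \<theta> = (\<Sum>j<n. (?H (\<theta> j))\<^sup>2 - 1)" for \<theta>
  define c where "c = (2 / \<beta> - 1) / (real n)\<^sup>2"
  define Y where "Y \<theta> = complex_of_real (\<beta> / 4) * ((S \<theta>)\<^sup>2 - 1 + c * r \<theta>)" for \<theta>
  have [measurable]: "r \<in> borel_measurable (cbe_space n)" "Y \<in> borel_measurable (cbe_space n)"
    unfolding Y_def r_def by measurable
  have rb: "cmod (c * r \<theta>) \<le> (2 / \<beta> + 1) * (2 * d * cmod (S \<theta>))" for \<theta>
  proof -
    have "cmod (r \<theta>) \<le> (\<Sum>j<n. 2 * ((real n * d) * Re (?H (\<theta> j))))"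
      unfolding r_def
    proof (rule sum_norm_le)
      fix j
      have "cmod ((?H (\<theta> j))\<^sup>2 - 1) = 2 * cmod (?H' (\<theta> j))"
        unfolding herglotz_kernel'_def by (simp add: norm_mult)
      also have "\<dots> \<le> 2 * ((real n * d) * Re (?H (\<theta> j)))"
        using cmod_herglotz_kernel'_le[OF w, of "\<theta> j"] unfolding d_eq[symmetric] by simp
      finally show "cmod ((?H (\<theta> j))\<^sup>2 - 1) \<le> \<dots>" .
    qed
    also have "\<dots> = 2 * (real n)\<^sup>2 * d * Re (S \<theta>)"
      unfolding S_def Re_mean_herglotz using n_pos by (simp add: sum_distrib_left[symmetric] power2_eq_square)
    also have "\<dots> \<le> 2 * (real n)\<^sup>2 * d * cmod (S \<theta>)"
      using d0 by (intro mult_left_mono complex_Re_le_cmod) auto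
    finally have "cmod (c * r \<theta>) \<le> \<bar>c\<bar> * (2 * (real n)\<^sup>2 * d * cmod (S \<theta>))"
      unfolding norm_mult norm_of_real by (intro mult_left_mono) auto
    also have "\<dots> = \<bar>2 / \<beta> - 1\<bar> * (2 * d * cmod (S \<theta>))"
      unfolding c_def abs_divide using n_pos by simp
    also have "\<dots> \<le> (2 / \<beta> + 1) * (2 * d * cmod (S \<theta>))"
      using beta d0 abs_triangle_ineq4[of "2 / \<beta>" 1] by (intro mult_right_mono) auto
    finally show ?thesis .
  qed
  have pw: "(cmod ((S \<theta>)\<^sup>2 - 1))\<^sup>2 \<le> 32 / \<beta>\<^sup>2 * (cmod (Y \<theta>))\<^sup>2 + 8 * (2 / \<beta> + 1)\<^sup>2 * d\<^sup>2 * (cmod (S \<theta>))\<^sup>2" for \<theta>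
  proof -
    have "(S \<theta>)\<^sup>2 - 1 = complex_of_real (4 / \<beta>) * Y \<theta> - c * r \<theta>"
      unfolding Y_def using beta by (simp add: field_simps)
    then have "cmod ((S \<theta>)\<^sup>2 - 1) \<le> cmod (complex_of_real (4 / \<beta>) * Y \<theta>) + cmod (c * r \<theta>)"
      by (metis norm_triangle_ineq4)
    also have "\<dots> \<le> 4 / \<beta> * cmod (Y \<theta>) + (2 / \<beta> + 1) * (2 * d * cmod (S \<theta>))"
      using rb[of \<theta>] beta unfolding norm_mult[of "complex_of_real (4 / \<beta>)"] norm_of_real by simp
    finally have "(cmod ((S \<theta>)\<^sup>2 - 1))\<^sup>2 \<le> (4 / \<beta> * cmod (Y \<theta>) + (2 / \<beta> + 1) * (2 * d * cmod (S \<theta>)))\<^sup>2"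
      by (intro power_mono) auto
    also have "\<dots> \<le> 2 * (4 / \<beta> * cmod (Y \<theta>))\<^sup>2 + 2 * ((2 / \<beta> + 1) * (2 * d * cmod (S \<theta>)))\<^sup>2"
      using sum_squares_bound[of "4 / \<beta> * cmod (Y \<theta>)" "(2 / \<beta> + 1) * (2 * d * cmod (S \<theta>))"] by (simp add: power2_sum)
    finally show ?thesis by (simp add: power_mult_distrib power_divide mult_ac)
  qed
  have X1: "cmod ((S \<theta>)\<^sup>2 - 1) \<le> (2 * (real n * d))\<^sup>2 + 1" for \<theta>
    by (intro order_trans[OF norm_triangle_ineq4] add_mono) (simp_all only: norm_power norm_one order_refl power_mono[OF Sb norm_ge_zero])
  have Yb: "cmod (Y \<theta>) \<le> \<beta> / 4 * ((2 * (real n * d))\<^sup>2 + 1 + (2 / \<beta> + 1) * (2 * d * (2 * (real n * d))))" for \<theta>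
  proof -
    note X1[of \<theta>]
    moreover have "cmod (c * r \<theta>) \<le> (2 / \<beta> + 1) * (2 * d * (2 * (real n * d)))"
      using Sb beta d0 by (intro order_trans[OF rb] mult_left_mono) auto
    ultimately have "cmod ((S \<theta>)\<^sup>2 - 1 + c * r \<theta>) \<le> (2 * (real n * d))\<^sup>2 + 1 + (2 / \<beta> + 1) * (2 * d * (2 * (real n * d)))"
      by (intro order_trans[OF norm_triangle_ineq] add_mono)
    then show ?thesis
      unfolding Y_def norm_mult norm_of_real using beta by (intro mult_mono) auto
  qed
  have iY: "integrable P (\<lambda>\<theta>. (cmod (Y \<theta>))\<^sup>2)"
    by (rule integrable_bounded, measurable, simp, rule power_mono[OF Yb]) simp
  have iS: "integrable P (\<lambda>\<theta>. (cmod (S \<theta>))\<^sup>2)"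
    by (rule integrable_bounded, measurable, simp, rule power_mono[OF Sb]) simp
  have iX: "integrable P (\<lambda>\<theta>. (cmod ((S \<theta>)\<^sup>2 - 1))\<^sup>2)"
    by (rule integrable_bounded, measurable, simp, rule power_mono[OF X1]) simp
  have iS1: "integrable P (\<lambda>\<theta>. cmod (S \<theta> - 1))"
    by (rule integrable_bounded[where B = "2 * (real n * d) + 1"], measurable)
      (use Sb in \<open>auto intro!: order_trans[OF norm_triangle_ineq4] add_mono\<close>)
  define X where "X = (\<integral>\<theta>. (cmod ((S \<theta>)\<^sup>2 - 1))\<^sup>2 \<partial>P)"
  define E2 where "E2 = (\<integral>\<theta>. (cmod (S \<theta>))\<^sup>2 \<partial>P)"
  have E20: "0 \<le> E2" unfolding E2_def by simp
  have EY: "(\<integral>\<theta>. (cmod (Y \<theta>))\<^sup>2 \<partial>P) \<le> d\<^sup>2 * (2 + 2 * \<beta>) * (E2 + 1)"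
  proof -
    have "(\<integral>\<theta>. (cmod (Y \<theta>))\<^sup>2 \<partial>P) \<le> d\<^sup>2 * (2 + 2 * \<beta>) * (\<integral>\<theta>. (cmod (S \<theta>))\<^sup>2 + 1 \<partial>P)"
      using herglotz_second_moment[OF w] d1 unfolding d_def Y_def S_def r_def c_def by simp
    also have "(\<integral>\<theta>. (cmod (S \<theta>))\<^sup>2 + 1 \<partial>P) = E2 + 1"
      unfolding E2_def using iS by (simp add: prob_space)
    finally show ?thesis .
  qed
  have "X \<le> (\<integral>\<theta>. 32 / \<beta>\<^sup>2 * (cmod (Y \<theta>))\<^sup>2 + 8 * (2 / \<beta> + 1)\<^sup>2 * d\<^sup>2 * (cmod (S \<theta>))\<^sup>2 \<partial>P)"
    unfolding X_def by (rule integral_mono[OF iX _ pw]) (use iY iS in auto)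
  also have "\<dots> = 32 / \<beta>\<^sup>2 * (\<integral>\<theta>. (cmod (Y \<theta>))\<^sup>2 \<partial>P) + 8 * (2 / \<beta> + 1)\<^sup>2 * d\<^sup>2 * E2"
    unfolding E2_def using iY iS by simp
  also have "\<dots> \<le> 32 / \<beta>\<^sup>2 * (d\<^sup>2 * (2 + 2 * \<beta>) * (E2 + 1)) + 8 * (2 / \<beta> + 1)\<^sup>2 * d\<^sup>2 * (E2 + 1)"
    by (intro add_mono mult_left_mono EY) auto
  also have "\<dots> = d\<^sup>2 * K * (E2 + 1)"
    unfolding K_def by (simp add: algebra_simps add_divide_distrib)
  finally have XK: "X \<le> d\<^sup>2 * K * (E2 + 1)" .
  \<comment> \<open>\<open>2 a b \<le> a^2 + b^2\<close> with \<open>a = |S^2 - 1|\<close> and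
    \<open>b = d^2 K\<close> bounds \<open>d^2 K E2\<close> by half of \<open>X\<close> plus a
    constant; inserted into \<open>XK\<close>, the half of \<open>X\<close> is absorbed on the
    left.\<close>
  have "2 * (d\<^sup>2 * K) * E2 = (\<integral>\<theta>. 2 * (d\<^sup>2 * K) * (cmod (S \<theta>))\<^sup>2 \<partial>P)"
    unfolding E2_def by simp
  also have "\<dots> \<le> (\<integral>\<theta>. (cmod ((S \<theta>)\<^sup>2 - 1))\<^sup>2 + ((d\<^sup>2 * K)\<^sup>2 + 2 * (d\<^sup>2 * K)) \<partial>P)"
  proof (rule integral_mono)
    fix \<theta>
    define x where "x = cmod ((S \<theta>)\<^sup>2 - 1)"
    have "(cmod (S \<theta>))\<^sup>2 \<le> x + 1"
      unfolding x_def norm_power[symmetric] using norm_triangle_ineq[of "(S \<theta>)\<^sup>2 - 1" 1] by simp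
    then have "2 * (d\<^sup>2 * K) * (cmod (S \<theta>))\<^sup>2 \<le> 2 * (d\<^sup>2 * K) * (x + 1)"
      using K0 by (intro mult_left_mono) auto
    also have "\<dots> \<le> x\<^sup>2 + ((d\<^sup>2 * K)\<^sup>2 + 2 * (d\<^sup>2 * K))"
      using sum_squares_bound[of x "d\<^sup>2 * K"] by (simp add: algebra_simps)
    finally show "2 * (d\<^sup>2 * K) * (cmod (S \<theta>))\<^sup>2 \<le> (cmod ((S \<theta>)\<^sup>2 - 1))\<^sup>2 + ((d\<^sup>2 * K)\<^sup>2 + 2 * (d\<^sup>2 * K))"
      unfolding x_def .
  qed (use iS iX in auto)
  also have "\<dots> = X + ((d\<^sup>2 * K)\<^sup>2 + 2 * (d\<^sup>2 * K))"
    unfolding X_def using iX by (simp add: prob_space)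
  finally have "X \<le> (d\<^sup>2 * K)\<^sup>2 + 4 * (d\<^sup>2 * K)"
    using XK by (simp add: algebra_simps)
  also have "\<dots> \<le> d\<^sup>2 * (K\<^sup>2 + 4 * K)"
  proof -
    have "d\<^sup>2 \<le> 1" using d0 d1 by (simp add: power_le_one)
    then have "(d\<^sup>2 * d\<^sup>2) * K\<^sup>2 \<le> (d\<^sup>2 * 1) * K\<^sup>2" by (intro mult_right_mono mult_left_mono) auto
    then show ?thesis by (simp add: power2_eq_square algebra_simps)
  qed
  finally have XX: "X \<le> d\<^sup>2 * (K\<^sup>2 + 4 * K)" .
  \<comment> \<open>In place of Cauchy-Schwarz: since \<open>X\<close> is of order
    \<open>d^2\<close>, the weights \<open>1 / (2 d)\<close> and \<open>d / 2\<close> make both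
    terms of order \<open>d\<close>.\<close>
  have "(\<integral>\<theta>. cmod (S \<theta> - 1) \<partial>P) \<le> (\<integral>\<theta>. (cmod ((S \<theta>)\<^sup>2 - 1))\<^sup>2 / (2 * d) + d / 2 \<partial>P)"
  proof (rule integral_mono[OF iS1])
    fix \<theta>
    define x where "x = cmod ((S \<theta>)\<^sup>2 - 1)"
    have "0 \<le> Re (S \<theta>)"
      unfolding S_def Re_mean_herglotz by (intro divide_nonneg_nonneg sum_nonneg less_imp_le[OF Re_herglotz_kernel_pos[OF w]]) auto
    then have "1 \<le> cmod (S \<theta> + 1)" using complex_Re_le_cmod[of "S \<theta> + 1"] by simp
    then have "cmod (S \<theta> - 1) * 1 \<le> cmod (S \<theta> - 1) * cmod (S \<theta> + 1)" by (intro mult_left_mono) auto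
    also have "\<dots> = x" unfolding x_def norm_mult[symmetric] by (simp add: power2_eq_square algebra_simps)
    finally have "cmod (S \<theta> - 1) \<le> x" by simp
    also have "x \<le> x\<^sup>2 / (2 * d) + d / 2"
      using d0 sum_squares_bound[of x d] by (simp add: field_simps power2_eq_square)
    finally show "cmod (S \<theta> - 1) \<le> (cmod ((S \<theta>)\<^sup>2 - 1))\<^sup>2 / (2 * d) + d / 2" unfolding x_def .
  qed (use iX in auto)
  also have "\<dots> = X / (2 * d) + d / 2"
    unfolding X_def using iX by (simp add: prob_space)
  also have "\<dots> \<le> d\<^sup>2 * (K\<^sup>2 + 4 * K) / (2 * d) + d / 2"
    using XX d0 by (intro add_mono divide_right_mono) auto
  also have "\<dots> = herglotz_bound \<beta> * d"
    unfolding hb using d0 by (simp add: power2_eq_square field_simps)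
  finally show ?thesis unfolding S_def .
qed

text \<open>The constant field \<open>v = 1\<close> generates the simultaneous rotation of all
  points; its differences vanish, so \<open>q = 0\<close> and the interaction drops out.\<close>

lemma ward_identity_rotation:
  fixes G :: "(nat \<Rightarrow> real) \<Rightarrow> complex" and G' :: "nat \<Rightarrow> (nat \<Rightarrow> real) \<Rightarrow> complex"
  assumes G: "\<And>\<theta> i t. i < n \<Longrightarrow> t \<in> {-pi..pi} \<Longrightarrow>
         ((\<lambda>t. G (\<theta>(i := t))) has_vector_derivative G' i (\<theta>(i := t))) (at t within {-pi..pi})"
      "\<And>\<theta> i. i < n \<Longrightarrow> G (\<theta>(i := pi)) = G (\<theta>(i := -pi))"
    and meas: "G \<in> borel_measurable (cbe_space n)" "\<And>i. i < n \<Longrightarrow> G' i \<in> borel_measurable (cbe_space n)"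
    and bnd:
      "\<And>\<theta>. (\<And>j. j < n \<Longrightarrow> \<theta> j \<in> {-pi..pi}) \<Longrightarrow> norm (G \<theta>) \<le> B4"
      "\<And>\<theta> i. i < n \<Longrightarrow> (\<And>j. j < n \<Longrightarrow> \<theta> j \<in> {-pi..pi}) \<Longrightarrow> norm (G' i \<theta>) \<le> B5"
  shows "(\<integral>\<theta>. (\<Sum>i<n. G' i \<theta>) \<partial>P) = 0"
proof -
  have "(\<integral>\<theta>. G \<theta> * ((\<Sum>i<n. (\<lambda>_. 0) (\<theta> i)) + complex_of_real (\<beta> / 2) * (\<Sum>j<n. \<Sum>k\<in>{j<..<n}. (\<lambda>_ _. 0) (\<theta> j) (\<theta> k)))
      + (\<Sum>i<n. (\<lambda>_. 1) (\<theta> i) * G' i \<theta>) \<partial>P) = 0"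
    by (rule ward_identity_cbe[where ?B1.0 = 1 and ?B2.0 = 0 and ?B3.0 = 0, OF _ _ _ G _ _ _ meas _ _ _ bnd]) auto
  then show ?thesis by simp
qed

text \<open>Subtracting the mean \<open>m\<close> from \<open>f\<close> gives a primitive
  \<open>F2\<close> with equal values at \<open>pi\<close> and \<open>-pi\<close>; rotation
  invariance applied to the sum of \<open>F2 (\<theta> j)\<close> says that \<open>f - m\<close> has
  mean zero. Only the primitive has to match at the ends, so \<open>f\<close> may jump there, as
  rescaled test functions can.\<close>

lemma intensity:
  fixes f :: "real \<Rightarrow> real"
  assumes f: "continuous_on UNIV f"
  shows "(\<integral>\<theta>. (\<Sum>j<n. f (\<theta> j)) \<partial>P) = n / (2 * pi) * integral {-pi..pi} f"
proof -
  have [measurable]: "f \<in> borel_measurable borel" using f by (rule borel_measurable_continuous_onI)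
  obtain F where F: "(F has_vector_derivative f x) (at x)" for x
    using einterval_antiderivative[of "-\<infinity>" "\<infinity>" f] f by (auto simp: continuous_on_eq_continuous_at)
  define m where "m = (F pi - F (-pi)) / (2 * pi)"
  have int: "integral {-pi..pi} f = F pi - F (-pi)"
    by (intro integral_unique fundamental_theorem_of_calculus) (auto intro: has_vector_derivative_at_within F)
  define F2 where "F2 t = F t - m * t" for t
  have F2: "(F2 has_vector_derivative (f x - m)) (at x within X)" for x X
    unfolding F2_def by (auto intro!: derivative_eq_intros has_vector_derivative_at_within[OF F])
  have F2p: "F2 pi = F2 (-pi)" unfolding F2_def m_def by (simp add: field_simps)
  have cF2: "continuous_on X F2" for X
    using F2 has_vector_derivative_continuous by (blast intro: continuous_at_imp_continuous_on)
  have [measurable]: "F2 \<in> borel_measurable borel" by (intro borel_measurable_continuous_onI cF2)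
  have "compact (F2 ` {-pi..pi})" "compact (f ` {-pi..pi})"
    by (intro compact_continuous_image cF2 continuous_on_subset[OF f]; simp)+
  then obtain B C where B: "\<And>t. t \<in> {-pi..pi} \<Longrightarrow> \<bar>F2 t\<bar> \<le> B" and C: "\<And>t. t \<in> {-pi..pi} \<Longrightarrow> \<bar>f t\<bar> \<le> C"
    using compact_imp_bounded bounded_iff by (metis (no_types, lifting) imageI real_norm_def)
  have "(\<integral>\<theta>. (\<Sum>i<n. complex_of_real (f (\<theta> i) - m)) \<partial>P) = 0"
  proof (rule ward_identity_rotation[where G = "\<lambda>\<theta>. complex_of_real (\<Sum>j<n. F2 (\<theta> j))" and G' = "\<lambda>i \<theta>. complex_of_real (f (\<theta> i) - m)"])
    fix \<theta> i t assume i: "i < n"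
    have c: "((\<lambda>t. F2 ((\<theta>(i := t)) j)) has_vector_derivative (if j = i then f t - m else 0)) (at t within {-pi..pi})" for j
      using F2 by (cases "j = i") auto
    have "((\<lambda>t. \<Sum>j<n. F2 ((\<theta>(i := t)) j)) has_vector_derivative (f t - m)) (at t within {-pi..pi})"
      by (rule has_vector_derivative_eq_rhs, rule has_vector_derivative_sum, rule c) (use i in simp)
    from bounded_linear.has_vector_derivative[OF bounded_linear_of_real this]
    show "((\<lambda>t. complex_of_real (\<Sum>j<n. F2 ((\<theta>(i := t)) j))) has_vector_derivative complex_of_real (f ((\<theta>(i := t)) i) - m)) (at t within {-pi..pi})"
      by simp
  next
    fix \<theta> :: "nat \<Rightarrow> real" and i
    have "F2 ((\<theta>(i := pi)) j) = F2 ((\<theta>(i := -pi)) j)" for j using F2p by simp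
    then show "complex_of_real (\<Sum>j<n. F2 ((\<theta>(i := pi)) j)) = complex_of_real (\<Sum>j<n. F2 ((\<theta>(i := -pi)) j))"
      by (simp only:)
  next
    fix \<theta> :: "nat \<Rightarrow> real" assume box: "\<And>j. j < n \<Longrightarrow> \<theta> j \<in> {-pi..pi}"
    have "\<bar>\<Sum>j<n. F2 (\<theta> j)\<bar> \<le> (\<Sum>j<n. B)"
      by (intro order_trans[OF sum_abs] sum_mono B box) auto
    then show "cmod (complex_of_real (\<Sum>j<n. F2 (\<theta> j))) \<le> (\<Sum>j<n. B)" by (simp only: norm_of_real)
    fix i assume "i < n"
    then show "cmod (complex_of_real (f (\<theta> i) - m)) \<le> C + \<bar>m\<bar>"
      unfolding norm_of_real by (intro order_trans[OF abs_triangle_ineq4] add_mono C box) auto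
  qed measurable
  then have "complex_of_real (\<integral>\<theta>. (\<Sum>i<n. f (\<theta> i) - m) \<partial>P) = 0"
    by (subst integral_complex_of_real[symmetric]) simp
  then have "0 = (\<integral>\<theta>. (\<Sum>i<n. f (\<theta> i)) - n * m \<partial>P)"
    by (simp add: sum_subtractf)
  also have "\<dots> = (\<integral>\<theta>. (\<Sum>i<n. f (\<theta> i)) \<partial>P) - n * m"
  proof -
    have "integrable P (\<lambda>\<theta>. (\<Sum>i<n. f (\<theta> i)))"
    proof (rule integrable_bounded[where B = "\<Sum>j<n. C"])
      fix \<theta> :: "nat \<Rightarrow> real" assume box: "\<And>j. j < n \<Longrightarrow> \<theta> j \<in> {-pi..pi}"
      show "norm (\<Sum>j<n. f (\<theta> j)) \<le> (\<Sum>j<n. C)"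
        unfolding real_norm_def by (intro order_trans[OF sum_abs] sum_mono C box) auto
    qed measurable
    then show ?thesis by (simp add: prob_space)
  qed
  finally show ?thesis unfolding int m_def by simp
qed

end

section \<open>The cotangent sum\<close>

lemma measurable_cbe_component_compose:
  "j < n \<Longrightarrow> f \<in> measurable M (cbe_space n) \<Longrightarrow> (\<lambda>x. f x j) \<in> borel_measurable M"
  by (rule measurable_compose[OF _ measurable_cbe_component])

lemma borel_measurable_cis [measurable (raw)]:
  "f \<in> borel_measurable M \<Longrightarrow> (\<lambda>x. cis (f x)) \<in> borel_measurable M"
  by (rule measurable_compose[OF _ borel_measurable_continuous_onI[OF continuous_on_cis[OF continuous_on_id]]])

lemma borel_measurable_exp_complex [measurable (raw)]:
  "f \<in> borel_measurable M \<Longrightarrow> (\<lambda>x. exp (f x) :: complex) \<in> borel_measurable M"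
  by (rule measurable_compose[OF _ borel_measurable_continuous_onI[OF continuous_on_exp[OF continuous_on_id]]])

context circular_beta
begin

lemma expectation_interval_integral_swap:
  fixes f :: "(nat \<Rightarrow> real) \<Rightarrow> real \<Rightarrow> 'b::{banach, second_countable_topology}"
  assumes f [measurable]: "case_prod f \<in> borel_measurable (cbe_space n \<Otimes>\<^sub>M borel)"
    and bnd: "\<And>\<theta> s. (\<And>j. j < n \<Longrightarrow> \<theta> j \<in> {-pi..pi}) \<Longrightarrow> s \<in> {a..b} \<Longrightarrow> norm (f \<theta> s) \<le> B"
  shows "(\<integral>\<theta>. (\<integral>s. indicator {a..b} s *\<^sub>R f \<theta> s \<partial>lborel) \<partial>P) =
         (\<integral>s. indicator {a..b} s *\<^sub>R (\<integral>\<theta>. f \<theta> s \<partial>P) \<partial>lborel)" (is ?swap)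
    and "integrable P (\<lambda>\<theta>. \<integral>s. indicator {a..b} s *\<^sub>R f \<theta> s \<partial>lborel)" (is ?int)
proof -
  let ?R = "restrict_space lborel {a..b}"
  interpret R: finite_measure ?R
    by (rule finite_measureI) (auto simp: space_restrict_space emeasure_restrict_space emeasure_lborel_Icc_eq)
  interpret PR: pair_sigma_finite P ?R ..
  interpret F: finite_measure "P \<Otimes>\<^sub>M ?R"
    by (rule finite_measure_pair_measure) unfold_locales
  have m: "(\<lambda>x. x) \<in> measurable (P \<Otimes>\<^sub>M ?R) (cbe_space n \<Otimes>\<^sub>M borel)"
  proof (rule measurable_Pair[of fst _ _ snd, unfolded prod.collapse])
    show "fst \<in> measurable (P \<Otimes>\<^sub>M ?R) (cbe_space n)" by simp
    show "snd \<in> borel_measurable (P \<Otimes>\<^sub>M ?R)"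
      by (rule measurable_compose[OF measurable_snd]) (intro measurable_restrict_space1, simp)
  qed
  have i: "integrable (P \<Otimes>\<^sub>M ?R) (case_prod f)"
  proof (rule F.integrable_const_bound)
    show "AE x in P \<Otimes>\<^sub>M ?R. norm (case_prod f x) \<le> B"
    proof (rule AE_I2)
      fix x assume x: "x \<in> space (P \<Otimes>\<^sub>M ?R)"
      obtain \<theta> s where [simp]: "x = (\<theta>, s)" by (cases x)
      from x have "\<theta> \<in> space (cbe_space n)" "s \<in> {a..b}"
        by (auto simp: space_pair_measure space_restrict_space)
      then show "norm (case_prod f x) \<le> B"
        by (auto intro!: bnd simp: space_cbe_space PiE_iff less_imp_le)
    qed
    show "case_prod f \<in> borel_measurable (P \<Otimes>\<^sub>M ?R)"
      by (rule measurable_compose[OF m f])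
  qed
  have r: "(\<integral>s. g s \<partial>?R) = (\<integral>s. indicator {a..b} s *\<^sub>R g s \<partial>lborel)" for g :: "real \<Rightarrow> 'b"
    by (rule integral_restrict_space) auto
  show ?swap using PR.Fubini_integral[OF i] unfolding r by simp
  show ?int using PR.integrable_fst'[OF i] unfolding r by simp
qed

text \<open>The kernel depends on \<open>w / z\<close> only, so differentiating in the radial variable of \<open>w\<close> amounts to
  rotating all points simultaneously, under which the ensemble is invariant.\<close>
lemma expectation_exp_mean_herglotz:
  assumes xi: "0 \<le> \<xi>" and \<rho>: "0 \<le> \<rho>" "\<rho> < 1" and u: "cmod u = 1"
  shows "(\<integral>\<theta>. exp (- complex_of_real \<xi> * mean_herglotz n (of_real \<rho> * u) \<theta>) \<partial>P) = exp (- complex_of_real \<xi>)"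
proof -
  define \<Psi> where "\<Psi> s \<theta> = exp (- complex_of_real \<xi> * mean_herglotz n (of_real s * u) \<theta>)" for s \<theta>
  define D where "D \<theta> s = (- complex_of_real \<xi> / of_nat n) * (\<Sum>j<n. 2 * cis (\<theta> j) * u / (cis (\<theta> j) - of_real s * u)\<^sup>2) * \<Psi> s \<theta>" for \<theta> s
  have w: "cmod (of_real s * u) < 1" if "s \<in> {0..\<rho>}" for s
    using that \<rho> u by (simp add: norm_mult)
  have nz: "cis t - of_real s * u \<noteq> 0" if "s \<in> {0..\<rho>}" for s t
    using cis_neq_interior[OF w[OF that]] .
  have \<Psi>1: "cmod (\<Psi> s \<theta>) \<le> 1" if "s \<in> {0..\<rho>}" for s \<theta>
  proof -
    have "0 \<le> Re (mean_herglotz n (of_real s * u) \<theta>)"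
      unfolding Re_mean_herglotz by (intro divide_nonneg_nonneg sum_nonneg less_imp_le[OF Re_herglotz_kernel_pos[OF w[OF that]]]) auto
    then show ?thesis unfolding \<Psi>_def norm_exp_eq_Re using xi by (simp add: mult_nonneg_nonneg)
  qed
  have deriv: "((\<lambda>s. \<Psi> s \<theta>) has_vector_derivative D \<theta> s) (at s within X)" if s: "s \<in> {0..\<rho>}" for \<theta> s X
  proof -
    have "((\<lambda>s. herglotz_kernel (of_real s * u) t) has_vector_derivative 2 * cis t * u / (cis t - of_real s * u)\<^sup>2) (at s within X)" for t
    proof -
      have "((\<lambda>w. herglotz_kernel (w * u) t) has_field_derivative 2 * cis t * u / (cis t - of_real s * u)\<^sup>2) (at (of_real s) within of_real ` X)"
        unfolding herglotz_kernel_def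
        by (rule derivative_eq_intros refl nz[OF s])+ (use nz[OF s] in \<open>simp add: divide_simps power2_eq_square; simp add: algebra_simps\<close>)
      moreover have "(complex_of_real has_vector_derivative 1) (at s within X)"
        by (simp add: has_vector_derivative_def scaleR_conv_of_real bounded_linear_imp_has_derivative bounded_linear_of_real)
      ultimately show ?thesis
        using field_vector_diff_chain_within[of complex_of_real 1 s X] by (simp add: o_def)
    qed
    then have "((\<lambda>s. mean_herglotz n (of_real s * u) \<theta>) has_vector_derivative (\<Sum>j<n. 2 * cis (\<theta> j) * u / (cis (\<theta> j) - of_real s * u)\<^sup>2) / of_nat n) (at s within X)"
      unfolding mean_herglotz_def by (intro has_vector_derivative_divide has_vector_derivative_sum)
    then have "((\<lambda>s. - complex_of_real \<xi> * mean_herglotz n (of_real s * u) \<theta>) has_vector_derivative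
        - complex_of_real \<xi> * ((\<Sum>j<n. 2 * cis (\<theta> j) * u / (cis (\<theta> j) - of_real s * u)\<^sup>2) / of_nat n)) (at s within X)"
      by (rule has_vector_derivative_mult_right)
    from field_vector_diff_chain_within[OF this has_field_derivative_at_within[OF DERIV_exp]]
    have "((\<lambda>s. \<Psi> s \<theta>) has_vector_derivative - complex_of_real \<xi> * ((\<Sum>j<n. 2 * cis (\<theta> j) * u / (cis (\<theta> j) - of_real s * u)\<^sup>2) / of_nat n) * \<Psi> s \<theta>) (at s within X)"
      unfolding \<Psi>_def by (simp add: o_def)
    then show ?thesis unfolding D_def by simp
  qed
  have contD: "continuous_on {0..\<rho>} (D \<theta>)" for \<theta>
    unfolding D_def \<Psi>_def mean_herglotz_def herglotz_kernel_def using nz n_pos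
    by (auto intro!: continuous_intros)
  have Db: "cmod (D \<theta> s) \<le> \<xi> / n * (n * (2 / (1 - \<rho>)\<^sup>2))" if s: "s \<in> {0..\<rho>}" for \<theta> s
  proof -
    have "cmod (\<Sum>j<n. 2 * cis (\<theta> j) * u / (cis (\<theta> j) - of_real s * u)\<^sup>2) \<le> (\<Sum>j<n. 2 / (1 - \<rho>)\<^sup>2)"
    proof (rule sum_norm_le)
      fix j
      have "1 - \<rho> \<le> cmod (cis (\<theta> j) - of_real s * u)"
        using norm_triangle_ineq2[of "cis (\<theta> j)" "of_real s * u"] s u by (simp add: norm_mult)
      then have "(1 - \<rho>)\<^sup>2 \<le> (cmod (cis (\<theta> j) - of_real s * u))\<^sup>2" using \<rho> by (intro power_mono) auto
      then show "cmod (2 * cis (\<theta> j) * u / (cis (\<theta> j) - of_real s * u)\<^sup>2) \<le> 2 / (1 - \<rho>)\<^sup>2"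
        using \<rho> u by (simp add: norm_mult norm_divide norm_power frac_le)
    qed
    then have "cmod (D \<theta> s) \<le> (\<xi> / n) * (n * (2 / (1 - \<rho>)\<^sup>2)) * 1"
      unfolding D_def norm_mult using xi \<Psi>1[OF s]
      by (intro mult_mono) (auto simp: norm_divide)
    then show ?thesis by simp
  qed
  note measurable_cbe_component_compose [measurable (raw)]
  have [measurable]: "case_prod D \<in> borel_measurable (cbe_space n \<Otimes>\<^sub>M borel)"
    unfolding D_def \<Psi>_def mean_herglotz_def herglotz_kernel_def by measurable
  have m\<Psi>: "\<Psi> s \<in> borel_measurable (cbe_space n)" for s
    unfolding \<Psi>_def mean_herglotz_def herglotz_kernel_def by measurable
  \<comment> \<open>Radial and angular derivatives of the kernel are related by
    \<open>s * dH/ds = i * H'\<close>. Recovering \<open>D\<close> requires a division by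
    \<open>s\<close>, so \<open>s = 0\<close> is left out; it is a null point of the integral over
    \<open>s\<close>.\<close>
  have ED: "(\<integral>\<theta>. D \<theta> s \<partial>P) = 0" if s: "s \<in> {0..\<rho>}" "s \<noteq> 0" for s
  proof -
    let ?w = "of_real s * u"
    have [measurable]: "herglotz_kernel' ?w \<in> borel_measurable borel" "\<Psi> s \<in> borel_measurable (cbe_space n)"
      using measurable_herglotz_kernel'[OF w[OF s(1)]] m\<Psi> by auto
    define G' where "G' i \<theta> = (- complex_of_real \<xi> / of_nat n) * herglotz_kernel' ?w (\<theta> i) * \<Psi> s \<theta>" for i \<theta>
    have H'b: "cmod (herglotz_kernel' ?w t) \<le> 2 / (1 - cmod ?w) / (1 - cmod ?w)" for t
      by (rule order_trans[OF cmod_herglotz_kernel'_le[OF w[OF s(1)]]])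
        (use w[OF s(1)] in \<open>intro divide_right_mono order_trans[OF complex_Re_le_cmod cmod_herglotz_kernel_le]; simp\<close>)
    have "(\<integral>\<theta>. (\<Sum>i<n. G' i \<theta>) \<partial>P) = 0"
    proof (rule ward_identity_rotation[where G = "\<Psi> s"])
      fix \<theta> i t assume i: "i < n"
      have c: "((\<lambda>t. herglotz_kernel ?w ((\<theta>(i := t)) j)) has_vector_derivative (if j = i then herglotz_kernel' ?w t else 0)) (at t within {-pi..pi})" for j
        using herglotz_kernel_deriv[OF w[OF s(1)]] by (cases "j = i") auto
      have "((\<lambda>t. \<Sum>j<n. herglotz_kernel ?w ((\<theta>(i := t)) j)) has_vector_derivative herglotz_kernel' ?w t) (at t within {-pi..pi})"
        by (rule has_vector_derivative_eq_rhs, rule has_vector_derivative_sum, rule c) (use i in simp)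
      then have "((\<lambda>t. - complex_of_real \<xi> * mean_herglotz n ?w (\<theta>(i := t))) has_vector_derivative - complex_of_real \<xi> * (herglotz_kernel' ?w t / of_nat n)) (at t within {-pi..pi})"
        unfolding mean_herglotz_def by (intro has_vector_derivative_mult_right has_vector_derivative_divide)
      from field_vector_diff_chain_within[OF this has_field_derivative_at_within[OF DERIV_exp]]
      have "((\<lambda>t. \<Psi> s (\<theta>(i := t))) has_vector_derivative - complex_of_real \<xi> * (herglotz_kernel' ?w t / of_nat n) * \<Psi> s (\<theta>(i := t))) (at t within {-pi..pi})"
        unfolding \<Psi>_def by (simp add: o_def)
      then show "((\<lambda>t. \<Psi> s (\<theta>(i := t))) has_vector_derivative G' i (\<theta>(i := t))) (at t within {-pi..pi})"
        unfolding G'_def by simp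
    next
      fix \<theta> :: "nat \<Rightarrow> real" and i
      have "herglotz_kernel ?w ((\<theta>(i := pi)) j) = herglotz_kernel ?w ((\<theta>(i := -pi)) j)" for j
        unfolding herglotz_kernel_def by (simp add: cis.code)
      then show "\<Psi> s (\<theta>(i := pi)) = \<Psi> s (\<theta>(i := - pi))" unfolding \<Psi>_def mean_herglotz_def by (simp only:)
    next
      show "G' i \<in> borel_measurable (cbe_space n)" if "i < n" for i
        using that unfolding G'_def by measurable
      show "cmod (\<Psi> s \<theta>) \<le> 1" for \<theta> by (rule \<Psi>1[OF s(1)])
      show "cmod (G' i \<theta>) \<le> \<xi> / n * (2 / (1 - cmod ?w) / (1 - cmod ?w)) * 1" for i \<theta>
      proof -
        have "cmod (- complex_of_real \<xi> / of_nat n) = \<xi> / n" using xi by (simp add: norm_divide)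
        moreover have "0 \<le> 2 / (1 - cmod ?w) / (1 - cmod ?w)" using order_trans[OF norm_ge_zero H'b] .
        ultimately show ?thesis
          unfolding G'_def norm_mult[of _ "\<Psi> s \<theta>"] norm_mult[of _ "herglotz_kernel' ?w (\<theta> i)"] using xi
          by (intro mult_mono \<Psi>1[OF s(1)] H'b mult_nonneg_nonneg) simp_all
      qed
    qed (use m\<Psi> in auto)
    moreover have "complex_of_real s * D \<theta> s = \<i> * (\<Sum>i<n. G' i \<theta>)" for \<theta>
    proof -
      have "\<i> * herglotz_kernel' ?w t = complex_of_real s * (2 * cis t * u / (cis t - ?w)\<^sup>2)" for t
        unfolding herglotz_kernel'_def herglotz_kernel_sq_minus_1[OF w[OF s(1)]]
        by (simp add: algebra_simps)
      then have "complex_of_real s * (\<Sum>j<n. 2 * cis (\<theta> j) * u / (cis (\<theta> j) - ?w)\<^sup>2) = (\<Sum>j<n. \<i> * herglotz_kernel' ?w (\<theta> j))"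
        by (simp only: sum_distrib_left)
      then have "(- complex_of_real \<xi> / of_nat n) * (complex_of_real s * (\<Sum>j<n. 2 * cis (\<theta> j) * u / (cis (\<theta> j) - ?w)\<^sup>2)) * \<Psi> s \<theta> =
         (- complex_of_real \<xi> / of_nat n) * (\<Sum>j<n. \<i> * herglotz_kernel' ?w (\<theta> j)) * \<Psi> s \<theta>" by (simp only:)
      then show ?thesis
        unfolding D_def G'_def by (simp only: sum_distrib_left sum_distrib_right mult_ac)
    qed
    ultimately have "(\<integral>\<theta>. complex_of_real s * D \<theta> s \<partial>P) = \<i> * 0"
      by (simp only: integral_mult_right_zero)
    then have "complex_of_real s * (\<integral>\<theta>. D \<theta> s \<partial>P) = 0"
      by (simp only: integral_mult_right_zero mult_zero_right)
    then show ?thesis using s by simp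
  qed
  have FTC: "(\<integral>s. indicator {0..\<rho>} s *\<^sub>R D \<theta> s \<partial>lborel) = \<Psi> \<rho> \<theta> - \<Psi> 0 \<theta>" for \<theta>
    using deriv \<rho> by (intro integral_FTC_atLeastAtMost contD) auto
  have int\<Psi>: "integrable P (\<Psi> s)" if "s \<in> {0..\<rho>}" for s
    by (rule integrable_bounded[OF m\<Psi> \<Psi>1[OF that]])
  have "(\<integral>\<theta>. \<Psi> \<rho> \<theta> - \<Psi> 0 \<theta> \<partial>P) = (\<integral>s. indicator {0..\<rho>} s *\<^sub>R (\<integral>\<theta>. D \<theta> s \<partial>P) \<partial>lborel)"
    unfolding FTC[symmetric] by (rule expectation_interval_integral_swap(1)[OF _ Db]) auto
  also have "\<dots> = (\<integral>s. 0 \<partial>(lborel :: real measure))"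
  proof (rule integral_cong_AE)
    have "AE s in lborel. s \<noteq> (0 :: real)" by (rule AE_lborel_singleton)
    then show "AE s in lborel. indicator {0..\<rho>} s *\<^sub>R (\<integral>\<theta>. D \<theta> s \<partial>P) = 0"
      by eventually_elim (use ED in \<open>auto simp: indicator_def\<close>)
    have [measurable]: "(\<lambda>(s, \<theta>). D \<theta> s) \<in> borel_measurable (borel \<Otimes>\<^sub>M P)"
      unfolding D_def \<Psi>_def mean_herglotz_def herglotz_kernel_def by measurable
    have "(\<lambda>s. \<integral>\<theta>. D \<theta> s \<partial>P) \<in> borel_measurable borel"
      by (rule borel_measurable_lebesgue_integral) measurable
    then show "(\<lambda>s. indicat_real {0..\<rho>} s *\<^sub>R (\<integral>\<theta>. D \<theta> s \<partial>P)) \<in> borel_measurable lborel"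
      by measurable
  qed simp
  finally have "(\<integral>\<theta>. \<Psi> \<rho> \<theta> \<partial>P) = (\<integral>\<theta>. \<Psi> 0 \<theta> \<partial>P)"
    using int\<Psi>[of \<rho>] int\<Psi>[of 0] \<rho> by simp
  also have "\<dots> = exp (- complex_of_real \<xi>)"
    unfolding \<Psi>_def mean_herglotz_def herglotz_kernel_def using n_pos by simp
  finally show ?thesis unfolding \<Psi>_def .
qed

end

text \<open>If some \<open>\<theta>\<^sub>j\<close> vanishes, then \<open>Re S(\<rho>)\<close> tends to infinity and \<open>exp (- \<xi> S(\<rho>))\<close> to zero; this is the
  value used on the exceptional set, so that its probability need not be known.\<close>
lemma (in circular_beta) expectation_cis_cot:
  assumes xi: "0 < \<xi>"
  shows "(\<integral>\<theta>. (if \<exists>j<n. \<theta> j = 0 then 0 else cis (\<xi> / n * (\<Sum>j<n. cot (\<theta> j / 2)))) \<partial>P) = exp (- complex_of_real \<xi>)"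
proof -
  define \<rho> where "\<rho> k = real k / real (Suc k)" for k
  have \<rho>: "0 \<le> \<rho> k" "\<rho> k < 1" for k unfolding \<rho>_def by (auto simp: divide_simps)
  have \<rho>lim: "\<rho> \<longlonglongrightarrow> 1"
    unfolding \<rho>_def using LIMSEQ_n_over_Suc_n by simp
  have w: "cmod (complex_of_real (\<rho> k) * 1) < 1" for k using \<rho>[of k] by simp
  define \<Psi> where "\<Psi> k \<theta> = exp (- complex_of_real \<xi> * mean_herglotz n (of_real (\<rho> k) * 1) \<theta>)" for k \<theta>
  define L where "L \<theta> = (if \<exists>j<n. \<theta> j = 0 then 0 else cis (\<xi> / n * (\<Sum>j<n. cot (\<theta> j / 2))))" for \<theta>
  have nonneg: "0 \<le> Re (herglotz_kernel (of_real (\<rho> k) * 1) t)" for k t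
    by (rule less_imp_le[OF Re_herglotz_kernel_pos[OF w]])
  have \<Psi>1: "cmod (\<Psi> k \<theta>) \<le> 1" for k \<theta>
  proof -
    have "0 \<le> Re (mean_herglotz n (of_real (\<rho> k) * 1) \<theta>)"
      unfolding Re_mean_herglotz by (intro divide_nonneg_nonneg sum_nonneg nonneg) auto
    then show ?thesis unfolding \<Psi>_def norm_exp_eq_Re using xi by (simp add: mult_nonneg_nonneg)
  qed
  have lim: "(\<lambda>k. \<Psi> k \<theta>) \<longlonglongrightarrow> L \<theta>" if box: "\<And>j. j < n \<Longrightarrow> \<theta> j \<in> {-pi<..pi}" for \<theta>
  proof (cases "\<exists>j<n. \<theta> j = 0")
    case True
    then obtain i where i: "i < n" "\<theta> i = 0" by auto
    \<comment> \<open>For a point at angle 0 the kernel equals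
      \<open>(1 + \<rho> k) / (1 - \<rho> k) = 2 k + 1\<close>, and the remaining real parts are
      nonnegative.\<close>
    have "cmod (\<Psi> k \<theta>) \<le> exp (- (\<xi> / n) * real (Suc k))" for k
    proof -
      have "real (Suc k) \<le> (1 + \<rho> k) / (1 - \<rho> k)"
        unfolding \<rho>_def by (simp add: divide_simps)
      also have "\<dots> = Re (herglotz_kernel (of_real (\<rho> k) * 1) (\<theta> i))"
      proof -
        have "herglotz_kernel (of_real (\<rho> k) * 1) (\<theta> i) = complex_of_real ((1 + \<rho> k) / (1 - \<rho> k))"
          unfolding herglotz_kernel_def i(2) by simp
        then show ?thesis by (simp only: Re_complex_of_real)
      qed
      also have "\<dots> \<le> (\<Sum>j<n. Re (herglotz_kernel (of_real (\<rho> k) * 1) (\<theta> j)))"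
        using i by (intro member_le_sum nonneg) auto
      finally have "\<xi> * (real (Suc k) / n) \<le> \<xi> * Re (mean_herglotz n (of_real (\<rho> k) * 1) \<theta>)"
        unfolding Re_mean_herglotz using xi by (intro mult_left_mono divide_right_mono) auto
      then show ?thesis unfolding \<Psi>_def norm_exp_eq_Re by simp
    qed
    moreover have "(\<lambda>k. exp (- (\<xi> / n) * real (Suc k))) \<longlonglongrightarrow> 0"
    proof -
      have "filterlim (\<lambda>k. (\<xi> / n) * real (Suc k)) at_top sequentially"
        using xi n_pos by (intro filterlim_tendsto_pos_mult_at_top[OF tendsto_const] filterlim_compose[OF filterlim_real_sequentially filterlim_Suc]) auto
      then have "filterlim (\<lambda>k. - ((\<xi> / n) * real (Suc k))) at_bot sequentially"
        by (simp only: filterlim_uminus_at_bot minus_minus)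
      from filterlim_compose[OF exp_at_bot this] show ?thesis by simp
    qed
    ultimately have "(\<lambda>k. \<Psi> k \<theta>) \<longlonglongrightarrow> 0"
      by (rule Lim_null_comparison[OF always_eventually[rule_format]])
    then show ?thesis unfolding L_def using True by auto
  next
    case False
    \<comment> \<open>On the unit circle the kernel at \<open>w = 1\<close> is purely imaginary,
      \<open>(z + 1) / (z - 1) = - i cot (\<theta> / 2)\<close>, so \<open>- \<xi> S\<close> tends
      to \<open>i (\<xi> / n)\<close> times the sum of the cotangents.\<close>
    have "(\<lambda>k. herglotz_kernel (of_real (\<rho> k) * 1) (\<theta> j)) \<longlonglongrightarrow> - \<i> * cot (\<theta> j / 2)" if j: "j < n" for j
    proof -
      let ?a = "\<theta> j / 2"
      have s: "sin ?a \<noteq> 0"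
      proof
        assume "sin ?a = 0"
        moreover have "- pi < ?a" "?a < pi"
          using box[OF j] pi_gt_zero unfolding greaterThanAtMost_iff by linarith+
        ultimately have "?a = 0" using sin_eq_0_pi by blast
        then show False using False j by auto
      qed
      have h: "cis (\<theta> j) = cis ?a * cis ?a" by (simp add: cis_mult)
      have "cis (\<theta> j) - 1 = cis ?a * (2 * \<i> * of_real (sin ?a))"
        unfolding h by (simp add: complex_eq_iff algebra_simps; use sin_cos_squared_add3[of ?a] in algebra)
      moreover have "cis (\<theta> j) + 1 = cis ?a * (2 * of_real (cos ?a))"
        unfolding h by (simp add: complex_eq_iff algebra_simps; use sin_cos_squared_add3[of ?a] in algebra)
      ultimately have e: "(cis (\<theta> j) + 1) / (cis (\<theta> j) - 1) = - \<i> * cot ?a" and nz: "cis (\<theta> j) - 1 \<noteq> 0"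
        using s by (simp_all add: cot_def divide_simps)
      have "(\<lambda>k. (cis (\<theta> j) + of_real (\<rho> k) * 1) / (cis (\<theta> j) - of_real (\<rho> k) * 1)) \<longlonglongrightarrow> (cis (\<theta> j) + of_real 1 * 1) / (cis (\<theta> j) - of_real 1 * 1)"
        using nz by (intro tendsto_intros \<rho>lim) auto
      then show ?thesis unfolding herglotz_kernel_def using e by simp
    qed
    then have "(\<lambda>k. mean_herglotz n (of_real (\<rho> k) * 1) \<theta>) \<longlonglongrightarrow> (\<Sum>j<n. - \<i> * cot (\<theta> j / 2)) / of_nat n"
      unfolding mean_herglotz_def using n_pos by (intro tendsto_intros tendsto_sum) auto
    then have "(\<lambda>k. \<Psi> k \<theta>) \<longlonglongrightarrow> exp (- complex_of_real \<xi> * ((\<Sum>j<n. - \<i> * cot (\<theta> j / 2)) / of_nat n))"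
      unfolding \<Psi>_def by (intro tendsto_intros)
    also have "- complex_of_real \<xi> * ((\<Sum>j<n. - \<i> * cot (\<theta> j / 2)) / of_nat n) = \<i> * of_real (\<xi> / n * (\<Sum>j<n. cot (\<theta> j / 2)))"
      by (simp add: sum_negf sum_distrib_left[symmetric])
    also have "exp (\<i> * of_real (\<xi> / n * (\<Sum>j<n. cot (\<theta> j / 2)))) = L \<theta>"
      unfolding L_def using False by (simp only: cis_conv_exp if_False)
    finally show ?thesis .
  qed
  have [measurable]: "cot \<in> borel_measurable (borel :: real measure)"
    unfolding cot_def by measurable
  have "(\<lambda>k. \<integral>\<theta>. \<Psi> k \<theta> \<partial>P) \<longlonglongrightarrow> (\<integral>\<theta>. L \<theta> \<partial>P)"
  proof (rule integral_dominated_convergence[where w = "\<lambda>_. 1"])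
    show "AE \<theta> in P. (\<lambda>k. \<Psi> k \<theta>) \<longlonglongrightarrow> L \<theta>"
      by (rule AE_I2, rule lim) (auto simp: space_cbe_space PiE_iff)
    have "{\<theta> \<in> space (cbe_space n). \<exists>j<n. \<theta> j = 0} \<in> sets (cbe_space n)"
      by measurable
    then show "L \<in> borel_measurable P"
      unfolding L_def by measurable
    show "\<Psi> k \<in> borel_measurable P" for k
      unfolding \<Psi>_def mean_herglotz_def herglotz_kernel_def by measurable
  qed (use \<Psi>1 in auto)
  moreover have "(\<integral>\<theta>. \<Psi> k \<theta> \<partial>P) = exp (- complex_of_real \<xi>)" for k
    unfolding \<Psi>_def by (rule expectation_exp_mean_herglotz) (use xi \<rho> in auto)
  ultimately have "(\<integral>\<theta>. L \<theta> \<partial>P) = exp (- complex_of_real \<xi>)"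
    by (simp add: LIMSEQ_const_iff)
  then show ?thesis unfolding L_def .
qed

section \<open>The Cauchy law from the one-point ensemble\<close>

lemma cbe_weight_1: "cbe_weight \<beta> 1 \<theta> = 1"
proof -
  have "{0<..<1::nat} = {}" by auto
  then show ?thesis unfolding cbe_weight_def by (simp add: lessThan_Suc)
qed

lemma integral_cbe_space_1:
  fixes f :: "real \<Rightarrow> 'b::{banach, second_countable_topology}"
  assumes "f \<in> borel_measurable borel"
  shows "(\<integral>\<theta>. f (\<theta> 0) \<partial>cbe_space 1) = (\<integral>t. indicator {-pi<..pi} t *\<^sub>R f t \<partial>lborel)"
proof -
  interpret product_sigma_finite "\<lambda>_::nat. restrict_space lborel {-pi<..pi}"
    by (rule product_sigma_finite_circle)
  have "{..<1::nat} = {0}" by auto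
  moreover have "f \<in> borel_measurable (restrict_space lborel {-pi<..pi})"
    using assms by (intro measurable_restrict_space1) auto
  ultimately show ?thesis
    unfolding cbe_space_def integral_circle[symmetric] by (simp add: product_integral_singleton)
qed

text \<open>For one point the weight is constant, so \<beta> = 1 is an arbitrary choice and
  \<open>S\<close> is the kernel itself. Letting \<open>w\<close> tend to \<open>-1\<close> instead
  of \<open>1\<close> produces the tangent, which is a bijection of the open interval onto the line,
  so that a substitution can follow.\<close>

lemma integral_cis_tan_half:
  assumes xi: "0 \<le> \<xi>"
  shows "(\<integral>t. indicator {-pi<..pi} t *\<^sub>R cis (\<xi> * tan (t / 2)) \<partial>lborel) = 2 * pi * exp (- \<xi>)"
proof -
  have "(\<integral>\<theta>. cbe_weight 1 1 \<theta> \<partial>cbe_space 1) = (\<integral>t. indicator {-pi<..pi} t *\<^sub>R (1::real) \<partial>lborel)"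
    unfolding cbe_weight_1 by (rule integral_cbe_space_1[of "\<lambda>_. 1"]) simp
  also have "\<dots> = 2 * pi" by simp
  finally have Z: "(\<integral>\<theta>. cbe_weight 1 1 \<theta> \<partial>cbe_space 1) = 2 * pi" .
  interpret circular_beta 1 1 by standard (simp_all only: Z, simp_all)
  define \<rho> where "\<rho> k = real k / real (Suc k)" for k
  have \<rho>: "0 \<le> \<rho> k" "\<rho> k < 1" for k unfolding \<rho>_def by (auto simp: divide_simps)
  have \<rho>lim: "\<rho> \<longlonglongrightarrow> 1"
    unfolding \<rho>_def using LIMSEQ_n_over_Suc_n by simp
  have w: "cmod (complex_of_real (\<rho> k) * (-1)) < 1" for k using \<rho>[of k] by simp
  define f where "f k t = exp (- complex_of_real \<xi> * herglotz_kernel (of_real (\<rho> k) * (-1)) t)" for k t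
  have fm [measurable]: "f k \<in> borel_measurable borel" for k
    using measurable_herglotz_kernel[OF w, of k] unfolding f_def by measurable
  have f1: "cmod (f k t) \<le> 1" for k t
    unfolding f_def norm_exp_eq_Re using xi less_imp_le[OF Re_herglotz_kernel_pos[OF w, of k t]] by (simp add: mult_nonneg_nonneg)
  have "(\<integral>t. indicator {-pi<..pi} t *\<^sub>R f k t \<partial>lborel) = 2 * pi * exp (- complex_of_real \<xi>)" for k
  proof -
    have "exp (- complex_of_real \<xi>) = (\<integral>\<theta>. exp (- complex_of_real \<xi> * mean_herglotz 1 (of_real (\<rho> k) * (-1)) \<theta>) \<partial>P)"
      by (rule expectation_exp_mean_herglotz[symmetric]) (use xi \<rho> in auto)
    also have "\<dots> = (\<integral>\<theta>. f k (\<theta> 0) \<partial>P)"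
      unfolding f_def mean_herglotz_def by simp
    also have "\<dots> = (\<integral>\<theta>. f k (\<theta> 0) \<partial>cbe_space 1) /\<^sub>R (2 * pi)"
      by (subst integral_cbe_measure) (measurable, simp_all only: cbe_weight_1 Z scaleR_one)
    also have "(\<integral>\<theta>. f k (\<theta> 0) \<partial>cbe_space 1) = (\<integral>t. indicator {-pi<..pi} t *\<^sub>R f k t \<partial>lborel)"
      by (rule integral_cbe_space_1) measurable
    finally show ?thesis by (simp add: scaleR_conv_of_real field_simps)
  qed
  moreover have "(\<lambda>k. \<integral>t. indicator {-pi<..pi} t *\<^sub>R f k t \<partial>lborel) \<longlonglongrightarrow> (\<integral>t. indicator {-pi<..pi} t *\<^sub>R cis (- \<xi> * tan (t / 2)) \<partial>lborel)"
  proof (rule integral_dominated_convergence[where w = "indicator {-pi<..pi}"])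
    have "AE t in lborel. t \<noteq> (pi :: real)" by (rule AE_lborel_singleton)
    then show "AE t in lborel. (\<lambda>k. indicator {-pi<..pi} t *\<^sub>R f k t) \<longlonglongrightarrow> indicator {-pi<..pi} t *\<^sub>R cis (- \<xi> * tan (t / 2))"
    proof eventually_elim
      fix t :: real assume t: "t \<noteq> pi"
      show "(\<lambda>k. indicator {-pi<..pi} t *\<^sub>R f k t) \<longlonglongrightarrow> indicator {-pi<..pi} t *\<^sub>R cis (- \<xi> * tan (t / 2))"
      proof (cases "t \<in> {-pi<..pi}")
        case True
        let ?a = "t / 2"
        have c: "cos ?a > 0" using True t by (intro cos_gt_zero_pi) auto
        have h: "cis t = cis ?a * cis ?a" by (simp add: cis_mult)
        have "cis t - 1 = cis ?a * (2 * \<i> * of_real (sin ?a))"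
          unfolding h by (simp add: complex_eq_iff algebra_simps; use sin_cos_squared_add3[of ?a] in algebra)
        moreover have "cis t + 1 = cis ?a * (2 * of_real (cos ?a))"
          unfolding h by (simp add: complex_eq_iff algebra_simps; use sin_cos_squared_add3[of ?a] in algebra)
        ultimately have e: "(cis t - 1) / (cis t + 1) = \<i> * tan ?a" and nz: "cis t + 1 \<noteq> 0"
          using c by (simp_all add: tan_def divide_simps)
        have "(\<lambda>k. (cis t + of_real (\<rho> k) * (-1)) / (cis t - of_real (\<rho> k) * (-1))) \<longlonglongrightarrow> (cis t + of_real 1 * (-1)) / (cis t - of_real 1 * (-1))"
          using nz by (intro tendsto_intros \<rho>lim) auto
        then have "(\<lambda>k. herglotz_kernel (of_real (\<rho> k) * (-1)) t) \<longlonglongrightarrow> \<i> * tan ?a"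
          unfolding herglotz_kernel_def using e by simp
        then have "(\<lambda>k. f k t) \<longlonglongrightarrow> exp (- complex_of_real \<xi> * (\<i> * tan ?a))"
          unfolding f_def by (intro tendsto_intros)
        also have "- complex_of_real \<xi> * (\<i> * tan ?a) = \<i> * of_real (- \<xi> * tan ?a)" by simp
        finally show ?thesis using True by (simp only: cis_conv_exp indicator_simps scaleR_one)
      qed auto
    qed
  next
    show "(\<lambda>t. indicat_real {-pi<..pi} t *\<^sub>R cis (- \<xi> * tan (t / 2))) \<in> borel_measurable lborel"
    proof -
      have "(\<lambda>t::real. tan (t / 2)) \<in> borel_measurable borel" unfolding tan_def by measurable
      then show ?thesis
        by (intro borel_measurable_scaleR borel_measurable_cis borel_measurable_times) simp_all
    qed
  qed (use f1 in \<open>auto simp: indicator_def\<close>)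
  ultimately have "(\<integral>t. indicator {-pi<..pi} t *\<^sub>R cis (- \<xi> * tan (t / 2)) \<partial>lborel) = 2 * pi * exp (- complex_of_real \<xi>)"
    by (simp add: LIMSEQ_const_iff)
  \<comment> \<open>The limit at \<open>w = -1\<close> carries \<open>- \<xi>\<close>. The value is
    real, so conjugation changes the sign.\<close>
  then have "cnj (\<integral>t. indicator {-pi<..pi} t *\<^sub>R cis (- \<xi> * tan (t / 2)) \<partial>lborel) = cnj (2 * pi * exp (complex_of_real (- \<xi>)))"
    by simp
  also have "\<dots> = 2 * pi * exp (- \<xi>)"
    unfolding exp_of_real by simp
  also have "cnj (\<integral>t. indicator {-pi<..pi} t *\<^sub>R cis (- \<xi> * tan (t / 2)) \<partial>lborel) =
      (\<integral>t. cnj (indicator {-pi<..pi} t *\<^sub>R cis (- \<xi> * tan (t / 2))) \<partial>lborel)"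
    by (rule Bochner_Integration.integral_cnj[symmetric])
  also have "\<dots> = (\<integral>t. indicator {-pi<..pi} t *\<^sub>R cis (\<xi> * tan (t / 2)) \<partial>lborel)"
    by (simp add: cis_cnj)
  finally show ?thesis .
qed

definition cauchy_density :: "real \<Rightarrow> real" where
  "cauchy_density x = 1 / (2 * pi * (x\<^sup>2 + 1/4))"

lemma cauchy_density_nonneg: "0 \<le> cauchy_density x"
  unfolding cauchy_density_def by (intro divide_nonneg_nonneg mult_nonneg_nonneg) auto

lemma continuous_on_cauchy_density: "continuous_on X cauchy_density"
proof -
  have "2 * pi * (x\<^sup>2 + 1/4) \<noteq> 0" for x :: real
    using zero_le_power2[of x] by (auto simp: add_nonneg_eq_0_iff)
  then show ?thesis unfolding cauchy_density_def by (intro continuous_intros) auto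
qed

lemma measurable_cauchy_density [measurable]: "cauchy_density \<in> borel_measurable borel"
  by (intro borel_measurable_continuous_onI continuous_on_cauchy_density)

text \<open>\<open>cauchy_density\<close> is the Cauchy density of scale 1/2, the law of
  \<open>tan (t / 2) / 2\<close> for uniform \<open>t\<close>. The substitution is
  \<open>y = tan v\<close> on the open interval of length \<open>pi\<close>, with the linear changes
  \<open>t = 2 v\<close> and \<open>y = 2 x\<close> on either side.\<close>

lemma cauchy_density_substitution:
  fixes h :: "real \<Rightarrow> complex"
  assumes h: "continuous_on UNIV h" and b: "\<And>x. cmod (h x) \<le> 1"
  shows "integrable lborel cauchy_density"
    and "(\<integral>x. cauchy_density x *\<^sub>R h x \<partial>lborel) = (\<integral>t. indicator {-pi<..pi} t *\<^sub>R h (tan (t / 2) / 2) \<partial>lborel) / (2 * pi)"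
proof -
  have nz: "1 + y\<^sup>2 \<noteq> 0" for y :: real using zero_le_power2[of y] by linarith
  have cd: "cauchy_density x = 2 / pi * inverse (1 + (0 + 2 * x)\<^sup>2)" for x
    unfolding cauchy_density_def by (simp add: divide_simps)
  have int: "integrable lborel (\<lambda>y::real. inverse (1 + y\<^sup>2))"
    using integrable_inverse_1_plus_square unfolding set_integrable_def by simp
  from lborel_integrable_real_affine[OF int, of 2 0]
  show "integrable lborel cauchy_density" unfolding cd[abs_def] by simp
  define f where "f y = inverse (1 + y\<^sup>2) *\<^sub>R h (y / 2)" for y :: real
  have hc: "continuous_on UNIV (\<lambda>y. h (c y))" if "continuous_on UNIV c" for c :: "real \<Rightarrow> real"
    using continuous_on_compose2[OF h that] by simp
  have fc: "continuous_on UNIV f"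
    unfolding f_def using nz by (intro continuous_intros hc) auto
  have intf: "integrable lborel f"
  proof (rule Bochner_Integration.integrable_bound[OF int])
    show "f \<in> borel_measurable lborel" using borel_measurable_continuous_onI[OF fc] by simp
    show "AE y in lborel. norm (f y) \<le> norm (inverse (1 + y\<^sup>2))"
      unfolding f_def norm_scaleR using b by (intro AE_I2) (simp add: mult_left_le)
  qed
  have meas: "(\<lambda>t. h (tan t / 2)) \<in> borel_measurable borel"
  proof -
    have "(\<lambda>t::real. tan t / 2) \<in> borel_measurable borel" unfolding tan_def by measurable
    then show ?thesis by (rule measurable_compose[OF _ borel_measurable_continuous_onI[OF h]])
  qed
  have "(\<integral>y. f y \<partial>lborel) = (LBINT y=-\<infinity>..\<infinity>. f y)"
    by (simp add: interval_lebesgue_integral_le_eq set_lebesgue_integral_def)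
  also have "\<dots> = (LBINT v=ereal (-pi/2)..ereal (pi/2). (1 + (tan v)\<^sup>2) *\<^sub>R f (tan v))"
  proof (rule interval_integral_substitution_integrable)
    fix v assume v: "ereal (-pi/2) < ereal v" "ereal v < ereal (pi/2)"
    then have c: "cos v > 0" by (intro cos_gt_zero_pi) auto
    then show "(tan has_real_derivative 1 + (tan v)\<^sup>2) (at v)"
      by (subst tan_sec) (auto intro!: DERIV_tan simp: power_inverse)
    show "isCont f (tan v)" using fc by (simp add: continuous_on_eq_continuous_at)
    show "isCont (\<lambda>v. 1 + (tan v)\<^sup>2) v" using c by auto
  next
    show "((ereal \<circ> tan \<circ> real_of_ereal) \<longlongrightarrow> - \<infinity>) (at_right (ereal (-pi/2)))"
      using filterlim_tan_at_right by (simp add: ereal_tendsto_simps)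
    show "((ereal \<circ> tan \<circ> real_of_ereal) \<longlongrightarrow> \<infinity>) (at_left (ereal (pi/2)))"
      using filterlim_tan_at_left by (simp add: ereal_tendsto_simps)
    have "set_integrable lborel {-pi/2<..<pi/2} (\<lambda>v. h (tan v / 2))"
      unfolding set_integrable_def
    proof (rule Bochner_Integration.integrable_bound[of _ "indicat_real {-pi/2<..<pi/2}"])
      show "(\<lambda>v. indicat_real {-pi/2<..<pi/2} v *\<^sub>R h (tan v / 2)) \<in> borel_measurable lborel"
        using meas by (intro borel_measurable_scaleR) simp_all
    qed (use b in \<open>auto simp: indicator_def\<close>)
    then show "set_integrable lborel (einterval (ereal (-pi/2)) (ereal (pi/2))) (\<lambda>v. (1 + (tan v)\<^sup>2) *\<^sub>R f (tan v))"
      unfolding f_def using nz by simp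
    show "set_integrable lborel (einterval (- \<infinity>) \<infinity>) f"
      using intf by (simp add: set_integrable_def)
  qed auto
  also have "\<dots> = (\<integral>v. indicator {-pi/2<..<pi/2} v *\<^sub>R h (tan v / 2) \<partial>lborel)"
    unfolding f_def using nz by (simp add: interval_lebesgue_integral_le_eq set_lebesgue_integral_def)
  also have "\<dots> = (\<integral>v. indicator {-pi<..pi} (0 + 2 * v) *\<^sub>R h (tan ((0 + 2 * v) / 2) / 2) \<partial>lborel)"
  proof (rule integral_cong_AE)
    have "AE v in lborel. v \<noteq> (pi / 2 :: real)" by (rule AE_lborel_singleton)
    then show "AE v in lborel. indicat_real {-pi/2<..<pi/2} v *\<^sub>R h (tan v / 2) = indicat_real {-pi<..pi} (0 + 2 * v) *\<^sub>R h (tan ((0 + 2 * v) / 2) / 2)"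
      by eventually_elim (auto simp: indicator_def)
  qed (use meas in \<open>simp_all\<close>)
  finally have 1: "(\<integral>y. f y \<partial>lborel) = \<dots>" .
  have 2: "(\<integral>t. indicator {-pi<..pi} t *\<^sub>R h (tan (t / 2) / 2) \<partial>lborel) =
     2 *\<^sub>R (\<integral>v. indicator {-pi<..pi} (0 + 2 * v) *\<^sub>R h (tan ((0 + 2 * v) / 2) / 2) \<partial>lborel)"
    using lborel_integral_real_affine[of 2 "\<lambda>t. indicator {-pi<..pi} t *\<^sub>R h (tan (t / 2) / 2)" 0] by simp
  have "(\<integral>y. f y \<partial>lborel) = 2 *\<^sub>R (\<integral>x. f (0 + 2 * x) \<partial>lborel)"
    using lborel_integral_real_affine[of 2 f 0] by simp
  also have "(\<integral>x. f (0 + 2 * x) \<partial>lborel) = (\<integral>x. (pi / 2) *\<^sub>R (cauchy_density x *\<^sub>R h x) \<partial>lborel)"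
    unfolding f_def cd by simp
  also have "\<dots> = (pi / 2) *\<^sub>R (\<integral>x. cauchy_density x *\<^sub>R h x \<partial>lborel)"
    by (rule integral_scaleR_right)
  finally have "(\<integral>y. f y \<partial>lborel) = pi *\<^sub>R (\<integral>x. cauchy_density x *\<^sub>R h x \<partial>lborel)" by simp
  then show "(\<integral>x. cauchy_density x *\<^sub>R h x \<partial>lborel) = (\<integral>t. indicator {-pi<..pi} t *\<^sub>R h (tan (t / 2) / 2) \<partial>lborel) / (2 * pi)"
    using 1 2 by (simp add: scaleR_conv_of_real field_simps)
qed

lemma cauchy_char:
  assumes "0 \<le> \<xi>"
  shows "(\<integral>x. cauchy_density x *\<^sub>R cis (\<xi> * x) \<partial>lborel) = exp (- \<xi> / 2)"
proof -
  have "(\<integral>x. cauchy_density x *\<^sub>R cis (\<xi> * x) \<partial>lborel) =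
    (\<integral>t. indicator {-pi<..pi} t *\<^sub>R cis (\<xi> * (tan (t / 2) / 2)) \<partial>lborel) / (2 * pi)"
    by (rule cauchy_density_substitution) (auto intro!: continuous_intros)
  also have "\<dots> = exp (- (\<xi> / 2))"
    using integral_cis_tan_half[of "\<xi> / 2"] assms by (simp add: mult.commute)
  finally show ?thesis by simp
qed

lemma cauchy_mass: "(\<integral>x. cauchy_density x \<partial>lborel) = 1"
proof -
  have "complex_of_real (\<integral>x. cauchy_density x \<partial>lborel) = 1"
    using cauchy_char[of 0] by (simp add: scaleR_conv_of_real)
  then show ?thesis by simp
qed

section \<open>Counting statistics\<close>

lemma Re_herglotz_kernel_polar:
  assumes \<rho>: "0 \<le> \<rho>" "\<rho> < 1"
  shows "Re (herglotz_kernel (of_real \<rho> * cis \<alpha>) t) = (1 - \<rho>\<^sup>2) / (1 + \<rho>\<^sup>2 - 2 * \<rho> * cos (\<alpha> - t))"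
proof -
  have "cmod (of_real \<rho> * cis \<alpha>) = \<rho>" using \<rho> by (simp add: norm_mult)
  moreover have "(cmod (cis t - of_real \<rho> * cis \<alpha>))\<^sup>2 = 1 + \<rho>\<^sup>2 - 2 * \<rho> * cos (\<alpha> - t)"
  proof -
    have "(cmod (cis t - of_real \<rho> * cis \<alpha>))\<^sup>2 = ((sin t)\<^sup>2 + (cos t)\<^sup>2) + \<rho>\<^sup>2 * ((sin \<alpha>)\<^sup>2 + (cos \<alpha>)\<^sup>2) - 2 * \<rho> * (cos \<alpha> * cos t + sin \<alpha> * sin t)"
      unfolding cmod_power2 by simp (use sin_cos_squared_add[of t] sin_cos_squared_add[of \<alpha>] in algebra)
    then show ?thesis by (simp add: cos_diff)
  qed
  ultimately show ?thesis using Re_herglotz_kernel[of "of_real \<rho> * cis \<alpha>" t] \<rho> by simp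
qed

text \<open>The integral is exactly \<open>4 arctan (K tan (u / 2))\<close>. Its deficit from the
  full mass \<open>2 pi\<close> is \<open>4 arctan (1 / (K tan (u / 2)))\<close>, and
  \<open>K tan (u / 2) \<ge> u / (2 (1 - \<rho>))\<close>.\<close>

lemma poisson_kernel_mass:
  assumes \<rho>: "0 \<le> \<rho>" "\<rho> < 1" and u: "0 < u" "u < pi"
  shows "2 * pi - 8 * (1 - \<rho>) / u \<le>
    (\<integral>\<alpha>. indicator {t - u..t + u} \<alpha> *\<^sub>R Re (herglotz_kernel (of_real \<rho> * cis \<alpha>) t) \<partial>lborel)"
proof -
  define K where "K = (1 + \<rho>) / (1 - \<rho>)"
  have K0: "0 < K" unfolding K_def using \<rho> by (intro divide_pos_pos) auto
  have pos: "0 < 1 + \<rho>\<^sup>2 - 2 * \<rho> * cos x" for x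
  proof -
    have "0 < (1 - \<rho>)\<^sup>2" using \<rho> by simp
    also have "(1 - \<rho>)\<^sup>2 = 1 + \<rho>\<^sup>2 - 2 * \<rho> * 1" by (simp add: power2_diff)
    also have "\<dots> \<le> 1 + \<rho>\<^sup>2 - 2 * \<rho> * cos x" using \<rho> by (intro diff_left_mono mult_left_mono) auto
    finally show ?thesis .
  qed
  \<comment> \<open>The half-angle antiderivative: the denominator
    \<open>(1 + (K tan)^2) cos^2\<close>, multiplied by \<open>(1 - \<rho>)^2\<close>, is the
    Poisson denominator.\<close>
  define F where "F \<alpha> = 2 * arctan (K * tan ((\<alpha> - t) / 2))" for \<alpha>
  have "(\<integral>\<alpha>. indicator {t - u..t + u} \<alpha> *\<^sub>R Re (herglotz_kernel (of_real \<rho> * cis \<alpha>) t) \<partial>lborel) = F (t + u) - F (t - u)"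
  proof (rule integral_FTC_atLeastAtMost)
    fix \<alpha> assume a: "t - u \<le> \<alpha>" "\<alpha> \<le> t + u"
    let ?x = "(\<alpha> - t) / 2"
    have c: "cos ?x > 0" using a u by (intro cos_gt_zero_pi) auto
    have "(F has_real_derivative 2 * (inverse (1 + (K * tan ?x)\<^sup>2) * (K * (inverse ((cos ?x)\<^sup>2) * (1/2))))) (at \<alpha> within {t - u..t + u})"
      unfolding F_def using c by (auto intro!: derivative_eq_intros)
    moreover have "2 * (inverse (1 + (K * tan ?x)\<^sup>2) * (K * (inverse ((cos ?x)\<^sup>2) * (1/2)))) = Re (herglotz_kernel (of_real \<rho> * cis \<alpha>) t)"
    proof -
      have cc: "cos (\<alpha> - t) = (cos ?x)\<^sup>2 - (sin ?x)\<^sup>2" using cos_double[of ?x] by (simp only: mult_2 field_sum_of_halves)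
      have den: "(1 - \<rho>)\<^sup>2 * (cos ?x)\<^sup>2 + (1 + \<rho>)\<^sup>2 * (sin ?x)\<^sup>2 = 1 + \<rho>\<^sup>2 - 2 * \<rho> * cos (\<alpha> - t)"
        unfolding cc using sin_cos_squared_add[of ?x] by algebra
      have "2 * (inverse (1 + (K * tan ?x)\<^sup>2) * (K * (inverse ((cos ?x)\<^sup>2) * (1/2)))) = K / ((1 + (K * tan ?x)\<^sup>2) * (cos ?x)\<^sup>2)"
        by (simp add: divide_simps)
      also have "(1 + (K * tan ?x)\<^sup>2) * (cos ?x)\<^sup>2 = (cos ?x)\<^sup>2 + K\<^sup>2 * (sin ?x)\<^sup>2"
        unfolding tan_def using c by (simp add: field_simps)
      also have "K / \<dots> = (K * (1 - \<rho>)\<^sup>2) / (((cos ?x)\<^sup>2 + K\<^sup>2 * (sin ?x)\<^sup>2) * (1 - \<rho>)\<^sup>2)"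
        using \<rho> by simp
      also have "K * (1 - \<rho>)\<^sup>2 = 1 - \<rho>\<^sup>2" unfolding K_def using \<rho> by (simp add: power2_eq_square) (simp add: algebra_simps)
      also have "((cos ?x)\<^sup>2 + K\<^sup>2 * (sin ?x)\<^sup>2) * (1 - \<rho>)\<^sup>2 = (1 - \<rho>)\<^sup>2 * (cos ?x)\<^sup>2 + (1 + \<rho>)\<^sup>2 * (sin ?x)\<^sup>2"
        unfolding K_def power_divide using \<rho> by (simp add: distrib_right distrib_left mult.commute)
      finally show ?thesis unfolding den Re_herglotz_kernel_polar[OF \<rho>] .
    qed
    ultimately show "(F has_vector_derivative Re (herglotz_kernel (of_real \<rho> * cis \<alpha>) t)) (at \<alpha> within {t - u..t + u})"
      by (simp add: has_real_derivative_iff_has_vector_derivative)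
  next
    show "continuous_on {t - u..t + u} (\<lambda>\<alpha>. Re (herglotz_kernel (of_real \<rho> * cis \<alpha>) t))"
      unfolding Re_herglotz_kernel_polar[OF \<rho>] using pos by (intro continuous_intros) (auto simp: less_imp_neq[symmetric])
  qed (use u in auto)
  also have "\<dots> = 4 * arctan (K * tan (u / 2))" unfolding F_def by (simp add: arctan_minus)
  also have "\<dots> \<ge> 2 * pi - 8 * (1 - \<rho>) / u"
  proof -
    have "u / 2 \<le> tan (u / 2)" using arctan_le_self[of "tan (u / 2)"] u tan_gt_zero[of "u/2"] arctan_tan[of "u/2"] by simp
    moreover have "1 / (1 - \<rho>) \<le> K" unfolding K_def using \<rho> by (intro divide_right_mono) auto
    ultimately have le: "1 / (1 - \<rho>) * (u / 2) \<le> K * tan (u / 2)"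
      using \<rho> u less_imp_le[OF K0] by (intro mult_mono) auto
    have q: "0 < 1 / (1 - \<rho>) * (u / 2)" using \<rho> u by simp
    have y: "0 < K * tan (u / 2)" using q le by linarith
    have "1 / (K * tan (u / 2)) \<le> 1 / (1 / (1 - \<rho>) * (u / 2))"
      by (rule frac_le[OF zero_le_one order_refl q le])
    then have "1 / (K * tan (u / 2)) \<le> 2 * (1 - \<rho>) / u" using \<rho> u by (simp add: mult.commute)
    moreover have "arctan (1 / (K * tan (u / 2))) \<le> 1 / (K * tan (u / 2))" using y by (intro arctan_le_self) simp
    moreover have "arctan (1 / (K * tan (u / 2))) = pi / 2 - arctan (K * tan (u / 2))"
      using arctan_inverse[OF y] by (simp only: inverse_eq_divide)
    moreover have "8 * (1 - \<rho>) / u = 4 * (2 * (1 - \<rho>) / u)" by simp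
    ultimately show ?thesis by linarith
  qed
  finally show ?thesis .
qed

text \<open>A continuous substitute for the indicator of \<open>{a..b}\<close>, as admissible test
  functions are continuous. The slopes have length one, so \<open>trapezoid (s + 1) (t - 1)\<close>
  lies below the indicator of \<open>{s..t}\<close>. The case \<open>b < a\<close> is meaningful and
  occurs for windows shorter than 2.\<close>

definition trapezoid :: "real \<Rightarrow> real \<Rightarrow> real \<Rightarrow> real" where
  "trapezoid a b x = max 0 (min 1 (min (x - a + 1) (b + 1 - x)))"

lemma trapezoid_bounds: "0 \<le> trapezoid a b x" "trapezoid a b x \<le> 1"
  unfolding trapezoid_def by auto

lemma trapezoid_eq_1: "x \<in> {a..b} \<Longrightarrow> trapezoid a b x = 1"
  unfolding trapezoid_def by auto

lemma trapezoid_eq_0: "x \<notin> {a - 1<..<b + 1} \<Longrightarrow> trapezoid a b x = 0"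
  unfolding trapezoid_def by auto

lemma continuous_on_trapezoid: "continuous_on X (trapezoid a b)"
  unfolding trapezoid_def by (intro continuous_intros)

lemma measurable_trapezoid [measurable]: "trapezoid a b \<in> borel_measurable borel"
  by (intro borel_measurable_continuous_onI continuous_on_trapezoid)

text \<open>The errors in \<open>linear_statistic_deviation\<close> add up to
  \<open>(p^2 (16 + 6 B) + 2) / (2 pi)\<close> with \<open>B = herglotz_bound \<beta>\<close>; as
  \<open>p \<ge> 1\<close>, the 2 is absorbed into 18.\<close>

definition count_bound :: "real \<Rightarrow> real" where
  "count_bound \<beta> = (18 + 6 * herglotz_bound \<beta>) / (2 * pi)"

lemma herglotz_bound_pos: "0 < \<beta> \<Longrightarrow> 0 < herglotz_bound \<beta>"
  unfolding herglotz_bound_def Let_def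
  by (intro divide_pos_pos add_nonneg_pos add_nonneg_nonneg mult_nonneg_nonneg divide_nonneg_nonneg) auto

context circular_beta
begin

lemma integrable_linear_statistic:
  assumes [measurable]: "g \<in> borel_measurable borel" and b: "\<And>x. \<bar>g x\<bar> \<le> B"
  shows "integrable P (\<lambda>\<theta>. \<Sum>j<n. g (real n * \<theta> j) :: real)"
proof (rule integrable_bounded[where B = "\<Sum>j<n. B"])
  fix \<theta> show "norm (\<Sum>j<n. g (real n * \<theta> j)) \<le> (\<Sum>j<n. B)"
    unfolding real_norm_def by (intro order_trans[OF sum_abs] sum_mono b)
qed measurable

lemma expectation_linear_statistic_le:
  assumes g: "continuous_on UNIV g" and g_le: "\<And>x. g x \<le> B * indicator {a..b} x" and B: "0 \<le> B" and ab: "a \<le> b"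
  shows "(\<integral>\<theta>. (\<Sum>j<n. g (real n * \<theta> j)) \<partial>P) \<le> B * (b - a) / (2 * pi)"
proof -
  let ?u = "a / n" and ?v = "b / n"
  let ?g = "\<lambda>x. if x \<in> {?u..?v} then B else 0 :: real"
  have uv: "?u \<le> ?v" using ab by (intro divide_right_mono) auto
  have G: "(?g has_integral (B * (b - a) / n)) UNIV"
    unfolding has_integral_restrict_UNIV using has_integral_const_real[of B ?u ?v] uv by (simp add: algebra_simps diff_divide_distrib)
  have c: "continuous_on X (\<lambda>x. g (real n * x))" for X
    by (rule continuous_on_compose2[OF g]) (auto intro: continuous_intros)
  have "integral {-pi..pi} (\<lambda>x. g (real n * x)) \<le> integral {-pi..pi} ?g"
  proof (rule integral_le)
    show "(\<lambda>x. g (real n * x)) integrable_on {-pi..pi}" by (intro integrable_continuous_interval c)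
    show "?g integrable_on {-pi..pi}" using G by (meson has_integral_integrable integrable_on_subinterval subset_UNIV)
    fix x assume "x \<in> {-pi..pi}"
    show "g (real n * x) \<le> ?g x"
      using g_le[of "real n * x"] n_pos by (cases "real n * x \<in> {a..b}") (auto simp: field_simps)
  qed
  also have "\<dots> \<le> integral UNIV ?g"
    using G B by (intro integral_subset_le) (auto intro: integrable_on_subinterval)
  also have "\<dots> = B * (b - a) / n" using G by (simp add: integral_unique)
  finally have *: "integral {-pi..pi} (\<lambda>x. g (real n * x)) \<le> B * (b - a) / n" .
  show ?thesis
    unfolding intensity[OF c] using mult_left_mono[OF *, of "n / (2 * pi)"] n_pos by simp
qed

lemma expectation_trapezoid_le:
  assumes "a \<le> b + 2"
  shows "(\<integral>\<theta>. (\<Sum>j<n. trapezoid a b (real n * \<theta> j)) \<partial>P) \<le> (b - a + 2) / (2 * pi)"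
proof -
  have "trapezoid a b x \<le> 1 * indicator {a - 1..b + 1} x" for x
    using trapezoid_bounds[of a b x] trapezoid_eq_0[of x a b] by (cases "x \<in> {a - 1..b + 1}") auto
  from expectation_linear_statistic_le[OF continuous_on_trapezoid this] show ?thesis
    using assms by (simp add: algebra_simps)
qed

lemma expectation_trapezoid_ge:
  assumes "- (pi * n) \<le> a" "b \<le> pi * n"
  shows "(b - a) / (2 * pi) \<le> (\<integral>\<theta>. (\<Sum>j<n. trapezoid a b (real n * \<theta> j)) \<partial>P)"
proof (cases "a \<le> b")
  case True
  let ?u = "a / n" and ?v = "b / n"
  have c: "continuous_on X (\<lambda>x. trapezoid a b (real n * x))" for X
    by (rule continuous_on_compose2[OF continuous_on_trapezoid[of UNIV]]) (auto intro: continuous_intros)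
  have uv: "?u \<le> ?v" using True by (intro divide_right_mono) auto
  have "(b - a) / n = integral {?u..?v} (\<lambda>x. 1 :: real)"
    using uv by (simp add: diff_divide_distrib)
  also have "\<dots> = integral {?u..?v} (\<lambda>x. trapezoid a b (real n * x))"
    using n_pos by (intro integral_cong trapezoid_eq_1[symmetric]) (auto simp: field_simps)
  also have "\<dots> \<le> integral {-pi..pi} (\<lambda>x. trapezoid a b (real n * x))"
    using assms n_pos by (intro integral_subset_le integrable_continuous_interval c) (auto simp: field_simps trapezoid_bounds)
  finally have *: "(b - a) / n \<le> integral {-pi..pi} (\<lambda>x. trapezoid a b (real n * x))" .
  show ?thesis
    unfolding intensity[OF c] using mult_left_mono[OF *, of "n / (2 * pi)"] n_pos by simp
next
  case False
  then have "(b - a) / (2 * pi) \<le> 0" by (intro divide_nonpos_pos) auto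
  also have "0 \<le> (\<integral>\<theta>. (\<Sum>j<n. trapezoid a b (real n * \<theta> j)) \<partial>P)"
    by (intro Bochner_Integration.integral_nonneg sum_nonneg trapezoid_bounds)
  finally show ?thesis .
qed

text \<open>With \<open>U\<close> the average of \<open>Re S\<close> over a slightly longer arc at distance \<open>p / n\<close> from the circle,
  the count \<open>N\<close> satisfies \<open>N \<le> U + (2 / p) N\<close>, and the means of both sides agree up to \<open>O(p\<^sup>2)\<close>. A one-sided
  comparison therefore suffices for the two-sided bound.\<close>
theorem linear_statistic_deviation:
  fixes g :: "real \<Rightarrow> real"
  assumes g [measurable]: "g \<in> borel_measurable borel"
    and g_le: "\<And>x. g x \<le> indicator {s..t} x" and g_ge: "\<And>x. trapezoid (s + 1) (t - 1) x \<le> g x"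
    and st: "t - s = p ^ 3" "- (pi * n) \<le> s" "t \<le> pi * n"
    and p: "1 \<le> p" "p \<le> n" "p\<^sup>2 < pi * n"
  shows "(\<integral>\<theta>. \<bar>(\<Sum>j<n. g (real n * \<theta> j)) - p ^ 3 / (2 * pi)\<bar> \<partial>P) \<le> count_bound \<beta> * p\<^sup>2"
proof -
  define B where "B = herglotz_bound \<beta>"
  have B0: "0 < B" unfolding B_def by (rule herglotz_bound_pos[OF beta])
  \<comment> \<open>This makes \<open>d = 1 / (n (1 - \<rho>))\<close> equal to
    \<open>1 / p\<close>, so the mean of \<open>|S - 1|\<close> is at most
    \<open>B / p\<close>.\<close>
  define \<rho> where "\<rho> = 1 - p / n"
  have \<rho>: "0 \<le> \<rho>" "\<rho> < 1" unfolding \<rho>_def using p n_pos by auto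
  have w: "cmod (of_real \<rho> * cis \<alpha>) < 1" for \<alpha> using \<rho> by (simp add: norm_mult)
  let ?S = "\<lambda>\<alpha> \<theta>. mean_herglotz n (of_real \<rho> * cis \<alpha>) \<theta>"
  define N where "N \<theta> = (\<Sum>j<n. g (real n * \<theta> j))" for \<theta>
  have g0: "0 \<le> g x" for x using trapezoid_bounds(1) g_ge by (rule order_trans)
  have g1: "\<bar>g x\<bar> \<le> 1" for x using g0[of x] order_trans[OF g_le indicator_le_1, of x] by simp
  have iN: "integrable P N" unfolding N_def by (rule integrable_linear_statistic[OF g g1])
  have N0: "0 \<le> N \<theta>" for \<theta> unfolding N_def by (intro sum_nonneg g0)
  have p3: "1 \<le> p ^ 3" "p\<^sup>2 \<le> p ^ 3" "p \<le> p\<^sup>2" "1 \<le> p\<^sup>2"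
    using p(1) by (auto intro: one_le_power power_increasing) (simp add: power2_eq_square)
  \<comment> \<open>On the rescaled axis the Poisson kernel has width \<open>p\<close>. A margin of
    \<open>p\<close> such widths leaves at most the fraction \<open>2 / p\<close> of the mass of a
    point of the window outside, and enlarges the mean by \<open>O(p^2)\<close> only.\<close>
  define a b where "a = (s - p\<^sup>2) / n" and "b = (t + p\<^sup>2) / n"
  have ab: "b - a = (p ^ 3 + 2 * p\<^sup>2) / n" unfolding a_def b_def diff_divide_distrib[symmetric] st(1)[symmetric] by simp
  have ab': "a \<le> b" using ab p3 by (smt (verit, best) divide_nonneg_nonneg of_nat_0_le_iff)
  define U where "U \<theta> = n / (2 * pi) * (\<integral>\<alpha>. indicator {a..b} \<alpha> *\<^sub>R Re (?S \<alpha> \<theta>) \<partial>lborel)" for \<theta>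
  have cH: "continuous_on X (\<lambda>\<alpha>. herglotz_kernel (of_real \<rho> * cis \<alpha>) x)" for X x
    unfolding herglotz_kernel_def using cis_neq_interior[OF w] by (intro continuous_intros) auto
  have cS: "continuous_on X (\<lambda>\<alpha>. ?S \<alpha> \<theta>)" for X \<theta>
    unfolding mean_herglotz_def using n_pos by (intro continuous_intros cH) auto
  have iH: "integrable lborel (\<lambda>\<alpha>. indicator {c..d} \<alpha> *\<^sub>R Re (herglotz_kernel (of_real \<rho> * cis \<alpha>) x))" for c d x
    using borel_integrable_atLeastAtMost'[of c d "\<lambda>\<alpha>. Re (herglotz_kernel (of_real \<rho> * cis \<alpha>) x)"]
    unfolding set_integrable_def by (simp add: continuous_on_Re cH)
  have NU: "N \<theta> \<le> U \<theta> + 2 / p * N \<theta>" for \<theta>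
  proof -
    have one: "(1 - 2 / p) * g (real n * x) \<le> 1 / (2 * pi) * (\<integral>\<alpha>. indicator {a..b} \<alpha> *\<^sub>R Re (herglotz_kernel (of_real \<rho> * cis \<alpha>) x) \<partial>lborel)" (is "_ \<le> 1 / (2 * pi) * ?I") for x
    proof (cases "real n * x \<in> {s..t}")
      case False
      then have "g (real n * x) = 0" using g_le[of "real n * x"] g0[of "real n * x"] by simp
      moreover have "0 \<le> ?I"
        by (intro integral_nonneg_AE AE_I2) (simp add: less_imp_le[OF Re_herglotz_kernel_pos[OF w]])
      ultimately show ?thesis by simp
    next
      case True
      define u where "u = p\<^sup>2 / n"
      have u: "0 < u" "u < pi" unfolding u_def using p n_pos by (auto simp: field_simps)
      have sub: "{x - u..x + u} \<subseteq> {a..b}"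
        using True n_pos unfolding a_def b_def u_def by (auto simp: field_simps)
      have "2 * pi - 8 * (1 - \<rho>) / u \<le> (\<integral>\<alpha>. indicator {x - u..x + u} \<alpha> *\<^sub>R Re (herglotz_kernel (of_real \<rho> * cis \<alpha>) x) \<partial>lborel)"
        by (rule poisson_kernel_mass[OF \<rho> u])
      also have "\<dots> \<le> ?I"
        using sub less_imp_le[OF Re_herglotz_kernel_pos[OF w]]
        by (intro integral_mono iH) (auto simp: indicator_def subset_eq)
      finally have "2 * pi - 8 * (1 - \<rho>) / u \<le> ?I" .
      moreover have "8 * (1 - \<rho>) / u = 8 / p"
        unfolding \<rho>_def u_def using p n_pos by (simp add: power2_eq_square)
      ultimately have I: "2 * pi - 8 / p \<le> ?I" by simp
      have "(1 - 2 / p) * (2 * pi) \<le> 2 * pi - 8 / p"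
      proof -
        have "8 / p \<le> 4 * pi / p" using p pi_ge_two by (intro divide_right_mono) auto
        then show ?thesis by (simp add: algebra_simps)
      qed
      with I have I2: "(1 - 2 / p) * (2 * pi) \<le> ?I" by linarith
      show ?thesis
      \<comment> \<open>For \<open>p < 2\<close> the factor is negative and the claim
        trivial.\<close>
      proof (cases "0 \<le> 1 - 2 / p")
        case True
        then have "(1 - 2 / p) * g (real n * x) \<le> (1 - 2 / p) * 1" using g1[of "real n * x"] by (intro mult_left_mono) auto
        also have "\<dots> \<le> 1 / (2 * pi) * ?I" using mult_left_mono[OF I2, of "1 / (2 * pi)"] by simp
        finally show ?thesis .
      next
        case False
        then have "(1 - 2 / p) * g (real n * x) \<le> 0" using g0[of "real n * x"] by (intro mult_nonpos_nonneg) auto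
        also have "0 \<le> 1 / (2 * pi) * ?I"
          by (intro mult_nonneg_nonneg integral_nonneg_AE AE_I2) (simp_all add: less_imp_le[OF Re_herglotz_kernel_pos[OF w]])
        finally show ?thesis .
      qed
    qed
    have "(1 - 2 / p) * N \<theta> \<le> (\<Sum>j<n. 1 / (2 * pi) * (\<integral>\<alpha>. indicator {a..b} \<alpha> *\<^sub>R Re (herglotz_kernel (of_real \<rho> * cis \<alpha>) (\<theta> j)) \<partial>lborel))"
      unfolding N_def sum_distrib_left by (intro sum_mono one)
    also have "\<dots> = 1 / (2 * pi) * (\<integral>\<alpha>. (\<Sum>j<n. indicator {a..b} \<alpha> *\<^sub>R Re (herglotz_kernel (of_real \<rho> * cis \<alpha>) (\<theta> j))) \<partial>lborel)"
      by (subst Bochner_Integration.integral_sum[OF iH]) (simp add: sum_distrib_left)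
    also have "(\<lambda>\<alpha>. (\<Sum>j<n. indicator {a..b} \<alpha> *\<^sub>R Re (herglotz_kernel (of_real \<rho> * cis \<alpha>) (\<theta> j)))) =
       (\<lambda>\<alpha>. real n * (indicator {a..b} \<alpha> *\<^sub>R Re (?S \<alpha> \<theta>)))"
      unfolding Re_mean_herglotz using n_pos by (intro ext) (simp add: sum_distrib_left[symmetric])
    also have "1 / (2 * pi) * (\<integral>\<alpha>. real n * (indicator {a..b} \<alpha> *\<^sub>R Re (?S \<alpha> \<theta>)) \<partial>lborel) = U \<theta>"
      unfolding U_def by (subst integral_mult_right_zero) simp
    finally show ?thesis by (simp add: algebra_simps)
  qed
  have Sm: "(\<lambda>(\<theta>, \<alpha>). Re (?S \<alpha> \<theta>)) \<in> borel_measurable (cbe_space n \<Otimes>\<^sub>M borel)"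
    "(\<lambda>(\<theta>, \<alpha>). cmod (?S \<alpha> \<theta> - 1)) \<in> borel_measurable (cbe_space n \<Otimes>\<^sub>M borel)"
  proof -
    note measurable_cbe_component_compose [measurable (raw)]
    show "(\<lambda>(\<theta>, \<alpha>). Re (?S \<alpha> \<theta>)) \<in> borel_measurable (cbe_space n \<Otimes>\<^sub>M borel)"
      "(\<lambda>(\<theta>, \<alpha>). cmod (?S \<alpha> \<theta> - 1)) \<in> borel_measurable (cbe_space n \<Otimes>\<^sub>M borel)"
      unfolding mean_herglotz_def herglotz_kernel_def by measurable
  qed
  have Sb: "cmod (?S \<alpha> \<theta>) \<le> 2 / (1 - \<rho>)" for \<alpha> \<theta>
    using cmod_mean_herglotz_le[OF w, of n \<alpha> \<theta>] \<rho> by (simp add: norm_mult)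
  have iU: "integrable P U"
    unfolding U_def using Sb by (intro integrable_mult_right expectation_interval_integral_swap(2)[OF Sm(1), where B = "2 / (1 - \<rho>)"])
      (auto intro: order_trans[OF abs_Re_le_cmod])
  \<comment> \<open>The value of \<open>U\<close> if \<open>S\<close> were identically 1; it exceeds
    the centre \<open>p^3 / (2 pi)\<close> by \<open>p^2 / pi\<close>.\<close>
  define m where "m = (p ^ 3 + 2 * p\<^sup>2) / (2 * pi)"
  have S1b: "cmod (?S \<alpha> \<theta> - 1) \<le> 2 / (1 - \<rho>) + 1" for \<alpha> \<theta>
    using Sb by (intro order_trans[OF norm_triangle_ineq4]) auto
  note sw = expectation_interval_integral_swap[OF Sm(2), where B = "2 / (1 - \<rho>) + 1" and a = a and b = b]
  have Um: "\<bar>U \<theta> - m\<bar> \<le> n / (2 * pi) * (\<integral>\<alpha>. indicator {a..b} \<alpha> *\<^sub>R cmod (?S \<alpha> \<theta> - 1) \<partial>lborel)" for \<theta>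
  proof -
    have i1: "integrable lborel (\<lambda>\<alpha>. indicator {a..b} \<alpha> *\<^sub>R Re (?S \<alpha> \<theta>))"
      using borel_integrable_atLeastAtMost'[of a b "\<lambda>\<alpha>. Re (?S \<alpha> \<theta>)"]
      unfolding set_integrable_def by (simp add: continuous_on_Re cS)
    have i2: "integrable lborel (\<lambda>\<alpha>. indicator {a..b} \<alpha> *\<^sub>R cmod (?S \<alpha> \<theta> - 1))"
      using borel_integrable_atLeastAtMost'[of a b "\<lambda>\<alpha>. cmod (?S \<alpha> \<theta> - 1)"]
      unfolding set_integrable_def by (simp add: continuous_on_norm continuous_on_diff cS)
    let ?I = "\<integral>\<alpha>. indicator {a..b} \<alpha> *\<^sub>R Re (?S \<alpha> \<theta>) \<partial>lborel"
    have e: "(\<integral>\<alpha>. indicator {a..b} \<alpha> *\<^sub>R Re (?S \<alpha> \<theta>) - indicat_real {a..b} \<alpha> \<partial>lborel) = ?I - (b - a)"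
      using ab' by (subst Bochner_Integration.integral_diff[OF i1]) auto
    have "m = n / (2 * pi) * (b - a)"
      unfolding m_def using ab n_pos by simp
    then have "U \<theta> - m = n / (2 * pi) * (\<integral>\<alpha>. indicator {a..b} \<alpha> *\<^sub>R Re (?S \<alpha> \<theta>) - indicat_real {a..b} \<alpha> \<partial>lborel)"
      unfolding e U_def by (simp only: right_diff_distrib)
    then have "\<bar>U \<theta> - m\<bar> = n / (2 * pi) * \<bar>\<integral>\<alpha>. indicator {a..b} \<alpha> *\<^sub>R Re (?S \<alpha> \<theta>) - indicat_real {a..b} \<alpha> \<partial>lborel\<bar>"
      by (simp add: abs_mult)
    also have "\<dots> \<le> n / (2 * pi) * (\<integral>\<alpha>. \<bar>indicator {a..b} \<alpha> *\<^sub>R Re (?S \<alpha> \<theta>) - indicat_real {a..b} \<alpha>\<bar> \<partial>lborel)"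
      by (intro mult_left_mono integral_abs_bound) auto
    also have "\<dots> \<le> n / (2 * pi) * (\<integral>\<alpha>. indicator {a..b} \<alpha> *\<^sub>R cmod (?S \<alpha> \<theta> - 1) \<partial>lborel)"
    proof (intro mult_left_mono integral_mono i2)
      fix \<alpha>
      show "\<bar>indicator {a..b} \<alpha> *\<^sub>R Re (?S \<alpha> \<theta>) - indicat_real {a..b} \<alpha>\<bar> \<le> indicator {a..b} \<alpha> *\<^sub>R cmod (?S \<alpha> \<theta> - 1)"
        using abs_Re_le_cmod[of "?S \<alpha> \<theta> - 1"] by (auto simp: indicator_def)
    next
      show "integrable lborel (\<lambda>\<alpha>. \<bar>indicator {a..b} \<alpha> *\<^sub>R Re (?S \<alpha> \<theta>) - indicat_real {a..b} \<alpha>\<bar>)"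
        by (intro integrable_abs Bochner_Integration.integrable_diff i1 integrable_real_indicator) (simp_all add: emeasure_lborel_Icc_eq)
    qed simp
    finally show ?thesis .
  qed
  have EUm: "(\<integral>\<theta>. \<bar>U \<theta> - m\<bar> \<partial>P) \<le> 3 * p\<^sup>2 * B / (2 * pi)"
  proof -
    have "(\<integral>\<theta>. \<bar>U \<theta> - m\<bar> \<partial>P) \<le> (\<integral>\<theta>. n / (2 * pi) * (\<integral>\<alpha>. indicator {a..b} \<alpha> *\<^sub>R cmod (?S \<alpha> \<theta> - 1) \<partial>lborel) \<partial>P)"
      using iU S1b by (intro integral_mono Um integrable_mult_right sw(2)) auto
    also have "\<dots> = n / (2 * pi) * (\<integral>\<alpha>. indicator {a..b} \<alpha> *\<^sub>R (\<integral>\<theta>. cmod (?S \<alpha> \<theta> - 1) \<partial>P) \<partial>lborel)"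
      using S1b by (subst sw(1)[symmetric]) auto
    also have "\<dots> \<le> n / (2 * pi) * (\<integral>\<alpha>. indicator {a..b} \<alpha> *\<^sub>R (B * (1 / p)) \<partial>lborel)"
    proof (intro mult_left_mono integral_mono_AE')
      show "integrable lborel (\<lambda>\<alpha>. indicat_real {a..b} \<alpha> *\<^sub>R (B * (1 / p)))"
        by (intro integrable_scaleR_left integrable_real_indicator) (simp_all add: emeasure_lborel_Icc_eq)
      have "(\<integral>\<theta>. cmod (?S \<alpha> \<theta> - 1) \<partial>P) \<le> B * (1 / p)" for \<alpha>
      proof -
        have "1 / (real n * (1 - cmod (of_real \<rho> * cis \<alpha>))) = 1 / p"
        proof -
          have "cmod (of_real \<rho> * cis \<alpha>) = \<rho>" using \<rho>(1) by (simp add: norm_mult)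
          then show ?thesis unfolding \<rho>_def using n_pos by simp
        qed
        then show ?thesis using mean_herglotz_near_1[OF w, of \<alpha>] p unfolding B_def by simp
      qed
      then show "AE \<alpha> in lborel. indicator {a..b} \<alpha> *\<^sub>R (\<integral>\<theta>. cmod (?S \<alpha> \<theta> - 1) \<partial>P) \<le> indicator {a..b} \<alpha> *\<^sub>R (B * (1 / p))"
        by (intro AE_I2) (auto simp: indicator_def)
      show "AE \<alpha> in lborel. 0 \<le> indicat_real {a..b} \<alpha> *\<^sub>R (B * (1 / p))" using B0 p by (intro AE_I2) simp
    qed auto
    also have "\<dots> = (p ^ 3 + 2 * p\<^sup>2) * B / p / (2 * pi)"
    proof -
      have "(\<integral>\<alpha>. indicator {a..b} \<alpha> *\<^sub>R (B * (1 / p)) \<partial>lborel) = (b - a) * (B / p)" using ab' by simp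
      then show ?thesis unfolding ab using n_pos by simp
    qed
    also have "\<dots> \<le> 3 * p\<^sup>2 * B / (2 * pi)"
    proof (intro divide_right_mono)
      have "(p ^ 3 + 2 * p\<^sup>2) * B / p = (p\<^sup>2 + 2 * p) * B" using p by (simp add: power2_eq_square power3_eq_cube field_simps)
      also have "\<dots> \<le> (3 * p\<^sup>2) * B" using p3 B0 by (intro mult_right_mono) auto
      finally show "(p ^ 3 + 2 * p\<^sup>2) * B / p \<le> 3 * p\<^sup>2 * B" .
    qed simp
    finally show ?thesis .
  qed
  have EN_ge: "(p ^ 3 - 2) / (2 * pi) \<le> (\<integral>\<theta>. N \<theta> \<partial>P)"
  proof -
    have "((t - 1) - (s + 1)) / (2 * pi) \<le> (\<integral>\<theta>. (\<Sum>j<n. trapezoid (s + 1) (t - 1) (real n * \<theta> j)) \<partial>P)"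
      by (rule expectation_trapezoid_ge) (use st in auto)
    also have "\<dots> \<le> (\<integral>\<theta>. N \<theta> \<partial>P)"
      unfolding N_def using iN[unfolded N_def] trapezoid_bounds g1
      by (intro integral_mono integrable_linear_statistic[where B = 1] sum_mono g_ge) auto
    finally show ?thesis using st(1) by (simp add: algebra_simps)
  qed
  have EN_le: "(\<integral>\<theta>. N \<theta> \<partial>P) \<le> 3 * p ^ 3 / (2 * pi)"
  proof -
    have "(\<integral>\<theta>. N \<theta> \<partial>P) \<le> (\<integral>\<theta>. (\<Sum>j<n. trapezoid s t (real n * \<theta> j)) \<partial>P)"
      unfolding N_def
    proof (intro integral_mono integrable_linear_statistic[where B = 1] sum_mono)
      show "g x \<le> trapezoid s t x" for x
        using g_le[of x] trapezoid_eq_1[of x s t] trapezoid_bounds(1)[of s t x] by (cases "x \<in> {s..t}") auto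
    qed (use g1 trapezoid_bounds in auto)
    also have "\<dots> \<le> (t - s + 2) / (2 * pi)"
      by (rule expectation_trapezoid_le) (use st p3 in linarith)
    also have "\<dots> \<le> 3 * p ^ 3 / (2 * pi)" unfolding st(1) using p3 by (intro divide_right_mono) auto
    finally show ?thesis .
  qed
  have "2 / p * (\<integral>\<theta>. N \<theta> \<partial>P) \<le> 2 / p * (3 * p ^ 3 / (2 * pi))"
    using EN_le p by (intro mult_left_mono) auto
  also have "\<dots> = 6 * p\<^sup>2 / (2 * pi)" using p by (simp add: power2_eq_square power3_eq_cube)
  finally have EN2: "2 / p * (\<integral>\<theta>. N \<theta> \<partial>P) \<le> 6 * p\<^sup>2 / (2 * pi)" .
  have EU: "(\<integral>\<theta>. U \<theta> \<partial>P) \<le> m + 3 * p\<^sup>2 * B / (2 * pi)"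
  proof -
    have "(\<integral>\<theta>. U \<theta> \<partial>P) - m = (\<integral>\<theta>. U \<theta> - m \<partial>P)" using iU by (simp add: prob_space)
    also have "\<dots> \<le> (\<integral>\<theta>. \<bar>U \<theta> - m\<bar> \<partial>P)" using iU by (intro integral_mono) auto
    finally show ?thesis using EUm by simp
  qed
  \<comment> \<open>By \<open>NU\<close> the first bracket is nonnegative, so its mean is just a
    combination of the means of \<open>U\<close> and \<open>N\<close>, whose leading terms cancel.
    No lower bound for \<open>N\<close> in terms of \<open>U\<close> is required.\<close>
  have "(\<integral>\<theta>. \<bar>N \<theta> - p ^ 3 / (2 * pi)\<bar> \<partial>P) \<le>
    (\<integral>\<theta>. (U \<theta> + 2 / p * N \<theta> - N \<theta>) + (\<bar>U \<theta> - m\<bar> + (m - p ^ 3 / (2 * pi) + 2 / p * N \<theta>)) \<partial>P)"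
  proof (intro integral_mono)
    fix \<theta>
    have "0 \<le> 2 / p * N \<theta>" using N0 p by simp
    moreover have "0 \<le> m - p ^ 3 / (2 * pi)" unfolding m_def diff_divide_distrib[symmetric] by simp
    ultimately show "\<bar>N \<theta> - p ^ 3 / (2 * pi)\<bar> \<le> (U \<theta> + 2 / p * N \<theta> - N \<theta>) + (\<bar>U \<theta> - m\<bar> + (m - p ^ 3 / (2 * pi) + 2 / p * N \<theta>))"
      using NU[of \<theta>] by linarith
  qed (use iU iN in auto)
  also have "\<dots> = ((\<integral>\<theta>. U \<theta> \<partial>P) + 2 / p * (\<integral>\<theta>. N \<theta> \<partial>P) - (\<integral>\<theta>. N \<theta> \<partial>P)) + ((\<integral>\<theta>. \<bar>U \<theta> - m\<bar> \<partial>P) + (m - p ^ 3 / (2 * pi) + 2 / p * (\<integral>\<theta>. N \<theta> \<partial>P)))"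
    using iU iN by (simp add: prob_space)
  also have "\<dots> \<le> ((m + 3 * p\<^sup>2 * B / (2 * pi)) + 6 * p\<^sup>2 / (2 * pi) - (p ^ 3 - 2) / (2 * pi)) +
      (3 * p\<^sup>2 * B / (2 * pi) + (m - p ^ 3 / (2 * pi) + 6 * p\<^sup>2 / (2 * pi)))"
    by (intro add_mono diff_mono EU EN2 EN_ge EUm order_refl)
  also have "\<dots> = (p\<^sup>2 * (16 + 6 * B) + 2) / (2 * pi)"
    unfolding m_def by (simp add: field_simps)
  also have "\<dots> \<le> count_bound \<beta> * p\<^sup>2"
    unfolding count_bound_def B_def[symmetric] times_divide_eq_left using p3 by (intro divide_right_mono) (auto simp: algebra_simps)
  finally show ?thesis unfolding N_def .
qed

end

section \<open>Tails of odd statistics\<close>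

text \<open>The two sides are subtracted so that their common mean \<open>s / (2 pi)\<close>
  cancels; the origin counts on neither side. The index set is arbitrary so that both the ensemble
  and a random set of reals fit.\<close>

definition signed_count :: "'i set \<Rightarrow> ('i \<Rightarrow> real) \<Rightarrow> real \<Rightarrow> real" where
  "signed_count J x s = (\<Sum>j\<in>J. of_bool (0 < x j \<and> x j \<le> s) - of_bool (0 < - x j \<and> - x j \<le> s))"

text \<open>As \<open>k R = 0\<close>, each \<open>K a\<close> is minus the integral of
  \<open>k'\<close> from \<open>a\<close> to \<open>R\<close>. Exchanging sum and integral replaces
  the points by their signed counts.\<close>

lemma abel_tail_bound:
  fixes x :: "'i \<Rightarrow> real" and k k' :: "real \<Rightarrow> real"
  assumes rR: "0 < r" "r \<le> R"
    and k: "\<And>s. s \<in> {r..R} \<Longrightarrow> (k has_real_derivative k' s) (at s within {r..R})"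
    and k': "continuous_on {r..R} k'" and kR: "k R = 0"
  defines "K \<equiv> \<lambda>a. if r < a \<and> a \<le> R then k a else 0"
  shows "\<bar>\<Sum>j\<in>J. K (x j) - K (- x j)\<bar> \<le> \<bar>k r\<bar> * \<bar>signed_count J x r\<bar> +
     (\<integral>s. indicator {r..R} s *\<^sub>R (\<bar>k' s\<bar> * \<bar>signed_count J x s\<bar>) \<partial>lborel)"
proof -
  define D where "D = signed_count J x"
  define g where "g s = indicator {r..R} s *\<^sub>R k' s" for s
  have ig: "integrable lborel g"
    unfolding g_def using borel_integrable_atLeastAtMost'[OF k'] unfolding set_integrable_def .
  then have [measurable]: "g \<in> borel_measurable borel" by simp
  have FTC: "(\<integral>s. indicator {a..R} s *\<^sub>R k' s \<partial>lborel) = - k a" if "r \<le> a" "a \<le> R" for a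
  proof -
    have "(\<integral>s. indicator {a..R} s *\<^sub>R k' s \<partial>lborel) = k R - k a"
    proof (rule integral_FTC_atLeastAtMost)
      fix s assume "a \<le> s" "s \<le> R"
      then have "(k has_real_derivative k' s) (at s within {a..R})"
        using k[of s] that by (auto intro: DERIV_subset)
      then show "(k has_vector_derivative k' s) (at s within {a..R})"
        by (simp add: has_real_derivative_iff_has_vector_derivative)
    qed (use that k' in \<open>auto intro: continuous_on_subset\<close>)
    then show ?thesis using kR by simp
  qed
  have one: "(\<integral>s. g s * of_bool (r < a \<and> a \<le> s) \<partial>lborel) = - K a" for a
  proof (cases "r < a \<and> a \<le> R")
    case True
    then have "g s * of_bool (r < a \<and> a \<le> s) = indicator {a..R} s *\<^sub>R k' s" for s
      unfolding g_def by (auto simp: indicator_def)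
    then show ?thesis using FTC[of a] True unfolding K_def by simp
  next
    case False
    then have z: "g s * of_bool (r < a \<and> a \<le> s) = 0" for s
      unfolding g_def by (auto simp: indicator_def)
    show ?thesis using False unfolding K_def z by auto
  qed
  have ib: "integrable lborel (\<lambda>s. g s * of_bool (r < a \<and> a \<le> s))" for a
    by (rule Bochner_Integration.integrable_bound[OF ig]) auto
  have ic: "integrable lborel (\<lambda>s. g s * of_bool (0 < a \<and> a \<le> s))" for a
    by (rule Bochner_Integration.integrable_bound[OF ig]) auto
  have id: "integrable lborel (\<lambda>s. g s * D s)"
    unfolding D_def signed_count_def sum_distrib_left right_diff_distrib
    by (intro Bochner_Integration.integrable_sum Bochner_Integration.integrable_diff ic)
  have "(\<Sum>j\<in>J. K (x j) - K (- x j)) = (\<Sum>j\<in>J. (\<integral>s. g s * of_bool (r < - x j \<and> - x j \<le> s) - g s * of_bool (r < x j \<and> x j \<le> s) \<partial>lborel))"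
    by (simp add: ib one)
  also have "\<dots> = (\<integral>s. (\<Sum>j\<in>J. g s * of_bool (r < - x j \<and> - x j \<le> s) - g s * of_bool (r < x j \<and> x j \<le> s)) \<partial>lborel)"
    by (rule Bochner_Integration.integral_sum[symmetric]) (intro Bochner_Integration.integrable_diff ib)
  \<comment> \<open>For \<open>s \<ge> r\<close> the indicator of \<open>r < a \<le> s\<close> is
    that of \<open>0 < a \<le> s\<close> minus that of \<open>0 < a \<le> r\<close>; this produces
    the boundary term \<open>D r\<close>.\<close>
  also have "\<dots> = (\<integral>s. D r * g s - g s * D s \<partial>lborel)"
  proof (rule Bochner_Integration.integral_cong[OF refl])
    fix s
    have "g s * of_bool (r < - x j \<and> - x j \<le> s) - g s * of_bool (r < x j \<and> x j \<le> s) =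
       g s * ((of_bool (0 < x j \<and> x j \<le> r) - of_bool (0 < - x j \<and> - x j \<le> r)) -
              (of_bool (0 < x j \<and> x j \<le> s) - of_bool (0 < - x j \<and> - x j \<le> s)))" for j
      unfolding g_def using rR by (auto simp: indicator_def)
    then have "(\<Sum>j\<in>J. g s * of_bool (r < - x j \<and> - x j \<le> s) - g s * of_bool (r < x j \<and> x j \<le> s)) =
       g s * ((\<Sum>j\<in>J. of_bool (0 < x j \<and> x j \<le> r) - of_bool (0 < - x j \<and> - x j \<le> r)) -
              (\<Sum>j\<in>J. of_bool (0 < x j \<and> x j \<le> s) - of_bool (0 < - x j \<and> - x j \<le> s)))"
      by (simp only: sum_distrib_left[symmetric] sum_subtractf)
    then show "(\<Sum>j\<in>J. g s * of_bool (r < - x j \<and> - x j \<le> s) - g s * of_bool (r < x j \<and> x j \<le> s)) = D r * g s - g s * D s"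
      unfolding D_def signed_count_def by (simp only: right_diff_distrib mult.commute)
  qed
  also have "\<dots> = D r * (- k r) - (\<integral>s. g s * D s \<partial>lborel)"
    using ig id FTC[of r] rR unfolding g_def[symmetric] by simp
  finally have "\<bar>\<Sum>j\<in>J. K (x j) - K (- x j)\<bar> \<le> \<bar>D r * (- k r)\<bar> + \<bar>\<integral>s. g s * D s \<partial>lborel\<bar>"
    by linarith
  also have "\<dots> \<le> \<bar>k r\<bar> * \<bar>D r\<bar> + (\<integral>s. \<bar>g s * D s\<bar> \<partial>lborel)"
    by (intro add_mono integral_abs_bound) (simp add: abs_mult)
  also have "(\<lambda>s. \<bar>g s * D s\<bar>) = (\<lambda>s. indicator {r..R} s *\<^sub>R (\<bar>k' s\<bar> * \<bar>D s\<bar>))"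
    unfolding g_def by (auto simp: fun_eq_iff abs_mult indicator_def)
  finally show ?thesis unfolding D_def .
qed

lemma power_powr:
  fixes x a :: real
  assumes "0 < x"
  shows "(x powr a) ^ m = x powr (a * real m)" "(x ^ m) powr a = x powr (real m * a)"
proof -
  have "(x powr a) ^ m = (x powr a) powr (real m)"
    using assms by (intro powr_realpow[symmetric]) simp
  then show "(x powr a) ^ m = x powr (a * real m)" by (simp only: powr_powr)
  have "(x ^ m) powr a = (x powr (real m)) powr a"
    using assms by (simp only: powr_realpow)
  then show "(x ^ m) powr a = x powr (real m * a)" by (simp only: powr_powr)
qed

text \<open>The exponent is \<open>2/3 - 2\<close>: the discrepancy \<open>s^(2/3)\<close> against
  the derivative \<open>s^(-2)\<close> of the kernel.\<close>

lemma integral_powr_tail: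
  fixes q R :: real
  assumes "1 \<le> q" "q ^ 3 \<le> R"
  shows "(\<integral>s. indicator {q ^ 3..R} s *\<^sub>R (s powr (- (4 / 3))) \<partial>lborel) \<le> 3 / q"
proof -
  have q3: "1 \<le> q ^ 3" using assms by simp
  have "(\<integral>s. indicator {q ^ 3..R} s *\<^sub>R (s powr (- (4 / 3))) \<partial>lborel) = - 3 * R powr (- (1 / 3)) - (- 3 * (q ^ 3) powr (- (1 / 3)))"
  proof (rule integral_FTC_atLeastAtMost[OF assms(2)])
    fix s assume "q ^ 3 \<le> s"
    then have "0 < s" using q3 by linarith
    then have "((\<lambda>s. - 3 * s powr (- (1 / 3))) has_real_derivative s powr (- (4 / 3))) (at s within {q ^ 3..R})"
      by (auto intro!: derivative_eq_intros has_field_derivative_at_within[OF has_real_derivative_powr])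
    then show "((\<lambda>s. - 3 * s powr (- (1 / 3))) has_vector_derivative s powr (- (4 / 3))) (at s within {q ^ 3..R})"
      by (simp only: has_real_derivative_iff_has_vector_derivative)
  next
    show "continuous_on {q ^ 3..R} (\<lambda>s. s powr (- (4 / 3)))"
      using q3 by (intro continuous_intros) auto
  qed
  also have "\<dots> \<le> 3 * (q ^ 3) powr (- (1 / 3))" by simp
  also have "(q ^ 3) powr (- (1 / 3)) = 1 / q"
    using power_powr(2)[of q 3 "- (1 / 3)"] assms by (simp add: powr_neg_one)
  finally show ?thesis by simp
qed

section \<open>The cotangent compared with the reciprocal\<close>

lemma cmod_cis_diff_le: "cmod (cis a - cis b) \<le> \<bar>a - b\<bar>"
proof -
  have "(cmod (cis a - cis b))\<^sup>2 = 2 - 2 * cos (2 * ((a - b) / 2))"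
  proof -
    have "2 * ((a - b) / 2) = a - b" by simp
    then show ?thesis by (simp only: cmod_cis_diff_sq)
  qed
  also have "\<dots> = (2 * sin ((a - b) / 2))\<^sup>2"
    unfolding cos_double_sin by (simp add: power_mult_distrib)
  also have "\<dots> = (2 * \<bar>sin ((a - b) / 2)\<bar>)\<^sup>2"
    by (simp add: power_mult_distrib)
  also have "\<dots> \<le> (2 * \<bar>(a - b) / 2\<bar>)\<^sup>2"
    by (intro power_mono mult_left_mono abs_sin_x_le_abs_x) auto
  also have "\<dots> = \<bar>a - b\<bar>\<^sup>2" by simp
  finally show ?thesis by (rule power2_le_imp_le) simp
qed

text \<open>The first two bounds allow \<open>1 / y\<close> to replace the cotangent near the
  origin; the last controls its derivative in the tail. The 5 comes from
  \<open>1 / sin^2 = 1 + cot^2\<close> with \<open>cot y \<le> 1 / y\<close> and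
  \<open>1 \<le> 4 / y^2\<close>, valid as \<open>y \<le> 2\<close>.\<close>

lemma cot_bounds:
  assumes y: "0 < y" "y \<le> pi / 2"
  shows "cot y \<le> 1 / y" "1 / y - y / 2 \<le> cot y" "0 \<le> cot y" "1 / (sin y)\<^sup>2 \<le> 5 / y\<^sup>2"
proof -
  have s: "0 < sin y" using y by (intro sin_gt_zero) auto
  have c: "0 \<le> cos y" using y by (intro cos_ge_zero) auto
  show c0: "0 \<le> cot y" unfolding cot_def using s c by simp
  show c1: "cot y \<le> 1 / y"
  proof (cases "y = pi / 2")
    case False
    then have "y < pi / 2" using y by simp
    then have "y \<le> tan y" using arctan_le_self[of "tan y"] tan_gt_zero[of y] arctan_tan[of y] y by simp
    then have "1 / tan y \<le> 1 / y" using y by (intro frac_le) auto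
    then show ?thesis by (simp add: cot_def tan_def)
  next
    case True
    show ?thesis unfolding True by (simp add: cot_def)
  qed
  show "1 / y - y / 2 \<le> cot y"
  proof (cases "0 \<le> 1 - y\<^sup>2 / 2")
    case True
    have "1 - y\<^sup>2 / 2 \<le> cos y"
    proof -
      have "(sin (y / 2))\<^sup>2 \<le> (y / 2)\<^sup>2"
        using abs_sin_x_le_abs_x[of "y / 2"] by (rule abs_le_square_iff[THEN iffD1])
      then show ?thesis using cos_double_sin[of "y / 2"] by (simp add: power_divide)
    qed
    then have "(1 - y\<^sup>2 / 2) / y \<le> cos y / sin y"
      using y s True sin_x_le_x[of y] by (intro frac_le) auto
    moreover have "(1 - y\<^sup>2 / 2) / y = 1 / y - y / 2" using y by (simp add: field_simps power2_eq_square)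
    ultimately show ?thesis unfolding cot_def by simp
  next
    case False
    have "1 / y - y / 2 = (1 - y\<^sup>2 / 2) / y" using y by (simp add: field_simps power2_eq_square)
    also have "\<dots> \<le> 0" using False y by (intro divide_nonpos_pos) auto
    finally show ?thesis using c0 by linarith
  qed
  have "1 / (sin y)\<^sup>2 = 1 + (cot y)\<^sup>2"
    unfolding cot_def power_divide using s sin_cos_squared_add[of y] by (simp add: field_simps)
  moreover have "(cot y)\<^sup>2 \<le> (1 / y)\<^sup>2" by (intro power_mono c0 c1)
  moreover have "1 \<le> 4 / y\<^sup>2"
  proof -
    have "y \<le> 2" using y pi_less_4 by linarith
    then have "y\<^sup>2 \<le> 2\<^sup>2" using y by (intro power_mono) auto
    then show ?thesis using y by simp
  qed
  moreover have "5 / y\<^sup>2 = 4 / y\<^sup>2 + (1 / y)\<^sup>2"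
    unfolding power_divide by (simp flip: add_divide_distrib)
  ultimately show "1 / (sin y)\<^sup>2 \<le> 5 / y\<^sup>2" by linarith
qed

context circular_beta
begin

lemma measurable_signed_count [measurable]:
  "(\<lambda>\<theta>. signed_count {..<n} (\<lambda>j. real n * \<theta> j) s) \<in> borel_measurable (cbe_space n)"
  unfolding signed_count_def by measurable

lemma abs_signed_count_le: "\<bar>signed_count {..<n} x s\<bar> \<le> n"
proof -
  have "\<bar>signed_count {..<n} x s\<bar> \<le> (\<Sum>j<n. 1)"
    unfolding signed_count_def by (intro order_trans[OF sum_abs] sum_mono) auto
  then show ?thesis by simp
qed

text \<open>The windows to the right and left of 0 have the same length \<open>s = p^3\<close>,
  hence the same centre in \<open>linear_statistic_deviation\<close>, which cancels in the
  difference.\<close>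

lemma expectation_signed_count:
  assumes n2: "2 \<le> n" and s: "1 \<le> s" "s \<le> pi * n"
  shows "(\<integral>\<theta>. \<bar>signed_count {..<n} (\<lambda>j. real n * \<theta> j) s\<bar> \<partial>P) \<le> 2 * count_bound \<beta> * s powr (2 / 3)"
proof -
  define p where "p = s powr (1 / 3)"
  have p1: "1 \<le> p" unfolding p_def using s by (intro ge_one_powr_ge_zero) auto
  have p3: "p ^ 3 = s" unfolding p_def using s power_powr(1)[of s "1 / 3" 3] by simp
  have p2: "p\<^sup>2 = s powr (2 / 3)" unfolding p_def using s power_powr(1)[of s "1 / 3" 2] by simp
  \<comment> \<open>\<open>p^3 = s \<le> pi n \<le> 4 n\<close>, and \<open>4 n \<le> n^3\<close>
    from \<open>n = 2\<close> on.\<close>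
  have pn: "p \<le> n"
  proof (rule ccontr)
    assume "\<not> p \<le> n"
    then have "real n ^ 3 < p ^ 3" by (intro power_strict_mono) auto
    also have "p ^ 3 \<le> pi * n" using p3 s by simp
    also have "\<dots> \<le> 4 * real n" using pi_less_4 by (intro mult_right_mono) auto
    finally have "real n * n * n < 4 * n" by (simp add: power3_eq_cube)
    moreover have "4 * real n \<le> real n * n * n" using n2 by (intro mult_right_mono) (auto intro: mult_mono[of 2 "real n" 2 "real n", simplified])
    ultimately show False by linarith
  qed
  have p2n: "p\<^sup>2 < pi * n"
  proof (cases "p = 1")
    case True
    have "1 < pi * n" using n2 pi_ge_two mult_mono[of 2 pi 2 "real n"] by simp
    then show ?thesis using True by simp
  next
    case False
    then have "p\<^sup>2 < p ^ 3" using p1 by (intro power_strict_increasing) auto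
    then show ?thesis using p3 s by simp
  qed
  have "(\<integral>\<theta>. \<bar>(\<Sum>j<n. indicat_real {0<..s} (real n * \<theta> j)) - p ^ 3 / (2 * pi)\<bar> \<partial>P) \<le> count_bound \<beta> * p\<^sup>2"
  proof (rule linear_statistic_deviation[where s = 0 and t = s])
    show "trapezoid (0 + 1) (s - 1) x \<le> indicat_real {0<..s} x" for x
      using trapezoid_bounds[of 1 "s - 1" x] trapezoid_eq_0[of x 1 "s - 1"] by (cases "x \<in> {0<..<s}") (auto simp: indicator_def)
    show "indicat_real {0<..s} x \<le> indicator {0..s} x" for x by (auto simp: indicator_def)
  qed (use p1 p3 pn p2n s in auto)
  moreover have "(\<integral>\<theta>. \<bar>(\<Sum>j<n. indicat_real {-s..<0} (real n * \<theta> j)) - p ^ 3 / (2 * pi)\<bar> \<partial>P) \<le> count_bound \<beta> * p\<^sup>2"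
  proof (rule linear_statistic_deviation[where s = "-s" and t = 0])
    show "trapezoid (- s + 1) (0 - 1) x \<le> indicat_real {-s..<0} x" for x
      using trapezoid_bounds[of "-s + 1" "-1" x] trapezoid_eq_0[of x "-s + 1" "-1"] by (cases "x \<in> {-s<..<0}") (auto simp: indicator_def)
    show "indicat_real {-s..<0} x \<le> indicator {-s..0} x" for x by (auto simp: indicator_def)
  qed (use p1 p3 pn p2n s in auto)
  moreover have "(\<integral>\<theta>. \<bar>signed_count {..<n} (\<lambda>j. real n * \<theta> j) s\<bar> \<partial>P) \<le>
     (\<integral>\<theta>. \<bar>(\<Sum>j<n. indicat_real {0<..s} (real n * \<theta> j)) - p ^ 3 / (2 * pi)\<bar> + \<bar>(\<Sum>j<n. indicat_real {-s..<0} (real n * \<theta> j)) - p ^ 3 / (2 * pi)\<bar> \<partial>P)"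
  proof (intro integral_mono)
    fix \<theta>
    have "signed_count {..<n} (\<lambda>j. real n * \<theta> j) s = (\<Sum>j<n. indicat_real {0<..s} (real n * \<theta> j)) - (\<Sum>j<n. indicat_real {-s..<0} (real n * \<theta> j))"
      unfolding signed_count_def sum_subtractf[symmetric] by (intro sum.cong) (auto simp: indicator_def)
    then show "\<bar>signed_count {..<n} (\<lambda>j. real n * \<theta> j) s\<bar> \<le> \<bar>(\<Sum>j<n. indicat_real {0<..s} (real n * \<theta> j)) - p ^ 3 / (2 * pi)\<bar> + \<bar>(\<Sum>j<n. indicat_real {-s..<0} (real n * \<theta> j)) - p ^ 3 / (2 * pi)\<bar>"
      by linarith
  next
    show "integrable P (\<lambda>\<theta>. \<bar>signed_count {..<n} (\<lambda>j. real n * \<theta> j) s\<bar>)"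
      by (rule integrable_bounded[where B = n]) (use abs_signed_count_le in auto)
  qed (intro Bochner_Integration.integrable_add integrable_abs Bochner_Integration.integrable_diff integrable_linear_statistic[where B = 1]; simp add: indicator_def)+
  moreover have "(\<integral>\<theta>. \<bar>(\<Sum>j<n. indicat_real {0<..s} (real n * \<theta> j)) - p ^ 3 / (2 * pi)\<bar> + \<bar>(\<Sum>j<n. indicat_real {-s..<0} (real n * \<theta> j)) - p ^ 3 / (2 * pi)\<bar> \<partial>P) =
     (\<integral>\<theta>. \<bar>(\<Sum>j<n. indicat_real {0<..s} (real n * \<theta> j)) - p ^ 3 / (2 * pi)\<bar> \<partial>P) + (\<integral>\<theta>. \<bar>(\<Sum>j<n. indicat_real {-s..<0} (real n * \<theta> j)) - p ^ 3 / (2 * pi)\<bar> \<partial>P)"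
    by (rule Bochner_Integration.integral_add)
      (intro integrable_abs Bochner_Integration.integrable_diff integrable_linear_statistic[where B = 1]; simp add: indicator_def)+
  ultimately show ?thesis
    unfolding p2[symmetric] by linarith
qed

text \<open>Abel summation against the mean discrepancy \<open>2 C s^(2/3)\<close>: the boundary
  term gives \<open>2 C / q\<close>, the integral of \<open>5 s^(-2)\<close> times the discrepancy
  gives \<open>30 C / q\<close>. The kernel is kept general because the tails of the cotangent and
  of the truncated reciprocal are both needed.\<close>

lemma expectation_odd_tail:
  fixes k k' :: "real \<Rightarrow> real" and q R :: real
  assumes n2: "2 \<le> n" and q: "1 \<le> q" "q ^ 3 \<le> R" "R \<le> pi * n"
    and k: "\<And>s. s \<in> {q ^ 3..R} \<Longrightarrow> (k has_real_derivative k' s) (at s within {q ^ 3..R})"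
    and k': "continuous_on {q ^ 3..R} k'" and kR: "k R = 0"
    and k'_le: "\<And>s. s \<in> {q ^ 3..R} \<Longrightarrow> \<bar>k' s\<bar> \<le> 5 / s\<^sup>2" and kr: "\<bar>k (q ^ 3)\<bar> \<le> 1 / q ^ 3"
  defines "K \<equiv> \<lambda>a. if q ^ 3 < a \<and> a \<le> R then k a else 0"
  shows "(\<integral>\<theta>. \<bar>\<Sum>j<n. K (real n * \<theta> j) - K (- (real n * \<theta> j))\<bar> \<partial>P) \<le> 32 * count_bound \<beta> / q"
    and "integrable P (\<lambda>\<theta>. \<bar>\<Sum>j<n. K (real n * \<theta> j) - K (- (real n * \<theta> j))\<bar>)"
proof -
  define r where "r = q ^ 3"
  have r1: "1 \<le> r" unfolding r_def using q by simp
  define C where "C = count_bound \<beta>"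
  have C0: "0 \<le> C" unfolding C_def count_bound_def using herglotz_bound_pos[OF beta] by simp
  define D where "D \<theta> = signed_count {..<n} (\<lambda>j. real n * \<theta> j)" for \<theta>
  \<comment> \<open>Extensions by 0 of \<open>k\<close> and \<open>k'\<close>, about which nothing
    is known outside the interval; they make the measurability and the uniform bound for Fubini
    available on the whole line.\<close>
  define kk where "kk s = (if s \<in> {r..R} then k s else 0)" for s
  define kk' where "kk' s = (if s \<in> {r..R} then k' s else 0)" for s
  have kk'b: "\<bar>kk' s\<bar> \<le> 5" for s
  proof (cases "s \<in> {r..R}")
    case True
    then have "1 \<le> s\<^sup>2" using r1 by simp
    then have "5 / s\<^sup>2 \<le> 5" by (simp add: divide_le_eq)
    then show ?thesis using k'_le[of s] True unfolding kk'_def r_def by simp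
  next
    case False
    then have "kk' s = 0" unfolding kk'_def by (rule if_not_P)
    then show ?thesis by simp
  qed
  have ck: "continuous_on {r..R} k" unfolding r_def by (rule DERIV_continuous_on[OF k])
  have [measurable]: "kk \<in> borel_measurable borel" "kk' \<in> borel_measurable borel"
    unfolding kk_def kk'_def using ck k' unfolding r_def[symmetric]
    by (intro borel_measurable_continuous_on_if continuous_on_const; simp)+
  have K_eq: "K a = (if r < a then kk a else 0)" for a unfolding K_def kk_def r_def by auto
  have [measurable]: "K \<in> borel_measurable borel" unfolding K_eq[abs_def] by measurable
  have mD: "(\<lambda>(\<theta>, s). \<bar>kk' s\<bar> * \<bar>D \<theta> s\<bar>) \<in> borel_measurable (cbe_space n \<Otimes>\<^sub>M borel)"
  proof -
    note measurable_cbe_component_compose [measurable (raw)]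
    show ?thesis unfolding D_def signed_count_def by measurable
  qed
  have bD: "norm (\<bar>kk' s\<bar> * \<bar>D \<theta> s\<bar>) \<le> 5 * real n" for s \<theta>
    unfolding real_norm_def abs_mult abs_abs D_def by (intro mult_mono kk'b abs_signed_count_le) auto
  note sw = expectation_interval_integral_swap[OF mD bD, of r R]
  have iD: "integrable P (\<lambda>\<theta>. \<bar>D \<theta> s\<bar>)" for s
    unfolding D_def by (rule integrable_bounded[where B = n]) (use abs_signed_count_le in auto)
  have pw: "\<bar>\<Sum>j<n. K (real n * \<theta> j) - K (- (real n * \<theta> j))\<bar> \<le> \<bar>k r\<bar> * \<bar>D \<theta> r\<bar> + (\<integral>s. indicator {r..R} s *\<^sub>R (\<bar>kk' s\<bar> * \<bar>D \<theta> s\<bar>) \<partial>lborel)" for \<theta>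
  proof -
    have "(\<integral>s. indicator {r..R} s *\<^sub>R (\<bar>kk' s\<bar> * \<bar>D \<theta> s\<bar>) \<partial>lborel) = (\<integral>s. indicator {r..R} s *\<^sub>R (\<bar>k' s\<bar> * \<bar>D \<theta> s\<bar>) \<partial>lborel)"
      by (intro Bochner_Integration.integral_cong) (auto simp: kk'_def indicator_def)
    then show ?thesis
      using abel_tail_bound[of r R k k' "\<lambda>j. real n * \<theta> j" "{..<n}"] r1 q k k' kR unfolding K_def D_def r_def by simp
  qed
  have iR: "integrable P (\<lambda>\<theta>. \<bar>k r\<bar> * \<bar>D \<theta> r\<bar> + (\<integral>s. indicator {r..R} s *\<^sub>R (\<bar>kk' s\<bar> * \<bar>D \<theta> s\<bar>) \<partial>lborel))"
    by (intro Bochner_Integration.integrable_add integrable_mult_right iD sw(2))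
  show iL: "integrable P (\<lambda>\<theta>. \<bar>\<Sum>j<n. K (real n * \<theta> j) - K (- (real n * \<theta> j))\<bar>)"
    by (rule Bochner_Integration.integrable_bound[OF iR]) (measurable, use pw in \<open>auto intro: order_trans[OF _ abs_ge_self]\<close>)
  have "(\<integral>\<theta>. \<bar>\<Sum>j<n. K (real n * \<theta> j) - K (- (real n * \<theta> j))\<bar> \<partial>P) \<le>
     (\<integral>\<theta>. \<bar>k r\<bar> * \<bar>D \<theta> r\<bar> + (\<integral>s. indicator {r..R} s *\<^sub>R (\<bar>kk' s\<bar> * \<bar>D \<theta> s\<bar>) \<partial>lborel) \<partial>P)"
    by (intro integral_mono iL iR pw)
  also have "\<dots> = \<bar>k r\<bar> * (\<integral>\<theta>. \<bar>D \<theta> r\<bar> \<partial>P) + (\<integral>s. indicator {r..R} s *\<^sub>R (\<bar>kk' s\<bar> * (\<integral>\<theta>. \<bar>D \<theta> s\<bar> \<partial>P)) \<partial>lborel)"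
    using iD sw by simp
  also have "\<dots> \<le> 2 * C / q + 10 * C * (3 / q)"
  proof (rule add_mono)
    have "\<bar>k r\<bar> * (\<integral>\<theta>. \<bar>D \<theta> r\<bar> \<partial>P) \<le> 1 / q ^ 3 * (2 * C * r powr (2 / 3))"
      unfolding D_def C_def using kr r1 q n2 unfolding r_def[symmetric]
      by (intro mult_mono expectation_signed_count Bochner_Integration.integral_nonneg) auto
    also have "r powr (2 / 3) = q\<^sup>2" unfolding r_def using q power_powr(2)[of q 3 "2 / 3"] by simp
    also have "1 / q ^ 3 * (2 * C * q\<^sup>2) = 2 * C / q" using q by (simp add: power2_eq_square power3_eq_cube)
    finally show "\<bar>k r\<bar> * (\<integral>\<theta>. \<bar>D \<theta> r\<bar> \<partial>P) \<le> 2 * C / q" .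
  next
    have ip: "integrable lborel (\<lambda>s. indicator {r..R} s *\<^sub>R (s powr (- (4 / 3))))"
    proof -
      have "continuous_on {r..R} (\<lambda>s. s powr (- (4 / 3)))" using r1 by (intro continuous_intros) auto
      from borel_integrable_atLeastAtMost'[OF this] show ?thesis unfolding set_integrable_def .
    qed
    have "(\<integral>s. indicator {r..R} s *\<^sub>R (\<bar>kk' s\<bar> * (\<integral>\<theta>. \<bar>D \<theta> s\<bar> \<partial>P)) \<partial>lborel) \<le>
       (\<integral>s. 10 * C * (indicator {r..R} s *\<^sub>R (s powr (- (4 / 3)))) \<partial>lborel)"
    proof (rule integral_mono_AE')
      show "AE s in lborel. indicator {r..R} s *\<^sub>R (\<bar>kk' s\<bar> * (\<integral>\<theta>. \<bar>D \<theta> s\<bar> \<partial>P)) \<le> 10 * C * (indicator {r..R} s *\<^sub>R (s powr (- (4 / 3))))"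
      proof (rule AE_I2)
        fix s :: real
        show "indicator {r..R} s *\<^sub>R (\<bar>kk' s\<bar> * (\<integral>\<theta>. \<bar>D \<theta> s\<bar> \<partial>P)) \<le> 10 * C * (indicator {r..R} s *\<^sub>R (s powr (- (4 / 3))))"
        proof (cases "s \<in> {r..R}")
          case True
          then have s: "1 \<le> s" "s \<le> pi * n" using r1 q by auto
          have "\<bar>kk' s\<bar> * (\<integral>\<theta>. \<bar>D \<theta> s\<bar> \<partial>P) \<le> 5 / s\<^sup>2 * (2 * C * s powr (2 / 3))"
            unfolding D_def C_def using k'_le[of s] True
            by (intro mult_mono expectation_signed_count n2 s Bochner_Integration.integral_nonneg) (auto simp: kk'_def r_def)
          also have "\<dots> = 10 * C * (s powr (2 / 3) / s powr 2)" using s by (simp add: powr_numeral)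
          also have "s powr (2 / 3) / s powr 2 = s powr (- (4 / 3))" unfolding powr_diff[symmetric] by simp
          finally show ?thesis using True by simp
        qed simp
      qed
      show "AE s in lborel. 0 \<le> 10 * C * (indicator {r..R} s *\<^sub>R (s powr (- (4 / 3))))" using C0 by simp
    qed (use ip in simp)
    also have "\<dots> = 10 * C * (\<integral>s. indicator {r..R} s *\<^sub>R (s powr (- (4 / 3))) \<partial>lborel)"
      by (rule integral_mult_right_zero)
    also have "\<dots> \<le> 10 * C * (3 / q)"
      unfolding r_def using C0 q by (intro mult_left_mono integral_powr_tail) auto
    finally show "(\<integral>s. indicator {r..R} s *\<^sub>R (\<bar>kk' s\<bar> * (\<integral>\<theta>. \<bar>D \<theta> s\<bar> \<partial>P)) \<partial>lborel) \<le> 10 * C * (3 / q)" .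
  qed
  also have "\<dots> = 32 * C / q" by (simp add: field_simps)
  finally show "(\<integral>\<theta>. \<bar>\<Sum>j<n. K (real n * \<theta> j) - K (- (real n * \<theta> j))\<bar> \<partial>P) \<le> 32 * count_bound \<beta> / q" unfolding C_def .
qed

end

text \<open>A continuous truncation of the positive part of \<open>1 / x\<close>: it equals \<open>1 / x\<close> on \<open>[\<epsilon>, r]\<close> and \<open>2 / x - 1 / r\<close> on
  \<open>[r, 2 r]\<close>, and vanishes outside \<open>[\<epsilon> / 2, 2 r]\<close>.\<close>
definition pv_kernel :: "real \<Rightarrow> real \<Rightarrow> real \<Rightarrow> real" where
  "pv_kernel \<epsilon> r x = max 0 (min (min ((2 * x / \<epsilon> - 1) / \<epsilon>) (1 / max x (\<epsilon> / 2))) (2 / max x (\<epsilon> / 2) - 1 / r))"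

lemma continuous_on_pv_kernel: "0 < \<epsilon> \<Longrightarrow> continuous_on X (pv_kernel \<epsilon> r)"
  unfolding pv_kernel_def by (intro continuous_intros) (auto simp: max_def)

lemma pv_kernel_nonneg: "0 \<le> pv_kernel \<epsilon> r x"
  unfolding pv_kernel_def by simp

lemma pv_kernel_eq_0: "0 < \<epsilon> \<Longrightarrow> x \<le> \<epsilon> / 2 \<Longrightarrow> pv_kernel \<epsilon> r x = 0"
proof -
  assume "0 < \<epsilon>" "x \<le> \<epsilon> / 2"
  then have "(2 * x / \<epsilon> - 1) / \<epsilon> \<le> 0" by (intro divide_nonpos_pos) (auto simp: field_simps)
  then show ?thesis unfolding pv_kernel_def by (intro max_absorb1 min.coboundedI1)
qed

lemma pv_kernel_eq_0':
  assumes "0 < \<epsilon>" "\<epsilon> \<le> r" "2 * r \<le> x"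
  shows "pv_kernel \<epsilon> r x = 0"
proof -
  have "max x (\<epsilon> / 2) = x" using assms by simp
  moreover have "2 / x \<le> 2 / (2 * r)" using assms by (intro divide_left_mono) auto
  ultimately have "2 / max x (\<epsilon> / 2) - 1 / r \<le> 0" by simp
  then show ?thesis unfolding pv_kernel_def by (intro max_absorb1 min.coboundedI2)
qed

lemma pv_kernel_eq:
  assumes "0 < \<epsilon>" "\<epsilon> \<le> r" "\<epsilon> \<le> x"
  shows "pv_kernel \<epsilon> r x = max 0 (min (1 / x) (2 / x - 1 / r))"
proof -
  have m: "max x (\<epsilon> / 2) = x" using assms by simp
  have "1 / x \<le> 1 / \<epsilon>" using assms by (intro divide_left_mono) auto
  also have "1 / \<epsilon> \<le> (2 * x / \<epsilon> - 1) / \<epsilon>" using assms by (intro divide_right_mono) (auto simp: field_simps)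
  finally show ?thesis unfolding pv_kernel_def m by (simp add: min_def)
qed

lemma pv_kernel_inner:
  assumes "0 < \<epsilon>" "\<epsilon> \<le> x" "x \<le> r"
  shows "pv_kernel \<epsilon> r x = 1 / x"
proof -
  have "1 / r \<le> 1 / x" using assms by (intro divide_left_mono) auto
  moreover have "0 < 1 / x" using assms by simp
  moreover have "2 / x = 1 / x + 1 / x" by simp
  ultimately have "1 / x \<le> 2 / x - 1 / r" by linarith
  then show ?thesis using assms \<open>0 < 1 / x\<close> by (subst pv_kernel_eq) (auto simp: min_def max_def)
qed

lemma pv_kernel_outer:
  assumes "0 < \<epsilon>" "\<epsilon> \<le> r" "r \<le> x" "x \<le> 2 * r"
  shows "pv_kernel \<epsilon> r x = 2 / x - 1 / r"
proof -
  have "1 / x \<le> 1 / r" using assms by (intro divide_left_mono) auto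
  moreover have "2 / x = 1 / x + 1 / x" by simp
  ultimately have 1: "2 / x - 1 / r \<le> 1 / x" by linarith
  have "2 / (2 * r) \<le> 2 / x" using assms by (intro divide_left_mono) auto
  then have "0 \<le> 2 / x - 1 / r" by simp
  then show ?thesis using assms 1 by (subst pv_kernel_eq) (auto simp: min_def max_def)
qed

lemma cc_nonneg_pv_kernel:
  assumes "0 < \<epsilon>" "\<epsilon> \<le> r"
  shows "cc_nonneg (pv_kernel \<epsilon> r)" "cc_nonneg (\<lambda>x. pv_kernel \<epsilon> r (- x))"
proof -
  have "\<epsilon> / 2 \<le> x \<and> x \<le> 2 * r" if "pv_kernel \<epsilon> r x \<noteq> 0" for x
    using pv_kernel_eq_0[of \<epsilon> x r] pv_kernel_eq_0'[of \<epsilon> r x] assms that by linarith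
  then have "{x. pv_kernel \<epsilon> r x \<noteq> 0} \<subseteq> {\<epsilon> / 2..2 * r}" "{x. pv_kernel \<epsilon> r (- x) \<noteq> 0} \<subseteq> {- (2 * r)..- (\<epsilon> / 2)}"
    by fastforce+
  then show "cc_nonneg (pv_kernel \<epsilon> r)" "cc_nonneg (\<lambda>x. pv_kernel \<epsilon> r (- x))"
    unfolding cc_nonneg_def using assms
    by (auto simp: pv_kernel_nonneg intro!: continuous_on_pv_kernel continuous_on_compose2[OF continuous_on_pv_kernel[of \<epsilon> UNIV]]
        continuous_intros bounded_subset[OF bounded_closed_interval])
qed

context circular_beta
begin

text \<open>The comparison is with \<open>1 / (2 n)\<close> times the sum of
  \<open>cot (\<theta> j / 2)\<close>, whose characteristic function at \<xi> is exactly
  \<open>exp (- \<xi> / 2)\<close>. The errors are \<open>2 \<epsilon>\<close> for a point too close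
  to 0, \<open>r / (8 n)\<close> for the reciprocal in place of the cotangent up to
  \<open>r = q^3\<close>, and one tail beyond \<open>r\<close> for each of the two kernels.\<close>

lemma cis_pv_statistic_error:
  assumes n2: "2 \<le> n" and q: "1 \<le> q" "2 * q ^ 3 \<le> pi * n" and eps: "0 < \<epsilon>" "\<epsilon> \<le> q ^ 3" and xi: "0 < \<xi>"
  defines "f \<equiv> pv_kernel \<epsilon> (q ^ 3)"
  shows "cmod ((\<integral>\<theta>. cis (\<xi> * ((\<Sum>j<n. f (real n * \<theta> j)) - (\<Sum>j<n. f (- (real n * \<theta> j))))) \<partial>P) - exp (- \<xi> / 2))
    \<le> 2 * \<epsilon> + \<xi> * (q ^ 3 / (8 * real n) + 64 * count_bound \<beta> / q)"
proof -
  define r where "r = q ^ 3"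
  have r1: "1 \<le> r" unfolding r_def using q by simp
  have q3: "q ^ 3 = r" unfolding r_def by simp
  have rn: "2 * r \<le> pi * n" "\<epsilon> \<le> r" using q eps unfolding r_def by auto
  \<comment> \<open>The cotangent summand in the rescaled variable \<open>a = n \<theta>\<close>,
    close to \<open>1 / a\<close>. It vanishes at \<open>a = pi n\<close>, and the outer piece
    \<open>k2\<close> of the truncated kernel at \<open>2 r\<close>, so both tails satisfy the end
    condition of \<open>expectation_odd_tail\<close>.\<close>
  define c where "c a = cot (a / (2 * real n)) / (2 * real n)" for a :: real
  define k2 where "k2 a = 2 / a - 1 / r" for a :: real
  define K1 where "K1 a = (if r < a \<and> a \<le> pi * n then c a else 0)" for a
  define K2 where "K2 a = (if r < a \<and> a \<le> 2 * r then k2 a else 0)" for a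
  define T1 where "T1 \<theta> = \<bar>\<Sum>j<n. K1 (real n * \<theta> j) - K1 (- (real n * \<theta> j))\<bar>" for \<theta>
  define T2 where "T2 \<theta> = \<bar>\<Sum>j<n. K2 (real n * \<theta> j) - K2 (- (real n * \<theta> j))\<bar>" for \<theta>
  \<comment> \<open>A continuous majorant of the indicator of
    \<open>{-\<epsilon>..\<epsilon>}\<close> supported in
    \<open>{- (2 * \<epsilon>)..2 * \<epsilon>}\<close>; its mean
    \<open>4 \<epsilon> / (2 pi)\<close> is at most \<epsilon>.\<close>
  define bump where "bump a = max 0 (min 1 (2 - \<bar>a\<bar> / \<epsilon>))" for a :: real
  define Bp where "Bp \<theta> = (\<Sum>j<n. bump (real n * \<theta> j))" for \<theta>
  define X where "X \<theta> = (\<Sum>j<n. f (real n * \<theta> j)) - (\<Sum>j<n. f (- (real n * \<theta> j)))" for \<theta>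
  define Y where "Y \<theta> = (if \<exists>j<n. \<theta> j = 0 then 0 else cis (\<xi> / 2 / n * (\<Sum>j<n. cot (\<theta> j / 2))))" for \<theta>
  have np: "0 < real n" using n_pos by simp
  have half: "0 < a / (2 * real n)" "a / (2 * real n) \<le> pi / 2" if "0 < a" "a \<le> pi * n" for a
    using that np by (auto simp: field_simps)
  have T1: "(\<integral>\<theta>. T1 \<theta> \<partial>P) \<le> 32 * count_bound \<beta> / q" and iT1: "integrable P T1"
  proof -
    let ?c' = "\<lambda>a. - (1 / (sin (a / (2 * real n)))\<^sup>2) / (4 * (real n)\<^sup>2)"
    have s: "sin (a / (2 * real n)) \<noteq> 0" if "a \<in> {q ^ 3..pi * n}" for a
      using half[of a] that r1 q3 by (intro less_imp_neq[symmetric] sin_gt_zero) auto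
    have 1: "(c has_real_derivative ?c' a) (at a within {q ^ 3..pi * n})" if "a \<in> {q ^ 3..pi * n}" for a
    proof -
      have "(cot has_real_derivative - inverse ((sin (a / (2 * real n)))\<^sup>2)) (at (a / (2 * real n)))"
        by (rule DERIV_cot[OF s[OF that]])
      then have "((\<lambda>a. cot (a / (2 * real n))) has_real_derivative - inverse ((sin (a / (2 * real n)))\<^sup>2) * (1 / (2 * real n))) (at a within {q ^ 3..pi * n})"
        by (rule DERIV_chain2) (use n_pos in \<open>auto intro!: derivative_eq_intros\<close>)
      then have "(c has_real_derivative - inverse ((sin (a / (2 * real n)))\<^sup>2) * (1 / (2 * real n)) / (2 * real n)) (at a within {q ^ 3..pi * n})"
        unfolding c_def by (rule DERIV_cdivide)
      moreover have "- inverse S * (1 / (2 * real n)) / (2 * real n) = - (1 / S) / (4 * (real n)\<^sup>2)" for S :: real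
        by (simp add: power2_eq_square inverse_eq_divide)
      ultimately show ?thesis by simp
    qed
    have 2: "continuous_on {q ^ 3..pi * n} ?c'"
      by (intro continuous_intros) (use s np in auto)
    have 3: "c (pi * n) = 0" unfolding c_def cot_def using np by simp
    have 4: "\<bar>?c' a\<bar> \<le> 5 / a\<^sup>2" if "a \<in> {q ^ 3..pi * n}" for a
    proof -
      have a: "0 < a" "a \<le> pi * n" using that r1 q3 by auto
      have "1 / (sin (a / (2 * real n)))\<^sup>2 \<le> 5 / (a / (2 * real n))\<^sup>2" by (rule cot_bounds(4)[OF half[OF a]])
      then have "1 / (sin (a / (2 * real n)))\<^sup>2 / (4 * (real n)\<^sup>2) \<le> 5 / (a / (2 * real n))\<^sup>2 / (4 * (real n)\<^sup>2)"
        by (intro divide_right_mono) auto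
      also have "\<dots> = 5 / a\<^sup>2" using np by (simp add: power_divide power_mult_distrib)
      finally show ?thesis by (simp add: abs_divide)
    qed
    have 5: "\<bar>c (q ^ 3)\<bar> \<le> 1 / q ^ 3"
    proof -
      have a: "0 < r" "r \<le> pi * n" using r1 rn by auto
      have "cot (r / (2 * real n)) / (2 * real n) \<le> 1 / (r / (2 * real n)) / (2 * real n)"
        by (intro divide_right_mono cot_bounds(1) half[OF a]) auto
      moreover have "0 \<le> cot (r / (2 * real n)) / (2 * real n)"
        by (intro divide_nonneg_nonneg cot_bounds(3) half[OF a]) auto
      ultimately show ?thesis unfolding c_def q3 using np by simp
    qed
    have 6: "q ^ 3 \<le> pi * n" using rn r1 q3 by linarith
    show "(\<integral>\<theta>. T1 \<theta> \<partial>P) \<le> 32 * count_bound \<beta> / q" "integrable P T1"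
      using expectation_odd_tail[OF n2 q(1) 6 order_refl 1 2 3 4 5] unfolding T1_def K1_def q3 by auto
  qed
  have T2: "(\<integral>\<theta>. T2 \<theta> \<partial>P) \<le> 32 * count_bound \<beta> / q" and iT2: "integrable P T2"
  proof -
    have 0: "q ^ 3 \<le> 2 * r" using r1 q3 by simp
    have 1: "(k2 has_real_derivative - 2 / a\<^sup>2) (at a within {q ^ 3..2 * r})" if "a \<in> {q ^ 3..2 * r}" for a
    proof -
      have "a \<noteq> 0" using that r1 q3 by auto
      then show ?thesis unfolding k2_def by (auto intro!: derivative_eq_intros simp: power2_eq_square)
    qed
    have 2: "continuous_on {q ^ 3..2 * r} (\<lambda>a. - 2 / a\<^sup>2)"
      using r1 q3 by (intro continuous_intros) auto
    have 3: "k2 (2 * r) = 0" unfolding k2_def by simp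
    have 4: "\<bar>- 2 / a\<^sup>2\<bar> \<le> 5 / a\<^sup>2" for a :: real by (simp add: abs_divide divide_right_mono)
    have 5: "\<bar>k2 (q ^ 3)\<bar> \<le> 1 / q ^ 3"
    proof -
      have "2 / r = 1 / r + 1 / r" by simp
      then have "k2 r = 1 / r" unfolding k2_def by linarith
      then show ?thesis unfolding q3 using r1 by simp
    qed
    show "(\<integral>\<theta>. T2 \<theta> \<partial>P) \<le> 32 * count_bound \<beta> / q" "integrable P T2"
      using expectation_odd_tail[OF n2 q(1) 0 rn(1) 1 2 3 4 5] unfolding T2_def K2_def q3 by auto
  qed
  have cb: "continuous_on A bump" for A unfolding bump_def using eps by (intro continuous_intros) auto
  have b1: "0 \<le> bump a" "bump a \<le> 1" for a unfolding bump_def by auto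
  have iB: "integrable P Bp"
    unfolding Bp_def by (rule integrable_linear_statistic[where B = 1]) (use b1 cb borel_measurable_continuous_onI in auto)
  have EB: "(\<integral>\<theta>. Bp \<theta> \<partial>P) \<le> \<epsilon>"
  proof -
    have "bump a \<le> 1 * indicator {- (2 * \<epsilon>)..2 * \<epsilon>} a" for a
    proof (cases "\<bar>a\<bar> \<le> 2 * \<epsilon>")
      case True then show ?thesis using b1 by (simp add: abs_le_iff)
    next
      case False
      then have "2 \<le> \<bar>a\<bar> / \<epsilon>" using eps by (simp add: field_simps)
      then show ?thesis unfolding bump_def by (auto simp: indicator_def)
    qed
    from expectation_linear_statistic_le[OF cb this] have "(\<integral>\<theta>. Bp \<theta> \<partial>P) \<le> 4 * \<epsilon> / (2 * pi)"
      unfolding Bp_def using eps by simp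
    also have "\<dots> \<le> 4 * \<epsilon> / 4" using eps pi_ge_two by (intro divide_left_mono) auto
    finally show ?thesis by simp
  qed
  have pw: "cmod (cis (\<xi> * X \<theta>) - Y \<theta>) \<le> 2 * Bp \<theta> + \<xi> * (r / (8 * real n) + T1 \<theta> + T2 \<theta>)" if \<theta>: "\<theta> \<in> space (cbe_space n)" for \<theta>
  proof (cases "\<exists>j<n. \<bar>real n * \<theta> j\<bar> < \<epsilon>")
    case True
    then obtain i where i: "i < n" "\<bar>real n * \<theta> i\<bar> < \<epsilon>" by auto
    have "cmod (cis (\<xi> * X \<theta>) - Y \<theta>) \<le> 1 + 1"
      unfolding Y_def by (intro order_trans[OF norm_triangle_ineq4] add_mono) auto
    also have "2 * bump (real n * \<theta> i) = 2"
    proof -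
      have "\<bar>real n * \<theta> i\<bar> / \<epsilon> \<le> 1" using i eps by simp
      then show ?thesis unfolding bump_def by simp
    qed
    then have "1 + 1 \<le> 2 * bump (real n * \<theta> i)" by simp
    also have "\<dots> \<le> 2 * Bp \<theta>"
      unfolding Bp_def using i b1 by (intro mult_left_mono member_le_sum) auto
    also have "\<dots> \<le> 2 * Bp \<theta> + \<xi> * (r / (8 * real n) + T1 \<theta> + T2 \<theta>)"
      using xi r1 unfolding T1_def T2_def by simp
    finally show ?thesis .
  next
    case False
    then have far: "\<epsilon> \<le> \<bar>real n * \<theta> j\<bar>" if "j < n" for j using that by (meson not_le)
    have "\<theta> j \<noteq> 0" if "j < n" for j using far[OF that] eps by auto
    then have Y: "Y \<theta> = cis (\<xi> * (\<Sum>j<n. c (real n * \<theta> j)))"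
      unfolding Y_def c_def using np by (auto simp: sum_divide_distrib[symmetric])
    \<comment> \<open>Up to \<open>r\<close> only the cotangent and \<open>1 / a\<close> differ;
      beyond \<open>r\<close>, \<open>K1\<close> and \<open>K2\<close> equal the two kernels exactly
      and nothing is left. Both sides are odd, so positive \<open>a\<close> suffice.\<close>
    have main: "\<bar>c a - (f a - f (- a)) - ((K1 a - K1 (- a)) - (K2 a - K2 (- a)))\<bar> \<le> r / (8 * (real n)\<^sup>2)"
      if a: "\<epsilon> \<le> \<bar>a\<bar>" "\<bar>a\<bar> \<le> pi * n" for a
    proof -
      have pos: "\<bar>c a - f a - (K1 a - K2 a)\<bar> \<le> r / (8 * (real n)\<^sup>2)" if a: "\<epsilon> \<le> a" "a \<le> pi * n" for a
      proof (cases "a \<le> r")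
        case True
        have a0: "0 < a" using a eps by simp
        define y where "y = a / (2 * real n)"
        have y: "0 < y" "y \<le> pi / 2" unfolding y_def using half[OF a0 a(2)] by auto
        have "1 / y - y / 2 \<le> cot y" "cot y \<le> 1 / y" using cot_bounds[OF y] by auto
        then have "\<bar>cot y - 1 / y\<bar> \<le> y / 2" by simp
        then have "\<bar>cot y - 1 / y\<bar> / (2 * real n) \<le> y / 2 / (2 * real n)" by (intro divide_right_mono) auto
        moreover have "c a - 1 / a = (cot y - 1 / y) / (2 * real n)"
          unfolding c_def y_def using np a0 by (simp add: diff_divide_distrib)
        then have "\<bar>c a - 1 / a\<bar> = \<bar>cot y - 1 / y\<bar> / (2 * real n)" by (simp add: abs_divide)
        moreover have "y / 2 / (2 * real n) = a / (8 * (real n)\<^sup>2)" unfolding y_def by (simp add: power2_eq_square)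
        moreover have "a / (8 * (real n)\<^sup>2) \<le> r / (8 * (real n)\<^sup>2)" using True by (intro divide_right_mono) auto
        moreover have "f a = 1 / a" unfolding f_def q3 using pv_kernel_inner[OF eps(1) a(1) True] .
        ultimately show ?thesis unfolding K1_def K2_def using True by simp
      next
        case False
        have "f a = K2 a"
        proof (cases "a \<le> 2 * r")
          case True
          then show ?thesis unfolding f_def q3 K2_def k2_def using False pv_kernel_outer[OF eps(1) rn(2), of a] by simp
        next
          case False
          then show ?thesis unfolding f_def q3 K2_def using pv_kernel_eq_0'[OF eps(1) rn(2), of a] by simp
        qed
        then show ?thesis using False a r1 unfolding K1_def by simp
      qed
      have neg: "f b = 0" "K1 b = 0" "K2 b = 0" if "b < 0" for b
        using that eps r1 unfolding f_def K1_def K2_def by (auto simp: pv_kernel_eq_0)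
      have odd: "c (- b) = - c b" for b unfolding c_def cot_def by simp
      show ?thesis
      proof (cases "0 < a")
        case True
        then show ?thesis using pos[of a] a neg[of "- a"] by simp
      next
        case False
        then have "a < 0" using a eps by auto
        then show ?thesis using pos[of "- a"] a neg[of a] odd[of a] by (simp add: abs_minus_commute)
      qed
    qed
    have inn: "\<bar>real n * \<theta> j\<bar> \<le> pi * n" if "j < n" for j
    proof -
      have "- pi < \<theta> j \<and> \<theta> j \<le> pi" using \<theta> that by (auto simp: space_cbe_space PiE_iff)
      then have "\<bar>\<theta> j\<bar> \<le> pi" by linarith
      then show ?thesis using np by (simp add: abs_mult mult.commute)
    qed
    define e where "e j = c (real n * \<theta> j) - (f (real n * \<theta> j) - f (- (real n * \<theta> j))) - ((K1 (real n * \<theta> j) - K1 (- (real n * \<theta> j))) - (K2 (real n * \<theta> j) - K2 (- (real n * \<theta> j))))" for j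
    have "\<bar>\<Sum>j<n. e j\<bar> \<le> (\<Sum>j<n. r / (8 * (real n)\<^sup>2))"
      unfolding e_def by (intro order_trans[OF sum_abs] sum_mono main far inn) auto
    also have "\<dots> = r / (8 * real n)" using np by (simp add: power2_eq_square)
    finally have e: "\<bar>\<Sum>j<n. e j\<bar> \<le> r / (8 * real n)" .
    have "(\<Sum>j<n. c (real n * \<theta> j)) - X \<theta> = (\<Sum>j<n. e j) + (\<Sum>j<n. K1 (real n * \<theta> j) - K1 (- (real n * \<theta> j))) - (\<Sum>j<n. K2 (real n * \<theta> j) - K2 (- (real n * \<theta> j)))"
      unfolding X_def e_def by (simp add: sum_subtractf)
    then have "\<bar>(\<Sum>j<n. c (real n * \<theta> j)) - X \<theta>\<bar> \<le> r / (8 * real n) + T1 \<theta> + T2 \<theta>"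
      unfolding T1_def T2_def using e by linarith
    then have "\<xi> * \<bar>X \<theta> - (\<Sum>j<n. c (real n * \<theta> j))\<bar> \<le> \<xi> * (r / (8 * real n) + T1 \<theta> + T2 \<theta>)"
      using xi by (intro mult_left_mono) (auto simp: abs_minus_commute)
    moreover have "cmod (cis (\<xi> * X \<theta>) - Y \<theta>) \<le> \<xi> * \<bar>X \<theta> - (\<Sum>j<n. c (real n * \<theta> j))\<bar>"
      unfolding Y using cmod_cis_diff_le[of "\<xi> * X \<theta>" "\<xi> * (\<Sum>j<n. c (real n * \<theta> j))"] xi
      by (simp add: right_diff_distrib[symmetric] abs_mult)
    moreover have "0 \<le> Bp \<theta>" unfolding Bp_def by (intro sum_nonneg b1)
    ultimately show ?thesis by linarith
  qed
  have EY: "(\<integral>\<theta>. Y \<theta> \<partial>P) = exp (- \<xi> / 2)"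
    unfolding Y_def using expectation_cis_cot[of "\<xi> / 2"] xi exp_of_real[of "- \<xi> / 2", where 'a = complex] by simp
  have mf: "f \<in> borel_measurable borel" unfolding f_def by (intro borel_measurable_continuous_onI continuous_on_pv_kernel eps)
  have mY: "Y \<in> borel_measurable P"
  proof -
    have [measurable]: "cot \<in> borel_measurable (borel :: real measure)"
      unfolding cot_def by measurable
    have "{\<theta> \<in> space (cbe_space n). \<exists>j<n. \<theta> j = 0} \<in> sets (cbe_space n)"
      by measurable
    then show ?thesis unfolding Y_def by measurable
  qed
  have iY: "integrable P Y"
    by (rule integrable_const_bound[where B = 1]) (use mY in \<open>auto simp: Y_def\<close>)
  have iX: "integrable P (\<lambda>\<theta>. cis (\<xi> * X \<theta>))"
    by (rule integrable_const_bound[where B = 1]) (use mf in \<open>auto simp: X_def\<close>)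
  have "cmod ((\<integral>\<theta>. cis (\<xi> * X \<theta>) \<partial>P) - exp (- \<xi> / 2)) = cmod (\<integral>\<theta>. cis (\<xi> * X \<theta>) - Y \<theta> \<partial>P)"
    unfolding EY[symmetric] using iX iY by simp
  also have "\<dots> \<le> (\<integral>\<theta>. cmod (cis (\<xi> * X \<theta>) - Y \<theta>) \<partial>P)" by (rule integral_norm_bound)
  also have "\<dots> \<le> (\<integral>\<theta>. 2 * Bp \<theta> + \<xi> * (r / (8 * real n) + T1 \<theta> + T2 \<theta>) \<partial>P)"
    using pw iX iY iB iT1 iT2 by (intro integral_mono) auto
  also have "\<dots> = 2 * (\<integral>\<theta>. Bp \<theta> \<partial>P) + \<xi> * (r / (8 * real n) + (\<integral>\<theta>. T1 \<theta> \<partial>P) + (\<integral>\<theta>. T2 \<theta> \<partial>P))"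
    using iB iT1 iT2 by (simp add: prob_space)
  also have "\<dots> \<le> 2 * \<epsilon> + \<xi> * (r / (8 * real n) + 32 * count_bound \<beta> / q + 32 * count_bound \<beta> / q)"
    using xi by (intro add_mono mult_left_mono EB T1 T2 order_refl) auto
  finally show ?thesis unfolding X_def r_def by (simp add: algebra_simps)
qed

end

section \<open>Passage to the limit process\<close>

text \<open>Moment method on a compact set: moments determine limits of polynomials in the two
  variables, and by Stone-Weierstrass these approximate \<phi> uniformly on the unit square. The
  measures are required to be probabilities only eventually, matching what is known about the
  partition function.\<close>

lemma tendsto_expectation_unit_square:
  fixes P :: "nat \<Rightarrow> 'b measure" and M :: "'a measure"
  assumes P: "\<forall>\<^sub>F n in sequentially. prob_space (P n)" and M: "prob_space M"
    and U: "\<And>n. U n \<in> borel_measurable (P n)" "\<And>n. V n \<in> borel_measurable (P n)"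
    and U': "U' \<in> borel_measurable M" "V' \<in> borel_measurable M"
    and U01: "\<And>n x. U n x \<in> {0..1}" "\<And>n x. V n x \<in> {0..1}" "\<And>x. U' x \<in> {0..1}" "\<And>x. V' x \<in> {0..1::real}"
    and moments: "\<And>i j. (\<lambda>n. \<integral>x. U n x ^ i * V n x ^ j \<partial>P n) \<longlonglongrightarrow> (\<integral>x. U' x ^ i * V' x ^ j \<partial>M)"
    and \<phi>: "continuous_on UNIV (\<phi> :: real \<times> real \<Rightarrow> real)"
  shows "(\<lambda>n. \<integral>x. \<phi> (U n x, V n x) \<partial>P n) \<longlonglongrightarrow> (\<integral>x. \<phi> (U' x, V' x) \<partial>M)"
proof -
  define S :: "(real \<times> real) set" where "S = {0..1} \<times> {0..1}"
  have cS: "compact S" unfolding S_def by (intro compact_Times) auto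
  interpret M: prob_space M by fact
  have bd: "\<exists>B. \<forall>z\<in>S. \<bar>g z\<bar> \<le> B" if "continuous_on UNIV g" for g :: "real \<times> real \<Rightarrow> real"
  proof -
    have "bounded (g ` S)" using that cS by (intro compact_imp_bounded compact_continuous_image) (auto intro: continuous_on_subset)
    then show ?thesis by (auto simp: bounded_iff)
  qed
  have m: "(\<lambda>x. g (u x, v x)) \<in> borel_measurable N" if "continuous_on UNIV g" "u \<in> borel_measurable N" "v \<in> borel_measurable N"
    for g :: "real \<times> real \<Rightarrow> real" and u v and N :: "'c measure"
    using borel_measurable_continuous_Pair[of u N v "\<lambda>a b. g (a, b)"] that by simp
  have intM: "integrable M (\<lambda>x. g (U' x, V' x))" if g: "continuous_on UNIV g" for g :: "real \<times> real \<Rightarrow> real"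
  proof -
    obtain B where "\<And>z. z \<in> S \<Longrightarrow> \<bar>g z\<bar> \<le> B" using bd[OF g] by auto
    then show ?thesis by (intro M.integrable_const_bound[where B = B] m[OF g U'] AE_I2) (use U01 in \<open>auto simp: S_def\<close>)
  qed
  have intP: "integrable (P n) (\<lambda>x. g (U n x, V n x))" if g: "continuous_on UNIV g" and n: "prob_space (P n)" for g :: "real \<times> real \<Rightarrow> real" and n
  proof -
    interpret Pn: prob_space "P n" by fact
    obtain B where "\<And>z. z \<in> S \<Longrightarrow> \<bar>g z\<bar> \<le> B" using bd[OF g] by auto
    then show ?thesis by (intro Pn.integrable_const_bound[where B = B] m[OF g U] AE_I2) (use U01 in \<open>auto simp: S_def\<close>)
  qed
  define conv where "conv g \<longleftrightarrow> (\<lambda>n. \<integral>x. g (U n x, V n x) \<partial>P n) \<longlonglongrightarrow> (\<integral>x. g (U' x, V' x) \<partial>M)" for g :: "real \<times> real \<Rightarrow> real"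
  have conv_add: "conv (\<lambda>z. g z + h z)" if "conv g" "conv h" "continuous_on UNIV g" "continuous_on UNIV h" for g h
  proof -
    have "(\<lambda>n. (\<integral>x. g (U n x, V n x) \<partial>P n) + (\<integral>x. h (U n x, V n x) \<partial>P n)) \<longlonglongrightarrow> (\<integral>x. g (U' x, V' x) \<partial>M) + (\<integral>x. h (U' x, V' x) \<partial>M)"
      using that(1,2) unfolding conv_def by (rule tendsto_add)
    moreover have "\<forall>\<^sub>F n in sequentially. (\<integral>x. g (U n x, V n x) \<partial>P n) + (\<integral>x. h (U n x, V n x) \<partial>P n) = (\<integral>x. g (U n x, V n x) + h (U n x, V n x) \<partial>P n)"
      using P by eventually_elim (simp add: intP that)
    ultimately show ?thesis
      unfolding conv_def using intM that by (simp add: tendsto_cong)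
  qed
  have conv_mult: "conv (\<lambda>z. c * g z)" if "conv g" for c g
    using tendsto_mult[OF tendsto_const that[unfolded conv_def], of c] unfolding conv_def by simp
  have cont: "continuous_on UNIV p" if "real_polynomial_function p" for p :: "real \<times> real \<Rightarrow> real"
    using that by (simp add: continuous_on_polymonial_function real_polynomial_function_eq)
  have cc: "continuous_on UNIV (\<lambda>z. fst z ^ i * snd z ^ j * q z)" if "continuous_on UNIV q" for i j and q :: "real \<times> real \<Rightarrow> real"
    using that by (intro continuous_intros)
  \<comment> \<open>The induction is strengthened by a factor \<open>q\<close> with all monomials in
    front: a product \<open>f * g\<close> is treated by the second hypothesis with
    \<open>q * f\<close> in the role of \<open>q\<close>, and a linear function raises one
    exponent.\<close>
  have poly: "\<forall>q. continuous_on UNIV q \<longrightarrow> (\<forall>i j. conv (\<lambda>z. fst z ^ i * snd z ^ j * q z)) \<longrightarrow> (\<forall>i j. conv (\<lambda>z. fst z ^ i * snd z ^ j * (q z * p z)))"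
    if "real_polynomial_function p" for p
    using that
  proof (induction p)
    case (linear f)
    have f: "f z = f (1, 0) * fst z + f (0, 1) * snd z" for z
    proof -
      have "z = fst z *\<^sub>R (1, 0) + snd z *\<^sub>R (0, 1)" by (cases z) simp
      then have "f z = f (fst z *\<^sub>R (1, 0) + snd z *\<^sub>R (0, 1))" by simp
      also have "\<dots> = fst z *\<^sub>R f (1, 0) + snd z *\<^sub>R f (0, 1)"
        using linear by (simp only: linear_add linear_cmul bounded_linear.linear)
      finally show ?thesis by (simp add: mult.commute)
    qed
    show ?case
    proof (intro allI impI)
      fix q i j assume q: "continuous_on UNIV q" "\<forall>i j. conv (\<lambda>z. fst z ^ i * snd z ^ j * q z)"
      have "conv (\<lambda>z. f (1, 0) * (fst z ^ Suc i * snd z ^ j * q z) + f (0, 1) * (fst z ^ i * snd z ^ Suc j * q z))"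
        by (intro conv_add conv_mult q(2)[THEN spec, THEN spec] continuous_intros q(1))
      then show "conv (\<lambda>z. fst z ^ i * snd z ^ j * (q z * f z))"
        by (subst f) (simp add: algebra_simps)
    qed
  next
    case (const c)
    then show ?case using conv_mult[of _ c] by (simp add: mult_ac)
  next
    case (add f g)
    show ?case
    proof (intro allI impI)
      fix q i j assume q: "continuous_on UNIV q" "\<forall>i j. conv (\<lambda>z. fst z ^ i * snd z ^ j * q z)"
      have "conv (\<lambda>z. fst z ^ i * snd z ^ j * (q z * f z) + fst z ^ i * snd z ^ j * (q z * g z))"
        using add q cont[OF add.hyps(1)] cont[OF add.hyps(2)] by (intro conv_add cc continuous_on_mult) auto
      then show "conv (\<lambda>z. fst z ^ i * snd z ^ j * (q z * (f z + g z)))"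
        by (simp add: algebra_simps)
    qed
  next
    case (mult f g)
    show ?case
    proof (intro allI impI)
      fix q i j assume q: "continuous_on UNIV q" "\<forall>i j. conv (\<lambda>z. fst z ^ i * snd z ^ j * q z)"
      have "\<forall>i j. conv (\<lambda>z. fst z ^ i * snd z ^ j * (q z * f z))" using mult.IH(1) q by blast
      moreover have "continuous_on UNIV (\<lambda>z. q z * f z)" using q cont[OF mult.hyps(1)] by (intro continuous_on_mult)
      ultimately have "conv (\<lambda>z. fst z ^ i * snd z ^ j * (q z * f z * g z))" using mult.IH(2) by blast
      then show "conv (\<lambda>z. fst z ^ i * snd z ^ j * (q z * (f z * g z)))" by (simp add: mult.assoc)
    qed
  qed
  have conv_poly: "conv p" if "real_polynomial_function p" for p
  proof -
    have "conv (\<lambda>z. fst z ^ i * snd z ^ j * 1)" for i j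
      using moments[of i j] unfolding conv_def by simp
    with poly[OF that, THEN spec[of _ "\<lambda>_. 1"]]
    have "\<forall>i j. conv (\<lambda>z. fst z ^ i * snd z ^ j * (1 * p z))" by simp
    from this[THEN spec[of _ 0], THEN spec[of _ 0]]
    show ?thesis by simp
  qed
  show ?thesis
  proof (rule LIMSEQ_I)
    fix e :: real assume e: "0 < e"
    have "continuous_on S \<phi>" using \<phi> by (rule continuous_on_subset) simp
    then obtain p where p: "real_polynomial_function p" "\<And>z. z \<in> S \<Longrightarrow> \<bar>\<phi> z - p z\<bar> < e / 3"
      using Stone_Weierstrass_real_polynomial_function[OF cS, of \<phi> "e / 3"] e by auto
    have "\<forall>\<^sub>F n in sequentially. \<bar>(\<integral>x. p (U n x, V n x) \<partial>P n) - (\<integral>x. p (U' x, V' x) \<partial>M)\<bar> < e / 3"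
      using conv_poly[OF p(1)] e unfolding conv_def tendsto_iff dist_real_def by (auto dest: spec[of _ "e / 3"])
    then have "\<forall>\<^sub>F n in sequentially. \<bar>(\<integral>x. \<phi> (U n x, V n x) \<partial>P n) - (\<integral>x. \<phi> (U' x, V' x) \<partial>M)\<bar> < e"
      using P
    proof eventually_elim
      fix n assume 1: "\<bar>(\<integral>x. p (U n x, V n x) \<partial>P n) - (\<integral>x. p (U' x, V' x) \<partial>M)\<bar> < e / 3" and n: "prob_space (P n)"
      interpret Pn: prob_space "P n" by fact
      have "\<bar>(\<integral>x. \<phi> (U n x, V n x) \<partial>P n) - (\<integral>x. p (U n x, V n x) \<partial>P n)\<bar> = \<bar>\<integral>x. \<phi> (U n x, V n x) - p (U n x, V n x) \<partial>P n\<bar>"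
        using intP[OF \<phi> n] intP[OF cont[OF p(1)] n] by simp
      also have "\<dots> \<le> (\<integral>x. \<bar>\<phi> (U n x, V n x) - p (U n x, V n x)\<bar> \<partial>P n)" by (rule integral_abs_bound)
      also have "\<dots> \<le> (\<integral>x. e / 3 \<partial>P n)"
        using intP[OF \<phi> n] intP[OF cont[OF p(1)] n] U01 by (intro integral_mono less_imp_le[OF p(2)]) (auto simp: S_def)
      also have "\<dots> = e / 3" using Pn.prob_space by simp
      finally have 2: "\<bar>(\<integral>x. \<phi> (U n x, V n x) \<partial>P n) - (\<integral>x. p (U n x, V n x) \<partial>P n)\<bar> \<le> e / 3" .
      have "\<bar>(\<integral>x. \<phi> (U' x, V' x) \<partial>M) - (\<integral>x. p (U' x, V' x) \<partial>M)\<bar> = \<bar>\<integral>x. \<phi> (U' x, V' x) - p (U' x, V' x) \<partial>M\<bar>"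
        using intM[OF \<phi>] intM[OF cont[OF p(1)]] by simp
      also have "\<dots> \<le> (\<integral>x. \<bar>\<phi> (U' x, V' x) - p (U' x, V' x)\<bar> \<partial>M)" by (rule integral_abs_bound)
      also have "\<dots> \<le> (\<integral>x. e / 3 \<partial>M)"
        using intM[OF \<phi>] intM[OF cont[OF p(1)]] U01 by (intro integral_mono less_imp_le[OF p(2)]) (auto simp: S_def)
      also have "\<dots> = e / 3" using M.prob_space by simp
      finally show "\<bar>(\<integral>x. \<phi> (U n x, V n x) \<partial>P n) - (\<integral>x. \<phi> (U' x, V' x) \<partial>M)\<bar> < e"
        using 1 2 by linarith
    qed
    then show "\<exists>no. \<forall>n\<ge>no. norm ((\<integral>x. \<phi> (U n x, V n x) \<partial>P n) - (\<integral>x. \<phi> (U' x, V' x) \<partial>M)) < e"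
      unfolding eventually_sequentially real_norm_def .
  qed
qed

lemma cc_nonneg_bound:
  assumes "cc_nonneg f"
  obtains B R where "0 \<le> B" "0 < R" "\<And>x. f x \<le> B * indicator {-R..R} x" "{x. f x \<noteq> 0} \<subseteq> {-R..R}"
proof -
  obtain R0 where R0: "\<And>x. f x \<noteq> 0 \<Longrightarrow> \<bar>x\<bar> \<le> R0"
    using assms unfolding cc_nonneg_def bounded_iff by auto
  define R where "R = max R0 1"
  have R: "0 < R" "\<And>x. f x \<noteq> 0 \<Longrightarrow> x \<in> {-R..R}" unfolding R_def using R0 by (fastforce simp: abs_le_iff)+
  have "compact (f ` {-R..R})"
    using assms unfolding cc_nonneg_def by (intro compact_continuous_image) (auto intro: continuous_on_subset)
  then obtain B where B: "\<And>x. x \<in> {-R..R} \<Longrightarrow> f x \<le> B"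
    using compact_imp_bounded bounded_iff by (metis (no_types, lifting) abs_le_D1 imageI real_norm_def)
  have "0 \<le> B" using B[of 0] R assms unfolding cc_nonneg_def by (meson atLeastAtMost_iff less_imp_le neg_le_0_iff_le order_trans)
  moreover have "f x \<le> B * indicator {-R..R} x" for x
  proof (cases "x \<in> {-R..R}")
    case False
    then have "f x = 0" using R(2)[of x] by blast
    then show ?thesis using False by simp
  qed (use B in simp)
  ultimately show ?thesis using that[of B R] R by blast
qed

lemma cc_nonneg_combine:
  assumes "cc_nonneg f" "cc_nonneg g"
  shows "cc_nonneg (\<lambda>x. real i * f x + real j * g x)"
proof -
  have "bounded ({x. f x \<noteq> 0} \<union> {x. g x \<noteq> 0})" using assms unfolding cc_nonneg_def by simp
  then have "bounded {x. real i * f x + real j * g x \<noteq> 0}" by (rule bounded_subset) auto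
  then show ?thesis using assms unfolding cc_nonneg_def by (auto intro!: continuous_intros)
qed

text \<open>Restricting to points with nonzero value matches the Laplace functional in
  \<open>sine_beta_process\<close> and keeps the sum finite for a locally finite set and compact
  support.\<close>

definition linear_stat :: "(real \<Rightarrow> real) \<Rightarrow> real set \<Rightarrow> real" where
  "linear_stat f A = (\<Sum>x\<in>{x\<in>A. f x \<noteq> 0}. f x)"

lemma linear_stat_eq:
  assumes "finite (A \<inter> {-R..R})" "{x. f x \<noteq> 0} \<subseteq> {-R..R}"
  shows "linear_stat f A = (\<Sum>x\<in>A \<inter> {-R..R}. f x)"
  unfolding linear_stat_def using assms by (intro sum.mono_neutral_left) auto

lemma linear_stat_nonneg: "(\<And>x. 0 \<le> f x) \<Longrightarrow> 0 \<le> linear_stat f A"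
  unfolding linear_stat_def by (intro sum_nonneg)

definition linear_stat_cbe :: "nat \<Rightarrow> (real \<Rightarrow> real) \<Rightarrow> (nat \<Rightarrow> real) \<Rightarrow> real" where
  "linear_stat_cbe n f \<theta> = (\<Sum>j<n. f (real n * \<theta> j))"

lemma measurable_linear_stat_cbe:
  assumes "cc_nonneg f"
  shows "linear_stat_cbe n f \<in> borel_measurable (cbe_space n)"
proof -
  have [measurable]: "f \<in> borel_measurable borel" using assms unfolding cc_nonneg_def by (intro borel_measurable_continuous_onI) auto
  show ?thesis unfolding linear_stat_cbe_def by measurable
qed

lemma linear_stat_cbe_nonneg: "cc_nonneg f \<Longrightarrow> 0 \<le> linear_stat_cbe n f \<theta>"
  unfolding linear_stat_cbe_def cc_nonneg_def by (intro sum_nonneg) auto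

lemma (in circular_beta) expectation_linear_stat_cbe:
  assumes "cc_nonneg f" and "0 \<le> B" "0 < R" "\<And>x. f x \<le> B * indicator {-R..R} x"
  shows "(\<integral>\<theta>. linear_stat_cbe n f \<theta> \<partial>P) \<le> B * (2 * R) / (2 * pi)" "integrable P (linear_stat_cbe n f)"
proof -
  have c: "continuous_on UNIV f" "0 \<le> f x" for x using assms unfolding cc_nonneg_def by auto
  show "(\<integral>\<theta>. linear_stat_cbe n f \<theta> \<partial>P) \<le> B * (2 * R) / (2 * pi)"
    using expectation_linear_statistic_le[OF c(1) assms(4)] assms unfolding linear_stat_cbe_def by simp
  have "\<bar>f x\<bar> \<le> B" for x
    using assms(2) assms(4)[of x] c(2)[of x] by (cases "x \<in> {-R..R}") auto
  then show "integrable P (linear_stat_cbe n f)"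
    unfolding linear_stat_cbe_def by (intro integrable_linear_statistic borel_measurable_continuous_onI c)
qed

text \<open>It exhibits the truncation \<open>min x T\<close> as a continuous function of
  \<open>exp (- x)\<close>, the only variable accessible through Laplace functionals.\<close>

lemma ln_max_exp: "ln (max (exp (- x)) (exp (- T))) = - min x T" for x T :: real
  by (simp add: max_def min_def)

section \<open>Linear statistics of the limit process\<close>

locale sine_process =
  fixes \<beta> :: real and M :: "'a measure" and \<Lambda> :: "'a \<Rightarrow> real set"
  assumes beta: "0 < \<beta>" and sine: "sine_beta_process \<beta> M \<Lambda>"
begin

lemma prob_M: "prob_space M" using sine unfolding sine_beta_process_def by simp

lemma integrable_M_bounded:
  fixes g :: "'a \<Rightarrow> 'b::{banach, second_countable_topology}"
  assumes "g \<in> borel_measurable M" "\<And>\<omega>. norm (g \<omega>) \<le> B"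
  shows "integrable M g"
proof -
  interpret prob_space M by (rule prob_M)
  show ?thesis using assms by (intro integrable_const_bound[where B = B]) auto
qed

abbreviation L where "L f \<omega> \<equiv> linear_stat f (\<Lambda> \<omega>)"

lemma AE_finite: "AE \<omega> in M. \<forall>a b. finite (\<Lambda> \<omega> \<inter> {a..b})"
  using sine unfolding sine_beta_process_def by simp

lemma laplace_cbe_expectation:
  assumes "cc_nonneg f"
  shows "(\<lambda>n. cbe_expectation \<beta> n (\<lambda>\<theta>. exp (- linear_stat_cbe n f \<theta>))) \<longlonglongrightarrow> (\<integral>\<omega>. exp (- L f \<omega>) \<partial>M)"
  using sine assms unfolding sine_beta_process_def linear_stat_cbe_def linear_stat_def by blast

text \<open>The test function 0 has Laplace functional 1 in the limit, while
  \<open>cbe_expectation\<close> of the constant 1 is 1 or, by division by zero, 0. Convergence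
  rules out the latter for large \<open>n\<close>.\<close>

lemma eventually_circular_beta: "\<forall>\<^sub>F n in sequentially. circular_beta \<beta> n"
proof -
  have "cc_nonneg (\<lambda>_. 0)" unfolding cc_nonneg_def by simp
  from laplace_cbe_expectation[OF this]
  have "(\<lambda>n. cbe_expectation \<beta> n (\<lambda>\<theta>. 1)) \<longlonglongrightarrow> 1"
    by (simp add: linear_stat_cbe_def linear_stat_def prob_space.prob_space[OF prob_M])
  then have "\<forall>\<^sub>F n in sequentially. 0 < cbe_expectation \<beta> n (\<lambda>\<theta>. 1)"
    by (rule order_tendstoD) simp
  then show ?thesis
    using eventually_gt_at_top[of 0]
  proof eventually_elim
    fix n :: nat assume "0 < cbe_expectation \<beta> n (\<lambda>\<theta>. 1)" "0 < n"
    then show "circular_beta \<beta> n"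
      using beta unfolding cbe_expectation_def by unfold_locales auto
  qed
qed

lemma eventually_prob_space: "\<forall>\<^sub>F n in sequentially. prob_space (cbe_measure \<beta> n)"
  using eventually_circular_beta by eventually_elim (rule circular_beta.prob_space_cbe)

lemma laplace_limit:
  assumes "cc_nonneg f"
  shows "(\<lambda>n. \<integral>\<theta>. exp (- linear_stat_cbe n f \<theta>) \<partial>cbe_measure \<beta> n) \<longlonglongrightarrow> (\<integral>\<omega>. exp (- L f \<omega>) \<partial>M)"
proof -
  have "cbe_expectation \<beta> n (\<lambda>\<theta>. exp (- linear_stat_cbe n f \<theta>)) = (\<integral>\<theta>. exp (- linear_stat_cbe n f \<theta>) \<partial>cbe_measure \<beta> n)" for n
    by (rule cbe_expectation_eq) (use measurable_linear_stat_cbe[OF assms] in measurable)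
  then show ?thesis using laplace_cbe_expectation[OF assms] by simp
qed

text \<open>The Laplace functional is bounded away from zero, so its integrand cannot be
  non-integrable (a Bochner integral of a non-measurable function would be zero).\<close>
lemma measurable_L [measurable]:
  assumes f: "cc_nonneg f"
  shows "L f \<in> borel_measurable M"
proof -
  obtain B R where BR: "0 \<le> B" "0 < R" "\<And>x. f x \<le> B * indicator {-R..R} x"
    using cc_nonneg_bound[OF f] by metis
  define c where "c = B * (2 * R) / (2 * pi)"
  have "\<forall>\<^sub>F n in sequentially. exp (- c) \<le> (\<integral>\<theta>. exp (- linear_stat_cbe n f \<theta>) \<partial>cbe_measure \<beta> n)"
    using eventually_circular_beta
  proof eventually_elim
    fix n assume "circular_beta \<beta> n"
    then interpret circular_beta \<beta> n .
    note X = expectation_linear_stat_cbe[OF f BR]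
    \<comment> \<open>The tangent of \<open>exp (- x)\<close> at \<open>x = c\<close> lies below it;
      with \<open>c\<close> an upper bound for the mean this is Jensen's inequality.\<close>
    have "exp (- c) \<le> exp (- c) * (1 + (c - (\<integral>\<theta>. linear_stat_cbe n f \<theta> \<partial>P)))"
      using X(1) unfolding c_def[symmetric] by simp
    also have "\<dots> = (\<integral>\<theta>. exp (- c) * (1 + (c - linear_stat_cbe n f \<theta>)) \<partial>P)"
      using X(2) by (simp add: prob_space)
    also have "\<dots> \<le> (\<integral>\<theta>. exp (- linear_stat_cbe n f \<theta>) \<partial>P)"
    proof (rule integral_mono)
      show "exp (- c) * (1 + (c - linear_stat_cbe n f \<theta>)) \<le> exp (- linear_stat_cbe n f \<theta>)" for \<theta>
      proof -
        have "exp (- c) * (1 + (c - linear_stat_cbe n f \<theta>)) \<le> exp (- c) * exp (c - linear_stat_cbe n f \<theta>)"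
          by (intro mult_left_mono exp_ge_add_one_self) auto
        also have "\<dots> = exp (- linear_stat_cbe n f \<theta>)" by (simp add: mult_exp_exp)
        finally show ?thesis .
      qed
      show "integrable P (\<lambda>\<theta>. exp (- linear_stat_cbe n f \<theta>))"
        by (rule integrable_const_bound[where B = 1])
          (use measurable_linear_stat_cbe[OF f] linear_stat_cbe_nonneg[OF f] in auto)
    qed (use X(2) in auto)
    finally show "exp (- c) \<le> (\<integral>\<theta>. exp (- linear_stat_cbe n f \<theta>) \<partial>P)" .
  qed
  from tendsto_lowerbound[OF laplace_limit[OF f] this]
  have "exp (- c) \<le> (\<integral>\<omega>. exp (- L f \<omega>) \<partial>M)" by simp
  then have "(\<integral>\<omega>. exp (- L f \<omega>) \<partial>M) \<noteq> 0" using exp_gt_zero[of "- c"] by linarith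
  then have "integrable M (\<lambda>\<omega>. exp (- L f \<omega>))" using not_integrable_integral_eq by blast
  then have [measurable]: "(\<lambda>\<omega>. exp (- L f \<omega>)) \<in> borel_measurable M" by (rule borel_measurable_integrable)
  have "(\<lambda>\<omega>. - ln (exp (- L f \<omega>))) \<in> borel_measurable M" by measurable
  then show ?thesis by simp
qed

lemma L_nonneg: "cc_nonneg f \<Longrightarrow> 0 \<le> L f \<omega>"
  unfolding cc_nonneg_def by (intro linear_stat_nonneg) auto

text \<open>Holds only almost surely: additivity rests on the sums being finite, which local
  finiteness guarantees.\<close>

lemma L_combine:
  assumes "cc_nonneg f" "cc_nonneg g"
  shows "AE \<omega> in M. L (\<lambda>x. real i * f x + real j * g x) \<omega> = real i * L f \<omega> + real j * L g \<omega>"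
  using AE_finite
proof eventually_elim
  fix \<omega> assume fin: "\<forall>a b. finite (\<Lambda> \<omega> \<inter> {a..b})"
  obtain R1 where R1: "{x. f x \<noteq> 0} \<subseteq> {-R1..R1}" using cc_nonneg_bound[OF assms(1)] by metis
  obtain R2 where R2: "{x. g x \<noteq> 0} \<subseteq> {-R2..R2}" using cc_nonneg_bound[OF assms(2)] by metis
  define R where "R = max R1 R2"
  have "{-R1..R1} \<subseteq> {-R..R}" "{-R2..R2} \<subseteq> {-R..R}" unfolding R_def by auto
  then have R: "{x. f x \<noteq> 0} \<subseteq> {-R..R}" "{x. g x \<noteq> 0} \<subseteq> {-R..R}"
    using R1 R2 by (blast intro: order_trans)+
  have "{x. real i * f x + real j * g x \<noteq> 0} \<subseteq> {x. f x \<noteq> 0} \<union> {x. g x \<noteq> 0}" by auto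
  with R have R3: "{x. real i * f x + real j * g x \<noteq> 0} \<subseteq> {-R..R}" by blast
  have fR: "finite (\<Lambda> \<omega> \<inter> {-R..R})" using fin by simp
  show "L (\<lambda>x. real i * f x + real j * g x) \<omega> = real i * L f \<omega> + real j * L g \<omega>"
    unfolding linear_stat_eq[OF fR R(1)] linear_stat_eq[OF fR R(2)] linear_stat_eq[OF fR R3]
    by (simp add: sum.distrib sum_distrib_left)
qed

text \<open>The mixed moment of order \<open>(i, j)\<close> is the Laplace functional of
  \<open>i f + j g\<close>, again a test function, so the moment criterion applies.\<close>

lemma tendsto_expectation:
  assumes f: "cc_nonneg f" and g: "cc_nonneg g" and \<phi>: "continuous_on UNIV \<phi>"
  shows "(\<lambda>n. \<integral>\<theta>. \<phi> (exp (- linear_stat_cbe n f \<theta>), exp (- linear_stat_cbe n g \<theta>)) \<partial>cbe_measure \<beta> n)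
     \<longlonglongrightarrow> (\<integral>\<omega>. \<phi> (exp (- L f \<omega>), exp (- L g \<omega>)) \<partial>M :: real)"
proof (rule tendsto_expectation_unit_square[OF eventually_prob_space prob_M _ _ _ _ _ _ _ _ _ \<phi>])
  fix i j
  have "(\<lambda>n. \<integral>\<theta>. exp (- linear_stat_cbe n (\<lambda>x. real i * f x + real j * g x) \<theta>) \<partial>cbe_measure \<beta> n) \<longlonglongrightarrow>
     (\<integral>\<omega>. exp (- L (\<lambda>x. real i * f x + real j * g x) \<omega>) \<partial>M)"
    by (rule laplace_limit[OF cc_nonneg_combine[OF f g]])
  also have "(\<integral>\<omega>. exp (- L (\<lambda>x. real i * f x + real j * g x) \<omega>) \<partial>M) = (\<integral>\<omega>. exp (- L f \<omega>) ^ i * exp (- L g \<omega>) ^ j \<partial>M)"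
  proof (rule integral_cong_AE)
    show "AE \<omega> in M. exp (- L (\<lambda>x. real i * f x + real j * g x) \<omega>) = exp (- L f \<omega>) ^ i * exp (- L g \<omega>) ^ j"
      using L_combine[OF f g, of i j]
      by eventually_elim (simp add: exp_of_nat_mult[symmetric] mult_exp_exp)
  qed (use measurable_L[OF cc_nonneg_combine[OF f g]] measurable_L[OF f] measurable_L[OF g] in measurable)
  also have "(\<lambda>n. \<integral>\<theta>. exp (- linear_stat_cbe n (\<lambda>x. real i * f x + real j * g x) \<theta>) \<partial>cbe_measure \<beta> n) =
     (\<lambda>n. \<integral>\<theta>. exp (- linear_stat_cbe n f \<theta>) ^ i * exp (- linear_stat_cbe n g \<theta>) ^ j \<partial>cbe_measure \<beta> n)"
  proof -
    have "linear_stat_cbe n (\<lambda>x. real i * f x + real j * g x) \<theta> = real i * linear_stat_cbe n f \<theta> + real j * linear_stat_cbe n g \<theta>" for n \<theta>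
      unfolding linear_stat_cbe_def by (simp add: sum.distrib sum_distrib_left)
    then show ?thesis by (simp add: exp_of_nat_mult[symmetric] mult_exp_exp)
  qed
  finally show "(\<lambda>n. \<integral>\<theta>. exp (- linear_stat_cbe n f \<theta>) ^ i * exp (- linear_stat_cbe n g \<theta>) ^ j \<partial>cbe_measure \<beta> n) \<longlonglongrightarrow> (\<integral>\<omega>. exp (- L f \<omega>) ^ i * exp (- L g \<omega>) ^ j \<partial>M)" .
qed (use measurable_L[OF f] measurable_L[OF g] measurable_linear_stat_cbe[OF f] measurable_linear_stat_cbe[OF g]
  L_nonneg[OF f] L_nonneg[OF g] linear_stat_cbe_nonneg[OF f] linear_stat_cbe_nonneg[OF g] in auto)

text \<open>\<open>L f - L g\<close> is singular where the exponentials vanish, so both statistics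
  are truncated at \<open>T\<close>. The error is \<open>O(1 / T)\<close> uniformly in
  \<open>n\<close> by the intensity, and in the limit process it disappears by dominated
  convergence.\<close>

lemma tendsto_expectation_difference:
  fixes h :: "real \<Rightarrow> real"
  assumes f: "cc_nonneg f" and g: "cc_nonneg g" and h: "continuous_on UNIV h" "\<And>x. \<bar>h x\<bar> \<le> 1"
  shows "(\<lambda>n. \<integral>\<theta>. h (linear_stat_cbe n f \<theta> - linear_stat_cbe n g \<theta>) \<partial>cbe_measure \<beta> n) \<longlonglongrightarrow> (\<integral>\<omega>. h (L f \<omega> - L g \<omega>) \<partial>M)"
proof -
  obtain B1 R1 where BR1: "0 \<le> B1" "0 < R1" "\<And>x. f x \<le> B1 * indicator {-R1..R1} x" using cc_nonneg_bound[OF f] by metis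
  obtain B2 R2 where BR2: "0 \<le> B2" "0 < R2" "\<And>x. g x \<le> B2 * indicator {-R2..R2} x" using cc_nonneg_bound[OF g] by metis
  define c where "c = B1 * (2 * R1) / (2 * pi) + B2 * (2 * R2) / (2 * pi)"
  have c0: "0 \<le> c" unfolding c_def using BR1 BR2 by (intro add_nonneg_nonneg divide_nonneg_nonneg) auto
  have [measurable]: "h \<in> borel_measurable borel" using h by (intro borel_measurable_continuous_onI)
  note [measurable] = measurable_L[OF f] measurable_L[OF g] measurable_linear_stat_cbe[OF f] measurable_linear_stat_cbe[OF g]
  define tr where "tr T x y = h (min x T - min y T)" for T x y :: real
  define \<phi> where "\<phi> T z = h (ln (max (snd z) (exp (- T))) - ln (max (fst z) (exp (- T))))" for T and z :: "real \<times> real"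
  have \<phi>_eq: "\<phi> T (exp (- x), exp (- y)) = tr T x y" for T x y
    unfolding \<phi>_def tr_def fst_conv snd_conv ln_max_exp by simp
  have c\<phi>: "continuous_on UNIV (\<phi> T)" for T
  proof -
    have "0 < max u (exp (- T))" for u :: real by (simp add: less_max_iff_disj)
    then have "max u (exp (- T)) \<noteq> 0" for u :: real by (metis less_irrefl)
    then show ?thesis unfolding \<phi>_def by (intro continuous_on_compose2[OF h(1)] continuous_intros) auto
  qed
  have lim_tr: "(\<lambda>n. \<integral>\<theta>. tr T (linear_stat_cbe n f \<theta>) (linear_stat_cbe n g \<theta>) \<partial>cbe_measure \<beta> n) \<longlonglongrightarrow> (\<integral>\<omega>. tr T (L f \<omega>) (L g \<omega>) \<partial>M)" for T
    using tendsto_expectation[OF f g c\<phi>, of T] unfolding \<phi>_eq .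
  have trb: "\<bar>tr T x y\<bar> \<le> 1" for T x y unfolding tr_def by (rule h)
  \<comment> \<open>Markov's inequality pointwise: truncation matters only if a variable exceeds
    \<open>T\<close>, and then \<open>2 / T * (x + y) \<ge> 2\<close>.\<close>
  have diff: "\<bar>h (x - y) - tr T x y\<bar> \<le> 2 / T * (x + y)" if "0 \<le> x" "0 \<le> y" "0 < T" for x y T
  proof (cases "x \<le> T \<and> y \<le> T")
    case True
    then show ?thesis using that unfolding tr_def by simp
  next
    case False
    then have "T \<le> x + y" using that by auto
    then have "2 \<le> 2 / T * (x + y)" using that by (simp add: field_simps)
    then show ?thesis using trb[of T x y] h(2)[of "x - y"] by linarith
  qed
  have fin: "\<bar>(\<integral>\<theta>. h (linear_stat_cbe n f \<theta> - linear_stat_cbe n g \<theta>) \<partial>cbe_measure \<beta> n) - (\<integral>\<theta>. tr T (linear_stat_cbe n f \<theta>) (linear_stat_cbe n g \<theta>) \<partial>cbe_measure \<beta> n)\<bar> \<le> 2 / T * c"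
    if "circular_beta \<beta> n" and T: "0 < T" for n T
  proof -
    interpret circular_beta \<beta> n by fact
    note X = expectation_linear_stat_cbe[OF f BR1] and Y = expectation_linear_stat_cbe[OF g BR2]
    have i1: "integrable P (\<lambda>\<theta>. h (linear_stat_cbe n f \<theta> - linear_stat_cbe n g \<theta>))"
      by (rule integrable_const_bound[where B = 1]) (use h in auto)
    have i2: "integrable P (\<lambda>\<theta>. tr T (linear_stat_cbe n f \<theta>) (linear_stat_cbe n g \<theta>))"
      by (rule integrable_const_bound[where B = 1]) (use trb in \<open>auto simp: tr_def\<close>)
    have "\<bar>(\<integral>\<theta>. h (linear_stat_cbe n f \<theta> - linear_stat_cbe n g \<theta>) \<partial>P) - (\<integral>\<theta>. tr T (linear_stat_cbe n f \<theta>) (linear_stat_cbe n g \<theta>) \<partial>P)\<bar>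
      = \<bar>\<integral>\<theta>. h (linear_stat_cbe n f \<theta> - linear_stat_cbe n g \<theta>) - tr T (linear_stat_cbe n f \<theta>) (linear_stat_cbe n g \<theta>) \<partial>P\<bar>"
      using i1 i2 by simp
    also have "\<dots> \<le> (\<integral>\<theta>. \<bar>h (linear_stat_cbe n f \<theta> - linear_stat_cbe n g \<theta>) - tr T (linear_stat_cbe n f \<theta>) (linear_stat_cbe n g \<theta>)\<bar> \<partial>P)"
      by (rule integral_abs_bound)
    also have "\<dots> \<le> (\<integral>\<theta>. 2 / T * (linear_stat_cbe n f \<theta> + linear_stat_cbe n g \<theta>) \<partial>P)"
      using i1 i2 X(2) Y(2) T by (intro integral_mono diff linear_stat_cbe_nonneg f g) auto
    also have "\<dots> = 2 / T * ((\<integral>\<theta>. linear_stat_cbe n f \<theta> \<partial>P) + (\<integral>\<theta>. linear_stat_cbe n g \<theta> \<partial>P))"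
      using X(2) Y(2) by simp
    also have "\<dots> \<le> 2 / T * c"
      unfolding c_def using X(1) Y(1) T by (intro mult_left_mono add_mono) auto
    finally show ?thesis .
  qed
  have limT: "(\<lambda>k. \<integral>\<omega>. tr (real k) (L f \<omega>) (L g \<omega>) \<partial>M) \<longlonglongrightarrow> (\<integral>\<omega>. h (L f \<omega> - L g \<omega>) \<partial>M)"
  proof (rule integral_dominated_convergence[where w = "\<lambda>_. 1"])
    show "AE \<omega> in M. (\<lambda>k. tr (real k) (L f \<omega>) (L g \<omega>)) \<longlonglongrightarrow> h (L f \<omega> - L g \<omega>)"
    proof (rule AE_I2, rule tendsto_eventually)
      fix \<omega>
      have "\<forall>\<^sub>F k in sequentially. max (L f \<omega>) (L g \<omega>) \<le> real k"
        by (rule eventually_compose_filterlim[OF eventually_ge_at_top filterlim_real_sequentially])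
      then show "\<forall>\<^sub>F k in sequentially. tr (real k) (L f \<omega>) (L g \<omega>) = h (L f \<omega> - L g \<omega>)"
        by eventually_elim (simp add: tr_def)
    qed
    show "integrable M (\<lambda>_. 1 :: real)" by (rule integrable_M_bounded[where B = 1]) auto
  qed (use trb in \<open>auto simp: tr_def\<close>)
  show ?thesis
  proof (rule LIMSEQ_I)
    fix e :: real assume e: "0 < e"
    have "\<forall>\<^sub>F k in sequentially. \<bar>(\<integral>\<omega>. tr (real k) (L f \<omega>) (L g \<omega>) \<partial>M) - (\<integral>\<omega>. h (L f \<omega> - L g \<omega>) \<partial>M)\<bar> < e / 3"
      using limT e unfolding tendsto_iff dist_real_def by (auto dest: spec[of _ "e / 3"])
    moreover have "\<forall>\<^sub>F k in sequentially. max 1 (6 * c / e + 1) \<le> real k"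
      by (rule eventually_compose_filterlim[OF eventually_ge_at_top filterlim_real_sequentially])
    ultimately obtain k :: nat where k: "\<bar>(\<integral>\<omega>. tr (real k) (L f \<omega>) (L g \<omega>) \<partial>M) - (\<integral>\<omega>. h (L f \<omega> - L g \<omega>) \<partial>M)\<bar> < e / 3"
      "1 \<le> real k" "6 * c / e < real k"
      using eventually_happens'[OF sequentially_bot eventually_conj] by (smt (verit, best))
    have kc: "2 / real k * c < e / 3" using k(2,3) e by (simp add: field_simps)
    have "\<forall>\<^sub>F n in sequentially. \<bar>(\<integral>\<theta>. tr (real k) (linear_stat_cbe n f \<theta>) (linear_stat_cbe n g \<theta>) \<partial>cbe_measure \<beta> n) - (\<integral>\<omega>. tr (real k) (L f \<omega>) (L g \<omega>) \<partial>M)\<bar> < e / 3"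
      using lim_tr[of "real k"] e unfolding tendsto_iff dist_real_def by (auto dest: spec[of _ "e / 3"])
    then have "\<forall>\<^sub>F n in sequentially. \<bar>(\<integral>\<theta>. h (linear_stat_cbe n f \<theta> - linear_stat_cbe n g \<theta>) \<partial>cbe_measure \<beta> n) - (\<integral>\<omega>. h (L f \<omega> - L g \<omega>) \<partial>M)\<bar> < e"
      using eventually_circular_beta
    proof eventually_elim
      case (elim n)
      then show ?case using fin[of n "real k"] k kc by linarith
    qed
    then show "\<exists>no. \<forall>n\<ge>no. norm ((\<integral>\<theta>. h (linear_stat_cbe n f \<theta> - linear_stat_cbe n g \<theta>) \<partial>cbe_measure \<beta> n) - (\<integral>\<omega>. h (L f \<omega> - L g \<omega>) \<partial>M)) < e"
      unfolding eventually_sequentially real_norm_def .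
  qed
qed

lemma nn_integral_L_deviation_le:
  assumes f: "cc_nonneg f" and b: "0 \<le> b"
    and dev: "\<forall>\<^sub>F n in sequentially. (\<integral>\<theta>. \<bar>linear_stat_cbe n f \<theta> - c\<bar> \<partial>cbe_measure \<beta> n) \<le> b"
  shows "(\<integral>\<^sup>+\<omega>. ennreal \<bar>L f \<omega> - c\<bar> \<partial>M) \<le> ennreal b"
proof -
  note [measurable] = measurable_L[OF f] measurable_linear_stat_cbe[OF f]
  obtain B R where BR: "0 \<le> B" "0 < R" "\<And>x. f x \<le> B * indicator {-R..R} x" using cc_nonneg_bound[OF f] by metis
  have tr: "(\<integral>\<omega>. \<bar>min (L f \<omega>) T - c\<bar> \<partial>M) \<le> b" if T: "c \<le> T" "0 \<le> T" for T
  proof -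
    define \<phi> where "\<phi> z = \<bar>- ln (max (fst z) (exp (- T))) - c\<bar>" for z :: "real \<times> real"
    have c\<phi>: "continuous_on UNIV \<phi>"
    proof -
      have "0 < max u (exp (- T))" for u :: real by (simp add: less_max_iff_disj)
      then have "max u (exp (- T)) \<noteq> 0" for u :: real by (metis less_irrefl)
      then show ?thesis unfolding \<phi>_def by (intro continuous_intros) auto
    qed
    have \<phi>_eq: "\<phi> (exp (- x), y) = \<bar>min x T - c\<bar>" for x y
      unfolding \<phi>_def fst_conv ln_max_exp by simp
    have "(\<lambda>n. \<integral>\<theta>. \<bar>min (linear_stat_cbe n f \<theta>) T - c\<bar> \<partial>cbe_measure \<beta> n) \<longlonglongrightarrow> (\<integral>\<omega>. \<bar>min (L f \<omega>) T - c\<bar> \<partial>M)"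
      using tendsto_expectation[OF f f c\<phi>] unfolding \<phi>_eq .
    moreover have "\<forall>\<^sub>F n in sequentially. (\<integral>\<theta>. \<bar>min (linear_stat_cbe n f \<theta>) T - c\<bar> \<partial>cbe_measure \<beta> n) \<le> b"
      using dev eventually_circular_beta
    proof eventually_elim
      fix n assume 1: "(\<integral>\<theta>. \<bar>linear_stat_cbe n f \<theta> - c\<bar> \<partial>cbe_measure \<beta> n) \<le> b" and "circular_beta \<beta> n"
      then interpret circular_beta \<beta> n by simp
      have "(\<integral>\<theta>. \<bar>min (linear_stat_cbe n f \<theta>) T - c\<bar> \<partial>P) \<le> (\<integral>\<theta>. \<bar>linear_stat_cbe n f \<theta> - c\<bar> \<partial>P)"
      proof (rule integral_mono)
        show i: "integrable P (\<lambda>\<theta>. \<bar>linear_stat_cbe n f \<theta> - c\<bar>)" using expectation_linear_stat_cbe(2)[OF f BR] by simp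
        show p: "\<bar>min (linear_stat_cbe n f \<theta>) T - c\<bar> \<le> \<bar>linear_stat_cbe n f \<theta> - c\<bar>" for \<theta> using T by auto
        show "integrable P (\<lambda>\<theta>. \<bar>min (linear_stat_cbe n f \<theta>) T - c\<bar>)"
          by (rule Bochner_Integration.integrable_bound[OF i]) (use p in auto)
      qed
      with 1 show "(\<integral>\<theta>. \<bar>min (linear_stat_cbe n f \<theta>) T - c\<bar> \<partial>P) \<le> b" by linarith
    qed
    ultimately show ?thesis by (rule tendsto_upperbound) simp
  qed
  have "(\<integral>\<^sup>+\<omega>. ennreal \<bar>L f \<omega> - c\<bar> \<partial>M) = (\<integral>\<^sup>+\<omega>. liminf (\<lambda>k. ennreal \<bar>min (L f \<omega>) (\<bar>c\<bar> + real k) - c\<bar>) \<partial>M)"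
  proof (rule nn_integral_cong, rule sym, rule lim_imp_Liminf, simp, rule tendsto_eventually)
    fix \<omega>
    have "\<forall>\<^sub>F k in sequentially. L f \<omega> - \<bar>c\<bar> \<le> real k"
      by (rule eventually_compose_filterlim[OF eventually_ge_at_top filterlim_real_sequentially])
    then show "\<forall>\<^sub>F k in sequentially. ennreal \<bar>min (L f \<omega>) (\<bar>c\<bar> + real k) - c\<bar> = ennreal \<bar>L f \<omega> - c\<bar>"
      by eventually_elim simp
  qed
  also have "\<dots> \<le> liminf (\<lambda>k. \<integral>\<^sup>+\<omega>. ennreal \<bar>min (L f \<omega>) (\<bar>c\<bar> + real k) - c\<bar> \<partial>M)"
    by (rule nn_integral_liminf) measurable
  also have "\<dots> \<le> liminf (\<lambda>k. ennreal b)"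
  proof (intro Liminf_mono always_eventually allI)
    fix k
    have "integrable M (\<lambda>\<omega>. \<bar>min (L f \<omega>) (\<bar>c\<bar> + real k) - c\<bar>)"
    proof (rule integrable_M_bounded[where B = "2 * \<bar>c\<bar> + real k"])
      show "norm \<bar>min (L f \<omega>) (\<bar>c\<bar> + real k) - c\<bar> \<le> 2 * \<bar>c\<bar> + real k" for \<omega>
        using L_nonneg[OF f, of \<omega>] unfolding real_norm_def min_def by (simp split: if_splits) linarith+
    qed measurable
    then have "(\<integral>\<^sup>+\<omega>. ennreal \<bar>min (L f \<omega>) (\<bar>c\<bar> + real k) - c\<bar> \<partial>M) = ennreal (\<integral>\<omega>. \<bar>min (L f \<omega>) (\<bar>c\<bar> + real k) - c\<bar> \<partial>M)"
      by (intro nn_integral_eq_integral) auto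
    also have "\<dots> \<le> ennreal b" by (intro ennreal_leI tr) auto
    finally show "(\<integral>\<^sup>+\<omega>. ennreal \<bar>min (L f \<omega>) (\<bar>c\<bar> + real k) - c\<bar> \<partial>M) \<le> ennreal b" .
  qed
  also have "\<dots> = ennreal b" by (simp add: Liminf_const)
  finally show ?thesis .
qed

end

section \<open>The principal value sum\<close>

text \<open>Bernoulli's inequality for \<open>(a / b)^9\<close>; it measures the gap between two
  scales \<open>k^9\<close>.\<close>

lemma power9_increment:
  fixes a b :: real
  assumes "0 \<le> a" "a \<le> b" "0 < b"
  shows "b ^ 9 \<le> a ^ 9 + 9 * (b - a) * b ^ 8"
proof -
  have "1 + real 9 * (a / b - 1) \<le> (1 + (a / b - 1)) ^ 9"
    using assms by (intro Bernoulli_inequality) simp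
  then have "b ^ 9 * (1 + 9 * (a / b - 1)) \<le> b ^ 9 * (a / b) ^ 9"
    using assms by (intro mult_left_mono) auto
  also have "\<dots> = a ^ 9" using assms by (simp add: power_divide)
  also have "b ^ 9 * (1 + 9 * (a / b - 1)) = b ^ 9 - 9 * (b - a) * b ^ 8"
  proof -
    have "b ^ 9 = b * b ^ 8" by (simp flip: power_Suc)
    then show ?thesis using assms by (simp add: field_simps)
  qed
  finally show ?thesis by simp
qed

lemma linear_stat_trapezoid_bounds:
  assumes fin: "\<And>a b. finite (A \<inter> {a..b})"
  shows "real (card (A \<inter> {1..t - 1})) \<le> linear_stat (trapezoid 1 (t - 1)) A"
    and "linear_stat (trapezoid 1 (t - 1)) A \<le> real (card (A \<inter> {0<..t}))"
proof -
  have sub: "{x. trapezoid 1 (t - 1) x \<noteq> 0} \<subseteq> {-\<bar>t\<bar>..\<bar>t\<bar>}"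
  proof -
    have "0 < x \<and> x < t" if "trapezoid 1 (t - 1) x \<noteq> 0" for x
      using trapezoid_eq_0[of x 1 "t - 1"] that by auto
    then show ?thesis by fastforce
  qed
  have L: "linear_stat (trapezoid 1 (t - 1)) A = (\<Sum>x\<in>A \<inter> {-\<bar>t\<bar>..\<bar>t\<bar>}. trapezoid 1 (t - 1) x)"
    by (rule linear_stat_eq[OF fin sub])
  have "real (card (A \<inter> {1..t - 1})) = (\<Sum>x\<in>A \<inter> {1..t - 1}. trapezoid 1 (t - 1) x)"
    by (simp add: trapezoid_eq_1)
  also have "\<dots> \<le> linear_stat (trapezoid 1 (t - 1)) A"
    unfolding L by (intro sum_mono2 fin trapezoid_bounds) auto
  finally show "real (card (A \<inter> {1..t - 1})) \<le> linear_stat (trapezoid 1 (t - 1)) A" .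
  have "linear_stat (trapezoid 1 (t - 1)) A \<le> (\<Sum>x\<in>A \<inter> {-\<bar>t\<bar>..\<bar>t\<bar>}. of_bool (0 < x \<and> x \<le> t))"
    unfolding L
  proof (rule sum_mono)
    fix x show "trapezoid 1 (t - 1) x \<le> of_bool (0 < x \<and> x \<le> t)"
      using trapezoid_bounds(2)[of 1 "t - 1" x] trapezoid_eq_0[of x 1 "t - 1"] by (cases "0 < x \<and> x \<le> t") auto
  qed
  also have "\<dots> = real (card (A \<inter> {-\<bar>t\<bar>..\<bar>t\<bar>} \<inter> {x. 0 < x \<and> x \<le> t}))"
    using fin by (simp add: sum_of_bool_eq)
  also have "A \<inter> {-\<bar>t\<bar>..\<bar>t\<bar>} \<inter> {x. 0 < x \<and> x \<le> t} = A \<inter> {0<..t}" by auto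
  finally show "linear_stat (trapezoid 1 (t - 1)) A \<le> real (card (A \<inter> {0<..t}))" .
qed

text \<open>The scales \<open>k^9\<close> are sparse enough for the deviations, of order \<open>k^6\<close> in mean, to be summable
  after division by \<open>k^8\<close>, and dense enough for the gaps between them to be of order \<open>k^8\<close> as well.\<close>
lemma count_asymptotics:
  assumes fin: "\<And>a b. finite (A \<inter> {a..b})" and C: "0 \<le> C"
    and stat: "\<And>k::nat. 1 \<le> k \<Longrightarrow> \<bar>linear_stat (trapezoid 1 (real k ^ 9 - 1)) A - real k ^ 9 / (2 * pi)\<bar> \<le> C * real k ^ 8"
  obtains C' where "0 \<le> C'" "\<And>x. 1 \<le> x \<Longrightarrow> \<bar>real (card (A \<inter> {0<..x})) - x / (2 * pi)\<bar> \<le> C' * x powr (8 / 9)"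
proof -
  define N where "N x = real (card (A \<inter> {0<..x}))" for x
  have fin': "finite (A \<inter> {a<..b})" for a b by (rule finite_subset[OF _ fin[of a b]]) auto
  have mono: "N x \<le> N y" if "x \<le> y" for x y
    unfolding N_def using that by (intro of_nat_mono card_mono fin') auto
  \<comment> \<open>18 is 9 times a step of 2 in the scale, and \<open>3^8\<close> comes from
    \<open>k + 2 \<le> 3 k\<close>. \<open>N 1\<close> pays for points near 0, which the trapezoid
    does not count fully.\<close>
  define C' where "C' = N 1 + (C + 18) * 3 ^ 8"
  have C'0: "0 \<le> C'" unfolding C'_def N_def using C by simp
  have "\<bar>N x - x / (2 * pi)\<bar> \<le> C' * x powr (8 / 9)" if x: "1 \<le> x" for x
  proof -
    define y where "y = x powr (1 / 9)"
    have y1: "1 \<le> y" unfolding y_def using x by (intro ge_one_powr_ge_zero) auto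
    have y9: "y ^ 9 = x" unfolding y_def using x power_powr(1)[of x "1 / 9" 9] by simp
    have y8: "y ^ 8 = x powr (8 / 9)" unfolding y_def using x power_powr(1)[of x "1 / 9" 8] by simp
    define k where "k = nat \<lfloor>y\<rfloor>"
    have k: "1 \<le> k" "real k \<le> y" "y < real k + 1"
      unfolding k_def using y1 by (auto simp: le_nat_iff le_floor_iff)
    have k1: "1 \<le> real k" using k by simp
    have k9: "real k ^ 9 \<le> x" "x < (real k + 1) ^ 9"
      unfolding y9[symmetric] using k y1 by (auto intro!: power_mono power_strict_mono)
    have k8: "real k ^ 8 \<le> x powr (8 / 9)" unfolding y8[symmetric] using k by (intro power_mono) auto
    have k81: "1 \<le> real k ^ 8" using k1 by (rule one_le_power)
    have pi1: "z / (2 * pi) \<le> z" if "0 \<le> z" for z :: real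
    proof -
      have "z / (2 * pi) \<le> z / 1" using that pi_ge_two by (intro divide_left_mono) auto
      then show ?thesis by simp
    qed
    have "(real k + 2) ^ 8 \<le> (3 * real k) ^ 8" using k1 by (intro power_mono) auto
    then have k28: "(real k + 2) ^ 8 \<le> 3 ^ 8 * real k ^ 8" by (simp only: power_mult_distrib)
    have inc: "(real k + 2) ^ 9 \<le> real k ^ 9 + 18 * (3 ^ 8 * real k ^ 8)"
      using power9_increment[of "real k" "real k + 2"] k28 by simp
    have mon: "(real k + 1) ^ 9 \<le> (real k + 2) ^ 9" by (intro power_mono) auto
    have lower: "x / (2 * pi) - C' * real k ^ 8 \<le> N x"
    proof -
      have "x \<le> real k ^ 9 + 18 * (3 ^ 8 * real k ^ 8)" using k9(2) inc mon by linarith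
      then have "x / (2 * pi) \<le> (real k ^ 9 + 18 * (3 ^ 8 * real k ^ 8)) / (2 * pi)"
        by (intro divide_right_mono) auto
      also have "\<dots> \<le> real k ^ 9 / (2 * pi) + 18 * (3 ^ 8 * real k ^ 8)"
        unfolding add_divide_distrib by (intro add_left_mono pi1) simp
      also have "real k ^ 9 / (2 * pi) \<le> N (real k ^ 9) + C * real k ^ 8"
        using stat[OF k(1)] linear_stat_trapezoid_bounds(2)[OF fin, of "real k ^ 9"] unfolding N_def by linarith
      also have "N (real k ^ 9) \<le> N x" by (rule mono[OF k9(1)])
      finally have "x / (2 * pi) \<le> N x + (C + 18 * 3 ^ 8) * real k ^ 8" by (simp add: algebra_simps)
      also have "(C + 18 * 3 ^ 8) * real k ^ 8 \<le> C' * real k ^ 8"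
        using C k81 unfolding C'_def N_def by (intro mult_right_mono) auto
      finally show ?thesis by simp
    qed
    have upper: "N x \<le> x / (2 * pi) + C' * real k ^ 8"
    proof -
      \<comment> \<open>The trapezoid equals 1 only up to \<open>?t - 1\<close>; taking
        \<open>k + 2\<close> instead of \<open>k + 1\<close> leaves room for this unit.\<close>
      let ?t = "real (k + 2) ^ 9"
      have xt: "x \<le> ?t - 1"
      proof -
        have "(real k + 1) ^ 9 * 1 + 1 \<le> (real k + 1) * (real k + 2) ^ 8 + (real k + 2) ^ 8"
        proof (rule add_mono)
          have "(real k + 1) ^ 9 * 1 = (real k + 1) * (real k + 1) ^ 8" by (simp flip: power_Suc)
          also have "\<dots> \<le> (real k + 1) * (real k + 2) ^ 8" by (intro mult_left_mono power_mono) auto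
          finally show "(real k + 1) ^ 9 * 1 \<le> (real k + 1) * (real k + 2) ^ 8" .
          show "1 \<le> (real k + 2) ^ 8" by (intro one_le_power) simp
        qed
        also have "\<dots> = (real k + 2) * (real k + 2) ^ 8" by (simp add: algebra_simps)
        also have "\<dots> = ?t" by (simp add: add.commute flip: power_Suc)
        finally show ?thesis using k9 by simp
      qed
      have "A \<inter> {0<..x} \<subseteq> A \<inter> {0<..1} \<union> A \<inter> {1..?t - 1}" using xt by auto
      then have "card (A \<inter> {0<..x}) \<le> card (A \<inter> {0<..1} \<union> A \<inter> {1..?t - 1})"
        using fin fin' by (intro card_mono) auto
      also have "\<dots> \<le> card (A \<inter> {0<..1}) + card (A \<inter> {1..?t - 1})" by (rule card_Un_le)
      finally have "N x \<le> N 1 + real (card (A \<inter> {1..?t - 1}))" unfolding N_def by simp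
      also have "real (card (A \<inter> {1..?t - 1})) \<le> ?t / (2 * pi) + C * real (k + 2) ^ 8"
        using stat[of "k + 2"] linear_stat_trapezoid_bounds(1)[OF fin, of ?t] by linarith
      also have "?t / (2 * pi) \<le> (real k ^ 9 + 18 * (3 ^ 8 * real k ^ 8)) / (2 * pi)"
        using inc by (intro divide_right_mono) (simp_all add: add.commute)
      also have "\<dots> \<le> real k ^ 9 / (2 * pi) + 18 * (3 ^ 8 * real k ^ 8)"
        unfolding add_divide_distrib by (intro add_left_mono pi1) simp
      also have "real k ^ 9 / (2 * pi) \<le> x / (2 * pi)" using k9 by (intro divide_right_mono) auto
      also have "C * real (k + 2) ^ 8 \<le> C * (3 ^ 8 * real k ^ 8)" using k28 C by (intro mult_left_mono) (simp_all add: add.commute)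
      also have "N 1 \<le> N 1 * real k ^ 8" using k81 mult_left_mono[of 1 "real k ^ 8" "N 1"] unfolding N_def by simp
      finally show ?thesis unfolding C'_def by (simp add: algebra_simps)
    qed
    have "C' * real k ^ 8 \<le> C' * x powr (8 / 9)" using k8 C'0 by (intro mult_left_mono)
    with lower upper show ?thesis by linarith
  qed
  with C'0 show ?thesis using that unfolding N_def by blast
qed

section \<open>Convergence of the sharply truncated sums of one configuration\<close>

definition sharp_sum :: "real set \<Rightarrow> real \<Rightarrow> real" where
  "sharp_sum A r = (\<Sum>x\<in>{x\<in>A. \<bar>x\<bar> \<le> r}. 1 / x)"

text \<open>Counts in finite windows are used because \<open>signed_count\<close> over an infinite
  set would be 0 by convention; on a window the two notions agree.\<close>

definition imbalance :: "real set \<Rightarrow> real \<Rightarrow> real" where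
  "imbalance A r = real (card (A \<inter> {0<..r})) - real (card (uminus ` A \<inter> {0<..r}))"

lemma finite_window:
  assumes "\<And>a b. finite (A \<inter> {a..b::real})"
  shows "finite {x\<in>A. \<bar>x\<bar> \<le> r}"
  by (rule finite_subset[OF _ assms[of "-r" r]]) auto

lemma signed_count_eq_imbalance:
  assumes fin: "\<And>a b. finite (A \<inter> {a..b::real})" and "s \<le> R"
  shows "signed_count {x\<in>A. \<bar>x\<bar> \<le> R} (\<lambda>x. x) s = imbalance A s"
proof -
  note f = finite_window[OF fin, of R]
  have e1: "{x\<in>A. \<bar>x\<bar> \<le> R} \<inter> {x. 0 < x \<and> x \<le> s} = A \<inter> {0<..s}" using assms(2) by auto
  have e2: "uminus ` A \<inter> {0<..s} = uminus ` ({x\<in>A. \<bar>x\<bar> \<le> R} \<inter> {x. 0 < - x \<and> - x \<le> s})" using assms(2) by (auto simp: image_iff)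
  have "card (uminus ` A \<inter> {0<..s}) = card ({x\<in>A. \<bar>x\<bar> \<le> R} \<inter> {x. 0 < - x \<and> - x \<le> s})"
    unfolding e2 by (rule card_image) simp
  then show ?thesis
    unfolding signed_count_def sum_subtractf imbalance_def e1[symmetric] using f by simp
qed

lemma integral_powr_ninth_tail:
  fixes r R :: real
  assumes "1 \<le> r" "r \<le> R"
  shows "(\<integral>s. indicator {r..R} s *\<^sub>R (s powr (- (10 / 9))) \<partial>lborel) \<le> 9 * r powr (- (1 / 9))"
proof -
  have "(\<integral>s. indicator {r..R} s *\<^sub>R (s powr (- (10 / 9))) \<partial>lborel) = - 9 * R powr (- (1 / 9)) - (- 9 * r powr (- (1 / 9)))"
  proof (rule integral_FTC_atLeastAtMost[OF assms(2)])
    fix s assume "r \<le> s"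
    then have "0 < s" using assms by linarith
    then have "((\<lambda>s. - 9 * s powr (- (1 / 9))) has_real_derivative s powr (- (10 / 9))) (at s within {r..R})"
      by (auto intro!: derivative_eq_intros has_field_derivative_at_within[OF has_real_derivative_powr])
    then show "((\<lambda>s. - 9 * s powr (- (1 / 9))) has_vector_derivative s powr (- (10 / 9))) (at s within {r..R})"
      by (simp only: has_real_derivative_iff_has_vector_derivative)
  next
    show "continuous_on {r..R} (\<lambda>s. s powr (- (10 / 9)))"
      using assms by (intro continuous_intros) auto
  qed
  then show ?thesis by simp
qed

text \<open>Abel summation needs a kernel vanishing at \<open>R\<close>, so
  \<open>1 / s - 1 / R\<close> is used and the difference is corrected by the imbalances divided by
  \<open>R\<close>. The constant is 1 for the boundary term, 9 for the integral and 2 for the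
  correction.\<close>

lemma sharp_sum_diff_le:
  assumes fin: "\<And>a b. finite (A \<inter> {a..b})" and C: "0 \<le> C"
    and D: "\<And>x. 1 \<le> x \<Longrightarrow> \<bar>imbalance A x\<bar> \<le> C * x powr (8 / 9)"
    and r: "1 \<le> r" "r \<le> R"
  shows "\<bar>sharp_sum A R - sharp_sum A r\<bar> \<le> 12 * C * r powr (- (1 / 9))"
proof -
  define J where "J = {x\<in>A. \<bar>x\<bar> \<le> R}"
  have fJ: "finite J" unfolding J_def by (rule finite_window[OF fin])
  have D': "signed_count J (\<lambda>x. x) s = imbalance A s" if "s \<le> R" for s
    unfolding J_def by (rule signed_count_eq_imbalance[OF fin that])
  define k where "k s = 1 / s - 1 / R" for s :: real
  define K where "K a = (if r < a \<and> a \<le> R then k a else 0)" for a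
  have R0: "0 < R" using r by simp
  have powr_eq: "s powr (8 / 9) / s = s powr (- (1 / 9))" "s powr (8 / 9) / s\<^sup>2 = s powr (- (10 / 9))" if "0 < s" for s :: real
  proof -
    have "s powr (8 / 9) / s powr 1 = s powr (8 / 9 - 1)" by (simp only: powr_diff)
    then show "s powr (8 / 9) / s = s powr (- (1 / 9))" using that by simp
    have "s powr (8 / 9) / s powr 2 = s powr (8 / 9 - 2)" by (simp only: powr_diff)
    then show "s powr (8 / 9) / s\<^sup>2 = s powr (- (10 / 9))" using that by (simp add: powr_numeral)
  qed
  have tail: "\<bar>\<Sum>x\<in>J. K x - K (- x)\<bar> \<le> \<bar>k r\<bar> * \<bar>imbalance A r\<bar> +
     (\<integral>s. indicator {r..R} s *\<^sub>R (\<bar>- 1 / s\<^sup>2\<bar> * \<bar>signed_count J (\<lambda>x. x) s\<bar>) \<partial>lborel)"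
    unfolding K_def D'[OF r(2), symmetric]
  proof (rule abel_tail_bound)
    fix s assume "s \<in> {r..R}"
    then show "(k has_real_derivative - 1 / s\<^sup>2) (at s within {r..R})"
      unfolding k_def using r by (auto intro!: derivative_eq_intros simp: power2_eq_square)
  qed (use r in \<open>auto intro!: continuous_intros simp: k_def\<close>)
  have t1: "\<bar>k r\<bar> * \<bar>imbalance A r\<bar> \<le> C * r powr (- (1 / 9))"
  proof -
    have "1 / R \<le> 1 / r" using r by (intro divide_left_mono) auto
    moreover have "0 \<le> 1 / R" using R0 by simp
    ultimately have "\<bar>k r\<bar> \<le> 1 / r" unfolding k_def by linarith
    then have "\<bar>k r\<bar> * \<bar>imbalance A r\<bar> \<le> 1 / r * (C * r powr (8 / 9))" using r by (intro mult_mono D) auto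
    also have "\<dots> = C * (r powr (8 / 9) / r)" by simp
    finally show ?thesis using powr_eq(1)[of r] r by simp
  qed
  have t2: "(\<integral>s. indicator {r..R} s *\<^sub>R (\<bar>- 1 / s\<^sup>2\<bar> * \<bar>signed_count J (\<lambda>x. x) s\<bar>) \<partial>lborel) \<le> 9 * C * r powr (- (1 / 9))"
  proof -
    have "(\<integral>s. indicator {r..R} s *\<^sub>R (\<bar>- 1 / s\<^sup>2\<bar> * \<bar>signed_count J (\<lambda>x. x) s\<bar>) \<partial>lborel) \<le> (\<integral>s. C * (indicator {r..R} s *\<^sub>R (s powr (- (10 / 9)))) \<partial>lborel)"
    proof (rule integral_mono_AE')
      have "continuous_on {r..R} (\<lambda>s. s powr (- (10 / 9)))" using r by (intro continuous_intros) auto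
      from borel_integrable_atLeastAtMost'[OF this]
      show "integrable lborel (\<lambda>s. C * (indicator {r..R} s *\<^sub>R (s powr (- (10 / 9)))))"
        unfolding set_integrable_def by (rule integrable_mult_right)
      show "AE s in lborel. indicator {r..R} s *\<^sub>R (\<bar>- 1 / s\<^sup>2\<bar> * \<bar>signed_count J (\<lambda>x. x) s\<bar>) \<le> C * (indicator {r..R} s *\<^sub>R (s powr (- (10 / 9))))"
      proof (rule AE_I2)
        fix s :: real
        show "indicator {r..R} s *\<^sub>R (\<bar>- 1 / s\<^sup>2\<bar> * \<bar>signed_count J (\<lambda>x. x) s\<bar>) \<le> C * (indicator {r..R} s *\<^sub>R (s powr (- (10 / 9))))"
        proof (cases "s \<in> {r..R}")
          case True
          then have s: "1 \<le> s" "s \<le> R" using r by auto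
          have "\<bar>- 1 / s\<^sup>2\<bar> * \<bar>imbalance A s\<bar> \<le> 1 / s\<^sup>2 * (C * s powr (8 / 9))"
            by (intro mult_mono D s) auto
          also have "\<dots> = C * (s powr (8 / 9) / s\<^sup>2)" by simp
          also have "\<dots> = C * s powr (- (10 / 9))" using powr_eq(2)[of s] s by simp
          finally show ?thesis using True D'[OF s(2)] by simp
        qed simp
      qed
      show "AE s in lborel. 0 \<le> C * (indicator {r..R} s *\<^sub>R (s powr (- (10 / 9))))" using C by simp
    qed
    also have "\<dots> = C * (\<integral>s. indicator {r..R} s *\<^sub>R (s powr (- (10 / 9))) \<partial>lborel)" by (rule integral_mult_right_zero)
    also have "\<dots> \<le> C * (9 * r powr (- (1 / 9)))" using r C by (intro mult_left_mono integral_powr_ninth_tail)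
    finally show ?thesis by simp
  qed
  have split: "(\<Sum>x\<in>J. K x - K (- x)) = sharp_sum A R - sharp_sum A r - (imbalance A R - imbalance A r) / R"
  proof -
    have "sharp_sum A r = (\<Sum>x\<in>J. if \<bar>x\<bar> \<le> r then 1 / x else 0)"
    proof -
      have "{x\<in>A. \<bar>x\<bar> \<le> r} = J \<inter> {x. \<bar>x\<bar> \<le> r}" unfolding J_def using r by auto
      then show ?thesis unfolding sharp_sum_def using fJ by (simp add: sum.inter_restrict)
    qed
    moreover have "sharp_sum A R = (\<Sum>x\<in>J. 1 / x)" unfolding sharp_sum_def J_def ..
    moreover have "(imbalance A R - imbalance A r) / R = (\<Sum>x\<in>J. ((of_bool (0 < x \<and> x \<le> R) - of_bool (0 < - x \<and> - x \<le> R)) - (of_bool (0 < x \<and> x \<le> r) - of_bool (0 < - x \<and> - x \<le> r))) / R)"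
      unfolding D'[OF order_refl, symmetric] D'[OF r(2), symmetric] signed_count_def by (simp only: sum_subtractf[symmetric] sum_divide_distrib)
    moreover have "K x - K (- x) = 1 / x - (if \<bar>x\<bar> \<le> r then 1 / x else 0) - ((of_bool (0 < x \<and> x \<le> R) - of_bool (0 < - x \<and> - x \<le> R)) - (of_bool (0 < x \<and> x \<le> r) - of_bool (0 < - x \<and> - x \<le> r))) / R" if "x \<in> J" for x
    proof -
      have "\<bar>x\<bar> \<le> R" using that unfolding J_def by simp
      then show ?thesis unfolding K_def k_def using r by auto
    qed
    ultimately show ?thesis by (simp add: sum_subtractf)
  qed
  have t3: "\<bar>(imbalance A R - imbalance A r) / R\<bar> \<le> 2 * C * r powr (- (1 / 9))"
  proof -
    have "\<bar>imbalance A R\<bar> / R \<le> C * R powr (8 / 9) / R" using D[of R] r R0 by (intro divide_right_mono) auto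
    also have "\<dots> = C * R powr (- (1 / 9))" by (simp only: powr_eq(1)[OF R0, symmetric] times_divide_eq_right)
    also have "\<dots> \<le> C * r powr (- (1 / 9))" using r C by (intro mult_left_mono powr_mono2') auto
    finally have a: "\<bar>imbalance A R\<bar> / R \<le> C * r powr (- (1 / 9))" .
    have "\<bar>imbalance A r\<bar> / R \<le> \<bar>imbalance A r\<bar> / r" using r by (intro divide_left_mono) auto
    also have "\<dots> \<le> C * r powr (8 / 9) / r" using D[of r] r by (intro divide_right_mono) auto
    also have "\<dots> = C * r powr (- (1 / 9))"
      using r by (simp only: powr_eq(1)[of r, symmetric] times_divide_eq_right)
    finally have b: "\<bar>imbalance A r\<bar> / R \<le> C * r powr (- (1 / 9))" .
    have "\<bar>(imbalance A R - imbalance A r) / R\<bar> \<le> \<bar>imbalance A R\<bar> / R + \<bar>imbalance A r\<bar> / R"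
      unfolding abs_divide add_divide_distrib[symmetric] using R0 by (simp add: divide_right_mono abs_triangle_ineq4)
    with a b show ?thesis by linarith
  qed
  from tail t1 t2 t3 split show ?thesis by linarith
qed

text \<open>The bound does not depend on the larger cut-off. It makes the values at integers a
  Cauchy sequence, and letting the larger cut-off run to infinity along the integers extends the
  limit to real \<open>r\<close>.\<close>

lemma sharp_sum_convergent:
  assumes fin: "\<And>a b. finite (A \<inter> {a..b})" and C: "0 \<le> C"
    and D: "\<And>x. 1 \<le> x \<Longrightarrow> \<bar>imbalance A x\<bar> \<le> C * x powr (8 / 9)"
  obtains S where "(sharp_sum A \<longlongrightarrow> S) at_top"
proof -
  have lim0: "((\<lambda>r::real. 12 * C * r powr (- (1 / 9))) \<longlongrightarrow> 0) at_top"
    using tendsto_mult_right_zero[OF tendsto_neg_powr[OF _ filterlim_ident], of "- (1 / 9)" "12 * C"] by simp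
  have "Cauchy (\<lambda>n. sharp_sum A (real n))"
  proof (rule metric_CauchyI)
    fix e :: real assume "0 < e"
    then have "\<forall>\<^sub>F r in at_top. 12 * C * r powr (- (1 / 9)) < e / 2" by (intro order_tendstoD(2)[OF lim0]) simp
    from eventually_conj[OF eventually_compose_filterlim[OF this filterlim_real_sequentially] eventually_ge_at_top[of 1]]
    have "\<forall>\<^sub>F n in sequentially. 12 * C * (real n) powr (- (1 / 9)) < e / 2 \<and> 1 \<le> n" .
    then obtain n where n: "12 * C * (real n) powr (- (1 / 9)) < e / 2" "1 \<le> n"
      using eventually_happens'[OF sequentially_bot] by blast
    have "\<bar>sharp_sum A (real m) - sharp_sum A (real n)\<bar> < e / 2" if "n \<le> m" for m
      using sharp_sum_diff_le[OF fin C D, of "real n" "real m"] n that by simp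
    then have "dist (sharp_sum A (real m)) (sharp_sum A (real m')) < e" if "n \<le> m" "n \<le> m'" for m m'
      using that unfolding dist_real_def by (smt (verit) field_sum_of_halves)
    then show "\<exists>M. \<forall>m\<ge>M. \<forall>n\<ge>M. dist (sharp_sum A (real m)) (sharp_sum A (real n)) < e" by blast
  qed
  then obtain S where S: "(\<lambda>n. sharp_sum A (real n)) \<longlonglongrightarrow> S" using Cauchy_convergent convergent_def by blast
  have "\<forall>\<^sub>F r in at_top. norm (sharp_sum A r - S) \<le> 12 * C * r powr (- (1 / 9))"
    using eventually_ge_at_top[of 1]
  proof eventually_elim
    fix r :: real assume r: "1 \<le> r"
    have "(\<lambda>n. \<bar>sharp_sum A (real n) - sharp_sum A r\<bar>) \<longlonglongrightarrow> \<bar>S - sharp_sum A r\<bar>"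
      by (intro tendsto_intros S)
    moreover have "\<forall>\<^sub>F n in sequentially. r \<le> real n"
      by (rule eventually_compose_filterlim[OF eventually_ge_at_top filterlim_real_sequentially])
    then have "\<forall>\<^sub>F n in sequentially. \<bar>sharp_sum A (real n) - sharp_sum A r\<bar> \<le> 12 * C * r powr (- (1 / 9))"
      by eventually_elim (rule sharp_sum_diff_le[OF fin C D r])
    ultimately have "\<bar>S - sharp_sum A r\<bar> \<le> 12 * C * r powr (- (1 / 9))"
      by (rule tendsto_upperbound) simp
    then show "norm (sharp_sum A r - S) \<le> 12 * C * r powr (- (1 / 9))" by (simp add: abs_minus_commute)
  qed
  from Lim_null_comparison[OF this lim0] have "((\<lambda>r. sharp_sum A r - S) \<longlongrightarrow> 0) at_top" .
  then have "(sharp_sum A \<longlongrightarrow> S) at_top" by (rule LIM_zero_cancel)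
  then show ?thesis by (rule that)
qed

text \<open>For positive points beyond the gap the kernel is \<open>2 / x\<close> up to
  \<open>2 r\<close>, minus \<open>1 / x\<close> up to \<open>r\<close>, minus \<open>1 / r\<close>
  between \<open>r\<close> and \<open>2 r\<close>. If the sharp sums converge to \<open>S\<close>
  and the imbalance is \<open>o(r)\<close>, this tends to \<open>2 S - S = S\<close>, so the
  continuous truncation has the same limit as the sharp one.\<close>

lemma pv_statistic_eq:
  assumes fin: "\<And>a b. finite (A \<inter> {a..b})" and eps: "0 < \<epsilon>" "\<epsilon> \<le> r"
    and gap: "\<And>x. x \<in> A \<Longrightarrow> x \<noteq> 0 \<Longrightarrow> \<epsilon> \<le> \<bar>x\<bar>"
  shows "linear_stat (pv_kernel \<epsilon> r) A - linear_stat (\<lambda>x. pv_kernel \<epsilon> r (- x)) A =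
    2 * sharp_sum A (2 * r) - sharp_sum A r - (imbalance A (2 * r) - imbalance A r) / r"
proof -
  define J where "J = {x\<in>A. \<bar>x\<bar> \<le> 2 * r}"
  have fJ: "finite J" unfolding J_def by (rule finite_window[OF fin])
  have J_eq: "J = A \<inter> {- (2 * r)..2 * r}" unfolding J_def by auto
  have r0: "0 < r" using eps by simp
  have "{x. pv_kernel \<epsilon> r x \<noteq> 0} \<subseteq> {- (2 * r)..2 * r}" "{x. pv_kernel \<epsilon> r (- x) \<noteq> 0} \<subseteq> {- (2 * r)..2 * r}"
  proof -
    have "0 \<le> x \<and> x \<le> 2 * r" if "pv_kernel \<epsilon> r x \<noteq> 0" for x
      using pv_kernel_eq_0[of \<epsilon> x r] pv_kernel_eq_0'[of \<epsilon> r x] eps that by linarith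
    then show "{x. pv_kernel \<epsilon> r x \<noteq> 0} \<subseteq> {- (2 * r)..2 * r}" "{x. pv_kernel \<epsilon> r (- x) \<noteq> 0} \<subseteq> {- (2 * r)..2 * r}"
      using r0 by fastforce+
  qed
  then have L: "linear_stat (pv_kernel \<epsilon> r) A - linear_stat (\<lambda>x. pv_kernel \<epsilon> r (- x)) A = (\<Sum>x\<in>J. pv_kernel \<epsilon> r x - pv_kernel \<epsilon> r (- x))"
    unfolding J_eq sum_subtractf using linear_stat_eq[OF fin] by simp
  have "sharp_sum A r = (\<Sum>x\<in>J. if \<bar>x\<bar> \<le> r then 1 / x else 0)"
  proof -
    have "{x\<in>A. \<bar>x\<bar> \<le> r} = J \<inter> {x. \<bar>x\<bar> \<le> r}" unfolding J_def using r0 by auto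
    then show ?thesis unfolding sharp_sum_def using fJ by (simp add: sum.inter_restrict)
  qed
  moreover have "sharp_sum A (2 * r) = (\<Sum>x\<in>J. 1 / x)" unfolding sharp_sum_def J_def ..
  moreover have "(imbalance A (2 * r) - imbalance A r) / r = (\<Sum>x\<in>J. ((of_bool (0 < x \<and> x \<le> 2 * r) - of_bool (0 < - x \<and> - x \<le> 2 * r)) - (of_bool (0 < x \<and> x \<le> r) - of_bool (0 < - x \<and> - x \<le> r))) / r)"
  proof -
    have "imbalance A (2 * r) = signed_count J (\<lambda>x. x) (2 * r)" "imbalance A r = signed_count J (\<lambda>x. x) r"
      unfolding J_def using signed_count_eq_imbalance[OF fin] r0 by simp_all
    then show ?thesis
      unfolding signed_count_def by (simp only: sum_subtractf[symmetric] sum_divide_distrib)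
  qed
  moreover have "pv_kernel \<epsilon> r x - pv_kernel \<epsilon> r (- x) = 2 * (1 / x) - (if \<bar>x\<bar> \<le> r then 1 / x else 0) - ((of_bool (0 < x \<and> x \<le> 2 * r) - of_bool (0 < - x \<and> - x \<le> 2 * r)) - (of_bool (0 < x \<and> x \<le> r) - of_bool (0 < - x \<and> - x \<le> r))) / r"
    if x: "x \<in> J" for x
  proof -
    have pos: "pv_kernel \<epsilon> r y = 2 * (1 / y) - (if y \<le> r then 1 / y else 0) - (1 - of_bool (y \<le> r)) / r" "pv_kernel \<epsilon> r (- y) = 0" if "\<epsilon> \<le> y" "y \<le> 2 * r" for y
    proof -
      show "pv_kernel \<epsilon> r (- y) = 0" using that eps by (intro pv_kernel_eq_0) auto
      show "pv_kernel \<epsilon> r y = 2 * (1 / y) - (if y \<le> r then 1 / y else 0) - (1 - of_bool (y \<le> r)) / r"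
        using pv_kernel_inner[OF eps(1) that(1), of r] pv_kernel_outer[OF eps _ that(2)] by auto
    qed
    have x2: "\<bar>x\<bar> \<le> 2 * r" "x \<noteq> 0 \<Longrightarrow> \<epsilon> \<le> \<bar>x\<bar>" using x gap unfolding J_def by auto
    consider "x = 0" | "0 < x" | "x < 0" by linarith
    then show ?thesis
    proof cases
      \<comment> \<open>A point at the origin contributes 0 everywhere, as
        \<open>1 / 0 = 0\<close>.\<close>
      case 1 then show ?thesis using r0 by simp
    next
      case 2 then show ?thesis using pos[of x] x2 by auto
    next
      case 3 then show ?thesis using pos[of "- x"] x2 by (auto simp: diff_divide_distrib)
    qed
  qed
  ultimately show ?thesis unfolding L by (simp add: sum_subtractf sum_distrib_left)
qed

section \<open>From characteristic functions to the law of the limit\<close>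

lemma cis_cos_sin: "cis x = of_real (cos x) + \<i> * of_real (sin x)"
  by (simp add: complex_eq_iff)

lemma integral_cis:
  fixes u :: "'c \<Rightarrow> real"
  assumes N: "prob_space N" and u [measurable]: "u \<in> borel_measurable N"
  shows "(\<integral>x. cis (u x) \<partial>N) = of_real (\<integral>x. cos (u x) \<partial>N) + \<i> * of_real (\<integral>x. sin (u x) \<partial>N)"
proof -
  interpret prob_space N by fact
  have c: "integrable N (\<lambda>x. cos (u x))" "integrable N (\<lambda>x. sin (u x))"
    by (rule integrable_const_bound[where B = 1]; simp)+
  show ?thesis unfolding cis_cos_sin using c by simp
qed

lemma char_eq_integral_cis: "char N t = (\<integral>x. cis (t * x) \<partial>N)"
  unfolding char_def by (simp add: cis_conv_exp)

lemma trapezoid_reflect: "trapezoid a b (- x) = trapezoid (- b) (- a) x"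
  unfolding trapezoid_def by (simp add: min.commute add.commute)

lemma cc_nonneg_trapezoid: "cc_nonneg (trapezoid a b)"
proof -
  have "x \<in> {a - 1..b + 1}" if "trapezoid a b x \<noteq> 0" for x
  proof -
    have "x \<in> {a - 1<..<b + 1}" using trapezoid_eq_0[of x a b] that by blast
    then show ?thesis by simp
  qed
  then have "{x. trapezoid a b x \<noteq> 0} \<subseteq> {a - 1..b + 1}" by blast
  then show ?thesis
    unfolding cc_nonneg_def by (auto intro: continuous_on_trapezoid trapezoid_bounds bounded_subset[OF bounded_closed_interval])
qed

lemma linear_stat_reflect: "linear_stat (\<lambda>x. f (- x)) A = linear_stat f (uminus ` A)"
proof -
  have "{x \<in> uminus ` A. f x \<noteq> 0} = uminus ` {x \<in> A. f (- x) \<noteq> 0}" by auto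
  then show ?thesis unfolding linear_stat_def by (simp add: sum.reindex)
qed

context sine_process
begin

text \<open>With \<epsilon> and \<open>q\<close> fixed, \<open>n\<close> tends to infinity and the
  error \<open>q^3 / (8 n)\<close> disappears. Real and imaginary parts are treated separately
  because the limit theorem is for real bounded functions.\<close>

lemma pv_characteristic_function:
  assumes q: "1 \<le> q" and eps: "0 < \<epsilon>" "\<epsilon> \<le> q ^ 3" and xi: "0 < \<xi>"
  defines "f \<equiv> pv_kernel \<epsilon> (q ^ 3)"
  shows "cmod ((\<integral>\<omega>. cis (\<xi> * (L f \<omega> - L (\<lambda>x. f (- x)) \<omega>)) \<partial>M) - exp (- \<xi> / 2)) \<le> 2 * \<epsilon> + \<xi> * (64 * count_bound \<beta> / q)"
proof -
  define g where "g x = f (- x)" for x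
  have f: "cc_nonneg f" and g: "cc_nonneg g"
    unfolding g_def f_def using cc_nonneg_pv_kernel[OF eps] by auto
  have c: "continuous_on UNIV (\<lambda>x. cos (\<xi> * x))" "continuous_on UNIV (\<lambda>x. sin (\<xi> * x))"
    by (intro continuous_intros)+
  let ?X = "\<lambda>n \<theta>. linear_stat_cbe n f \<theta> - linear_stat_cbe n g \<theta>"
  have "(\<lambda>n. complex_of_real (\<integral>\<theta>. cos (\<xi> * ?X n \<theta>) \<partial>cbe_measure \<beta> n) + \<i> * complex_of_real (\<integral>\<theta>. sin (\<xi> * ?X n \<theta>) \<partial>cbe_measure \<beta> n)) \<longlonglongrightarrow>
     complex_of_real (\<integral>\<omega>. cos (\<xi> * (L f \<omega> - L g \<omega>)) \<partial>M) + \<i> * complex_of_real (\<integral>\<omega>. sin (\<xi> * (L f \<omega> - L g \<omega>)) \<partial>M)"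
    by (intro tendsto_intros tendsto_expectation_difference[OF f g c(1)] tendsto_expectation_difference[OF f g c(2)]) auto
  moreover have "(\<integral>\<omega>. cis (\<xi> * (L f \<omega> - L g \<omega>)) \<partial>M) =
      complex_of_real (\<integral>\<omega>. cos (\<xi> * (L f \<omega> - L g \<omega>)) \<partial>M) + \<i> * complex_of_real (\<integral>\<omega>. sin (\<xi> * (L f \<omega> - L g \<omega>)) \<partial>M)"
    using measurable_L[OF f] measurable_L[OF g] by (intro integral_cis prob_M) simp
  ultimately have lim: "(\<lambda>n. complex_of_real (\<integral>\<theta>. cos (\<xi> * ?X n \<theta>) \<partial>cbe_measure \<beta> n) + \<i> * complex_of_real (\<integral>\<theta>. sin (\<xi> * ?X n \<theta>) \<partial>cbe_measure \<beta> n)) \<longlonglongrightarrow>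
     (\<integral>\<omega>. cis (\<xi> * (L f \<omega> - L g \<omega>)) \<partial>M)" by (simp only:)
  have "\<forall>\<^sub>F n in sequentially. 2 * q ^ 3 / pi \<le> real n"
    by (rule eventually_compose_filterlim[OF eventually_ge_at_top filterlim_real_sequentially])
  then have ev: "\<forall>\<^sub>F n in sequentially. cmod (complex_of_real (\<integral>\<theta>. cos (\<xi> * ?X n \<theta>) \<partial>cbe_measure \<beta> n) + \<i> * complex_of_real (\<integral>\<theta>. sin (\<xi> * ?X n \<theta>) \<partial>cbe_measure \<beta> n) - exp (- \<xi> / 2))
     \<le> 2 * \<epsilon> + \<xi> * (q ^ 3 / (8 * real n) + 64 * count_bound \<beta> / q)"
    using eventually_circular_beta eventually_ge_at_top[of 2]
  proof eventually_elim
    fix n assume n: "2 * q ^ 3 / pi \<le> real n" "circular_beta \<beta> n" "2 \<le> n"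
    interpret circular_beta \<beta> n by fact
    have "2 * q ^ 3 \<le> pi * n" using n(1) by (simp add: field_simps)
    from cis_pv_statistic_error[OF n(3) q this eps xi]
    have "cmod ((\<integral>\<theta>. cis (\<xi> * ?X n \<theta>) \<partial>P) - exp (- \<xi> / 2)) \<le> 2 * \<epsilon> + \<xi> * (q ^ 3 / (8 * real n) + 64 * count_bound \<beta> / q)"
      unfolding linear_stat_cbe_def g_def f_def .
    moreover have "(\<integral>\<theta>. cis (\<xi> * ?X n \<theta>) \<partial>P) = complex_of_real (\<integral>\<theta>. cos (\<xi> * ?X n \<theta>) \<partial>P) + \<i> * complex_of_real (\<integral>\<theta>. sin (\<xi> * ?X n \<theta>) \<partial>P)"
      using measurable_linear_stat_cbe[OF f, of n] measurable_linear_stat_cbe[OF g, of n] by (intro integral_cis prob_space_cbe) simp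
    ultimately show "cmod (complex_of_real (\<integral>\<theta>. cos (\<xi> * ?X n \<theta>) \<partial>P) + \<i> * complex_of_real (\<integral>\<theta>. sin (\<xi> * ?X n \<theta>) \<partial>P) - exp (- \<xi> / 2))
     \<le> 2 * \<epsilon> + \<xi> * (q ^ 3 / (8 * real n) + 64 * count_bound \<beta> / q)" by simp
  qed
  have "(\<lambda>n. q ^ 3 / 8 * (1 / real n)) \<longlonglongrightarrow> q ^ 3 / 8 * 0"
    by (intro tendsto_mult tendsto_const lim_1_over_n)
  then have "(\<lambda>n. 2 * \<epsilon> + \<xi> * (q ^ 3 / (8 * real n) + 64 * count_bound \<beta> / q)) \<longlonglongrightarrow> 2 * \<epsilon> + \<xi> * (0 + 64 * count_bound \<beta> / q)"
    by (intro tendsto_intros) simp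
  moreover have "(\<lambda>n. cmod (complex_of_real (\<integral>\<theta>. cos (\<xi> * ?X n \<theta>) \<partial>cbe_measure \<beta> n) + \<i> * complex_of_real (\<integral>\<theta>. sin (\<xi> * ?X n \<theta>) \<partial>cbe_measure \<beta> n) - exp (- \<xi> / 2)))
     \<longlonglongrightarrow> cmod ((\<integral>\<omega>. cis (\<xi> * (L f \<omega> - L g \<omega>)) \<partial>M) - exp (- \<xi> / 2))"
    by (intro tendsto_intros lim)
  ultimately have "cmod ((\<integral>\<omega>. cis (\<xi> * (L f \<omega> - L g \<omega>)) \<partial>M) - exp (- \<xi> / 2)) \<le> 2 * \<epsilon> + \<xi> * (0 + 64 * count_bound \<beta> / q)"
    using ev by (intro tendsto_le[OF sequentially_bot])
  then show ?thesis unfolding g_def by simp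
qed

text \<open>The deviation theorem with \<open>p = k^3\<close>, so that the window is
  \<open>p^3 = k^9\<close> and the error \<open>p^2 = k^6\<close>; its conditions on
  \<open>n\<close> hold eventually.\<close>

lemma nn_integral_trapezoid_deviation:
  assumes st: "t - s = real k ^ 9" and k: "1 \<le> k"
  shows "(\<integral>\<^sup>+\<omega>. ennreal \<bar>L (trapezoid (s + 1) (t - 1)) \<omega> - real k ^ 9 / (2 * pi)\<bar> \<partial>M) \<le> ennreal (count_bound \<beta> * real k ^ 6)"
proof (rule nn_integral_L_deviation_le[OF cc_nonneg_trapezoid])
  show "0 \<le> count_bound \<beta> * real k ^ 6"
    unfolding count_bound_def using herglotz_bound_pos[OF beta] by simp
  have "\<forall>\<^sub>F n in sequentially. \<bar>s\<bar> + \<bar>t\<bar> + real k ^ 3 + real k ^ 6 + 1 \<le> real n"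
    by (rule eventually_compose_filterlim[OF eventually_ge_at_top filterlim_real_sequentially])
  then show "\<forall>\<^sub>F n in sequentially. (\<integral>\<theta>. \<bar>linear_stat_cbe n (trapezoid (s + 1) (t - 1)) \<theta> - real k ^ 9 / (2 * pi)\<bar> \<partial>cbe_measure \<beta> n) \<le> count_bound \<beta> * real k ^ 6"
    using eventually_circular_beta
  proof eventually_elim
    fix n assume n: "\<bar>s\<bar> + \<bar>t\<bar> + real k ^ 3 + real k ^ 6 + 1 \<le> real n" and "circular_beta \<beta> n"
    then interpret circular_beta \<beta> n by simp
    have e: "(real k ^ 3) ^ 3 = real k ^ 9" "(real k ^ 3)\<^sup>2 = real k ^ 6" by (simp_all flip: power_mult)
    have pn: "real n \<le> pi * n" using pi_ge_two by (intro order_trans[OF _ mult_right_mono[of 1 pi "real n"]]) auto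
    have k0: "0 \<le> real k ^ 3" "0 \<le> real k ^ 6" by simp_all
    have "(\<integral>\<theta>. \<bar>(\<Sum>j<n. trapezoid (s + 1) (t - 1) (real n * \<theta> j)) - (real k ^ 3) ^ 3 / (2 * pi)\<bar> \<partial>P) \<le> count_bound \<beta> * (real k ^ 3)\<^sup>2"
    proof (rule linear_statistic_deviation[where s = s and t = t])
      show "trapezoid (s + 1) (t - 1) x \<le> indicator {s..t} x" for x
        using trapezoid_bounds(2)[of "s + 1" "t - 1" x] trapezoid_eq_0[of x "s + 1" "t - 1"] by (cases "x \<in> {s..t}") auto
      show "t - s = (real k ^ 3) ^ 3" unfolding e by (rule st)
      show "- (pi * n) \<le> s" "t \<le> pi * n" "real k ^ 3 \<le> real n" "(real k ^ 3)\<^sup>2 < pi * n"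
        unfolding e using n pn k0 by linarith+
      show "1 \<le> real k ^ 3" using k by (intro one_le_power) simp
    qed simp_all
    then show "(\<integral>\<theta>. \<bar>linear_stat_cbe n (trapezoid (s + 1) (t - 1)) \<theta> - real k ^ 9 / (2 * pi)\<bar> \<partial>P) \<le> count_bound \<beta> * real k ^ 6"
      unfolding linear_stat_cbe_def e .
  qed
qed

text \<open>Divided by \<open>(k + 1)^8\<close> the means are summable like
  \<open>(k + 1)^(-2)\<close>, so the series of weighted deviations is almost surely finite; its
  value serves as the random constant \<open>C\<close>.\<close>

lemma AE_deviation_bound:
  assumes Y: "\<And>k. Y k \<in> borel_measurable M"
    and b: "\<And>k. (\<integral>\<^sup>+\<omega>. ennreal \<bar>Y k \<omega>\<bar> \<partial>M) \<le> ennreal (B * real (Suc k) ^ 6)" and B: "0 \<le> B"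
  shows "AE \<omega> in M. \<exists>C\<ge>0. \<forall>k. \<bar>Y k \<omega>\<bar> \<le> C * real (Suc k) ^ 8"
proof -
  note [measurable] = Y
  have "(\<integral>\<^sup>+\<omega>. (\<Sum>k. ennreal (\<bar>Y k \<omega>\<bar> / real (Suc k) ^ 8)) \<partial>M) = (\<Sum>k. \<integral>\<^sup>+\<omega>. ennreal (\<bar>Y k \<omega>\<bar> / real (Suc k) ^ 8) \<partial>M)"
    by (rule nn_integral_suminf) measurable
  also have "\<dots> \<le> (\<Sum>k. ennreal (B * (1 / real (Suc k) ^ 2)))"
  proof (rule suminf_le)
    fix k
    have k: "0 < real (Suc k) ^ 8" by simp
    have "(\<integral>\<^sup>+\<omega>. ennreal (\<bar>Y k \<omega>\<bar> / real (Suc k) ^ 8) \<partial>M) = (\<integral>\<^sup>+\<omega>. ennreal (1 / real (Suc k) ^ 8) * ennreal \<bar>Y k \<omega>\<bar> \<partial>M)"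
      by (intro nn_integral_cong) (simp flip: ennreal_mult)
    also have "\<dots> = ennreal (1 / real (Suc k) ^ 8) * (\<integral>\<^sup>+\<omega>. ennreal \<bar>Y k \<omega>\<bar> \<partial>M)"
      by (rule nn_integral_cmult) measurable
    also have "\<dots> \<le> ennreal (1 / real (Suc k) ^ 8) * ennreal (B * real (Suc k) ^ 6)"
      by (intro mult_left_mono b) simp
    also have "\<dots> = ennreal (1 / real (Suc k) ^ 8 * (B * real (Suc k) ^ 6))"
      using B by (intro ennreal_mult[symmetric]) auto
    also have "1 / real (Suc k) ^ 8 * (B * real (Suc k) ^ 6) = B * (1 / real (Suc k) ^ 2)"
    proof -
      have "1 / y ^ 8 * (B * y ^ 6) = B * (1 / y ^ 2)" if "0 < y" for y :: real
      proof -
        have e: "y ^ 8 = y ^ 6 * y ^ 2" by (simp flip: power_add)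
        have "1 / y ^ 8 * (B * y ^ 6) = (y ^ 6 * B) / (y ^ 6 * y ^ 2)"
          by (simp only: e mult_1 mult_1_right times_divide_eq_left times_divide_eq_right mult.commute)
        also have "\<dots> = B / y ^ 2" using that by (intro mult_divide_mult_cancel_left) simp
        finally show ?thesis by simp
      qed
      then show ?thesis by simp
    qed
    finally show "(\<integral>\<^sup>+\<omega>. ennreal (\<bar>Y k \<omega>\<bar> / real (Suc k) ^ 8) \<partial>M) \<le> ennreal (B * (1 / real (Suc k) ^ 2))" .
  qed auto
  also have "\<dots> < \<top>"
  proof -
    have "summable (\<lambda>k. 1 / real (Suc k) ^ 2)"
      using sums_summable[OF inverse_squares_sums] by simp
    then have "summable (\<lambda>k. B * (1 / real (Suc k) ^ 2))" by (rule summable_mult)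
    then have "(\<Sum>k. ennreal (B * (1 / real (Suc k) ^ 2))) = ennreal (\<Sum>k. B * (1 / real (Suc k) ^ 2))"
      using B by (intro suminf_ennreal2) auto
    then show ?thesis by simp
  qed
  finally have "AE \<omega> in M. (\<Sum>k. ennreal (\<bar>Y k \<omega>\<bar> / real (Suc k) ^ 8)) \<noteq> \<infinity>"
    by (intro nn_integral_PInf_AE) auto
  then show ?thesis
  proof eventually_elim
    fix \<omega> assume fin: "(\<Sum>k. ennreal (\<bar>Y k \<omega>\<bar> / real (Suc k) ^ 8)) \<noteq> \<infinity>"
    then obtain C where C: "0 \<le> C" "(\<Sum>k. ennreal (\<bar>Y k \<omega>\<bar> / real (Suc k) ^ 8)) = ennreal C"
      by (cases "\<Sum>k. ennreal (\<bar>Y k \<omega>\<bar> / real (Suc k) ^ 8)") auto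
    have "\<bar>Y k \<omega>\<bar> \<le> C * real (Suc k) ^ 8" for k
    proof -
      have "ennreal (\<bar>Y k \<omega>\<bar> / real (Suc k) ^ 8) = (\<Sum>k\<in>{k}. ennreal (\<bar>Y k \<omega>\<bar> / real (Suc k) ^ 8))" by simp
      also have "\<dots> \<le> (\<Sum>k. ennreal (\<bar>Y k \<omega>\<bar> / real (Suc k) ^ 8))" by (rule sum_le_suminf) auto
      finally have "\<bar>Y k \<omega>\<bar> / real (Suc k) ^ 8 \<le> C" unfolding C(2) using C(1) by simp
      then show ?thesis by (simp add: pos_divide_le_eq del: of_nat_Suc)
    qed
    with C(1) show "\<exists>C\<ge>0. \<forall>k. \<bar>Y k \<omega>\<bar> \<le> C * real (Suc k) ^ 8" by blast
  qed
qed

text \<open>Counting asymptotics for the configuration and for its reflection have the same leading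
  term \<open>x / (2 pi)\<close>, which cancels.\<close>

lemma AE_imbalance_bound:
  "AE \<omega> in M. (\<forall>a b. finite (\<Lambda> \<omega> \<inter> {a..b})) \<and> (\<exists>C\<ge>0. \<forall>x\<ge>1. \<bar>imbalance (\<Lambda> \<omega>) x\<bar> \<le> C * x powr (8 / 9))"
proof -
  define T where "T k = trapezoid 1 (real (Suc k) ^ 9 - 1)" for k
  define T' where "T' k = (\<lambda>x. T k (- x))" for k
  have T'_eq: "T' k = trapezoid (- (real (Suc k) ^ 9) + 1) (0 - 1)" for k
    unfolding T'_def T_def by (simp add: fun_eq_iff trapezoid_reflect)
  have cc: "cc_nonneg (T k)" "cc_nonneg (T' k)" for k
    unfolding T'_eq unfolding T_def by (rule cc_nonneg_trapezoid)+
  have B: "0 \<le> count_bound \<beta>" unfolding count_bound_def using herglotz_bound_pos[OF beta] by simp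
  have 1: "AE \<omega> in M. \<exists>C\<ge>0. \<forall>k. \<bar>L (T k) \<omega> - real (Suc k) ^ 9 / (2 * pi)\<bar> \<le> C * real (Suc k) ^ 8"
  proof (rule AE_deviation_bound[OF _ _ B])
    show "(\<integral>\<^sup>+\<omega>. ennreal \<bar>L (T k) \<omega> - real (Suc k) ^ 9 / (2 * pi)\<bar> \<partial>M) \<le> ennreal (count_bound \<beta> * real (Suc k) ^ 6)" for k
      using nn_integral_trapezoid_deviation[of "real (Suc k) ^ 9" 0 "Suc k"] unfolding T_def by simp
  qed (use measurable_L[OF cc(1)] in simp)
  have 2: "AE \<omega> in M. \<exists>C\<ge>0. \<forall>k. \<bar>L (T' k) \<omega> - real (Suc k) ^ 9 / (2 * pi)\<bar> \<le> C * real (Suc k) ^ 8"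
  proof (rule AE_deviation_bound[OF _ _ B])
    show "(\<integral>\<^sup>+\<omega>. ennreal \<bar>L (T' k) \<omega> - real (Suc k) ^ 9 / (2 * pi)\<bar> \<partial>M) \<le> ennreal (count_bound \<beta> * real (Suc k) ^ 6)" for k
      using nn_integral_trapezoid_deviation[of 0 "- (real (Suc k) ^ 9)" "Suc k"] unfolding T'_eq by simp
  qed (use measurable_L[OF cc(2)] in simp)
  show ?thesis
    using AE_finite 1 2
  proof eventually_elim
    fix \<omega>
    assume fin: "\<forall>a b. finite (\<Lambda> \<omega> \<inter> {a..b})"
      and "\<exists>C\<ge>0. \<forall>k. \<bar>L (T k) \<omega> - real (Suc k) ^ 9 / (2 * pi)\<bar> \<le> C * real (Suc k) ^ 8"
      and "\<exists>C\<ge>0. \<forall>k. \<bar>L (T' k) \<omega> - real (Suc k) ^ 9 / (2 * pi)\<bar> \<le> C * real (Suc k) ^ 8"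
    then obtain C1 C2 where C: "0 \<le> C1" "\<And>k. \<bar>L (T k) \<omega> - real (Suc k) ^ 9 / (2 * pi)\<bar> \<le> C1 * real (Suc k) ^ 8"
      "0 \<le> C2" "\<And>k. \<bar>L (T' k) \<omega> - real (Suc k) ^ 9 / (2 * pi)\<bar> \<le> C2 * real (Suc k) ^ 8" by blast
    let ?A = "\<Lambda> \<omega>"
    have fin1: "finite (?A \<inter> {a..b})" for a b using fin by simp
    have fin2: "finite (uminus ` ?A \<inter> {a..b})" for a b
    proof -
      have "uminus ` ?A \<inter> {a..b} = uminus ` (?A \<inter> {- b..- a})" by (auto simp: image_iff)
      then show ?thesis using fin1 by simp
    qed
    have s1: "\<bar>linear_stat (trapezoid 1 (real k ^ 9 - 1)) ?A - real k ^ 9 / (2 * pi)\<bar> \<le> C1 * real k ^ 8" if "1 \<le> k" for k :: nat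
      using C(2)[of "k - 1"] that unfolding T_def by simp
    have s2: "\<bar>linear_stat (trapezoid 1 (real k ^ 9 - 1)) (uminus ` ?A) - real k ^ 9 / (2 * pi)\<bar> \<le> C2 * real k ^ 8" if "1 \<le> k" for k :: nat
      using C(4)[of "k - 1"] that unfolding T'_def linear_stat_reflect T_def by simp
    obtain K1 where K1: "0 \<le> K1" "\<And>x. 1 \<le> x \<Longrightarrow> \<bar>real (card (?A \<inter> {0<..x})) - x / (2 * pi)\<bar> \<le> K1 * x powr (8 / 9)"
      using count_asymptotics[OF fin1 C(1) s1] by blast
    obtain K2 where K2: "0 \<le> K2" "\<And>x. 1 \<le> x \<Longrightarrow> \<bar>real (card (uminus ` ?A \<inter> {0<..x})) - x / (2 * pi)\<bar> \<le> K2 * x powr (8 / 9)"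
      using count_asymptotics[OF fin2 C(3) s2] by blast
    have "\<bar>imbalance ?A x\<bar> \<le> (K1 + K2) * x powr (8 / 9)" if "1 \<le> x" for x
      using K1(2)[OF that] K2(2)[OF that] unfolding imbalance_def distrib_right by linarith
    with K1(1) K2(1) fin show "(\<forall>a b. finite (?A \<inter> {a..b})) \<and> (\<exists>C\<ge>0. \<forall>x\<ge>1. \<bar>imbalance ?A x\<bar> \<le> C * x powr (8 / 9))"
      by (intro conjI exI[of _ "K1 + K2"]) auto
  qed
qed

text \<open>Both cut-offs are tied to one parameter, \<open>q = m + 1\<close> and
  \<open>\<epsilon> = 1 / (m + 1)\<close>, so that the error of the characteristic function is
  \<open>O(1 / m)\<close> for fixed \<xi>.\<close>

definition pv_approx :: "nat \<Rightarrow> 'a \<Rightarrow> real" where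
  "pv_approx m \<omega> = (let f = pv_kernel (1 / real (Suc m)) (real (Suc m) ^ 3) in L f \<omega> - L (\<lambda>x. f (- x)) \<omega>)"

lemma measurable_pv_approx [measurable]: "pv_approx m \<in> borel_measurable M"
proof -
  have "1 / real (Suc m) \<le> real (Suc m) ^ 3"
  proof -
    have "1 / real (Suc m) \<le> 1" by simp
    also have "1 \<le> real (Suc m) ^ 3" by (intro one_le_power) simp
    finally show ?thesis .
  qed
  note cc = cc_nonneg_pv_kernel[OF _ this]
  show ?thesis
    unfolding pv_approx_def Let_def by (intro borel_measurable_diff measurable_L cc) simp_all
qed

lemma AE_pv_limit:
  "AE \<omega> in M. \<exists>S. (sharp_sum (\<Lambda> \<omega>) \<longlongrightarrow> S) at_top \<and> (\<lambda>m. pv_approx m \<omega>) \<longlonglongrightarrow> S"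
  using AE_imbalance_bound
proof eventually_elim
  fix \<omega>
  let ?A = "\<Lambda> \<omega>"
  assume "(\<forall>a b. finite (?A \<inter> {a..b})) \<and> (\<exists>C\<ge>0. \<forall>x\<ge>1. \<bar>imbalance ?A x\<bar> \<le> C * x powr (8 / 9))"
  then obtain C where fin: "\<And>a b. finite (?A \<inter> {a..b})" and C: "0 \<le> C" and D: "\<And>x. 1 \<le> x \<Longrightarrow> \<bar>imbalance ?A x\<bar> \<le> C * x powr (8 / 9)"
    by auto
  obtain S where S: "(sharp_sum ?A \<longlongrightarrow> S) at_top" using sharp_sum_convergent[OF fin C D] by blast
  define r where "r m = real (Suc m) ^ 3" for m :: nat
  have r1: "1 \<le> r m" for m unfolding r_def by (intro one_le_power) simp
  have rlim: "filterlim r at_top sequentially"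
    unfolding r_def by (intro filterlim_pow_at_top filterlim_compose[OF filterlim_real_sequentially filterlim_Suc]) simp
  have r2lim: "filterlim (\<lambda>m. 2 * r m) at_top sequentially"
    by (intro filterlim_tendsto_pos_mult_at_top[OF tendsto_const _ rlim]) simp
  have imb: "(\<lambda>m. (imbalance ?A (2 * r m) - imbalance ?A (r m)) / r m) \<longlonglongrightarrow> 0"
  proof (rule Lim_null_comparison[OF always_eventually])
    show "\<forall>m. norm ((imbalance ?A (2 * r m) - imbalance ?A (r m)) / r m) \<le> (C * 2 powr (8 / 9) + C) * r m powr (- (1 / 9))"
    proof
      fix m
      have r0: "0 < r m" using r1[of m] by simp
      have "\<bar>imbalance ?A (2 * r m)\<bar> \<le> C * (2 * r m) powr (8 / 9)" using r1[of m] by (intro D) simp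
      also have "\<dots> = C * 2 powr (8 / 9) * r m powr (8 / 9)" using r0 by (simp add: powr_mult)
      finally have "\<bar>imbalance ?A (2 * r m) - imbalance ?A (r m)\<bar> \<le> (C * 2 powr (8 / 9) + C) * r m powr (8 / 9)"
        using D[OF r1[of m]] unfolding distrib_right by linarith
      then have "norm ((imbalance ?A (2 * r m) - imbalance ?A (r m)) / r m) \<le> (C * 2 powr (8 / 9) + C) * r m powr (8 / 9) / r m"
        using r0 unfolding real_norm_def abs_divide by (simp add: divide_right_mono)
      also have "\<dots> = (C * 2 powr (8 / 9) + C) * (r m powr (8 / 9) / r m powr 1)" using r0 by simp
      also have "r m powr (8 / 9) / r m powr 1 = r m powr (8 / 9 - 1)" by (rule powr_diff[symmetric])
      finally show "norm ((imbalance ?A (2 * r m) - imbalance ?A (r m)) / r m) \<le> (C * 2 powr (8 / 9) + C) * r m powr (- (1 / 9))" by simp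
    qed
    show "(\<lambda>m. (C * 2 powr (8 / 9) + C) * r m powr (- (1 / 9))) \<longlonglongrightarrow> 0"
      by (intro tendsto_mult_right_zero tendsto_neg_powr rlim) simp
  qed
  have "(\<lambda>m. 2 * sharp_sum ?A (2 * r m) - sharp_sum ?A (r m) - (imbalance ?A (2 * r m) - imbalance ?A (r m)) / r m) \<longlonglongrightarrow> 2 * S - S - 0"
    by (intro tendsto_diff tendsto_mult tendsto_const imb filterlim_compose[OF S rlim] filterlim_compose[OF S r2lim])
  moreover have "\<forall>\<^sub>F m in sequentially. pv_approx m \<omega> = 2 * sharp_sum ?A (2 * r m) - sharp_sum ?A (r m) - (imbalance ?A (2 * r m) - imbalance ?A (r m)) / r m"
  proof -
    \<comment> \<open>Local finiteness leaves finitely many nonzero points in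
      \<open>{-1..1}\<close>; 1 is inserted to keep the minimum defined and to cover points
      outside.\<close>
    have "\<exists>\<delta>>0. \<forall>x\<in>?A. x \<noteq> 0 \<longrightarrow> \<delta> \<le> \<bar>x\<bar>"
    proof -
      let ?F = "insert 1 (abs ` (?A \<inter> {-1..1} - {0}))"
      have fF: "finite ?F" using fin by simp
      have "0 < Min ?F" using fF by (subst Min_gr_iff) auto
      moreover have "Min ?F \<le> \<bar>x\<bar>" if "x \<in> ?A" "x \<noteq> 0" for x
      proof (cases "\<bar>x\<bar> \<le> 1")
        case True
        then have "\<bar>x\<bar> \<in> ?F" using that by (auto simp: abs_le_iff)
        then show ?thesis using fF by (intro Min_le) auto
      next
        case False
        moreover have "Min ?F \<le> 1" using fF by (intro Min_le) auto
        ultimately show ?thesis by linarith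
      qed
      ultimately show ?thesis by blast
    qed
    then obtain \<delta> where \<delta>: "0 < \<delta>" "\<And>x. x \<in> ?A \<Longrightarrow> x \<noteq> 0 \<Longrightarrow> \<delta> \<le> \<bar>x\<bar>" by blast
    have "\<forall>\<^sub>F m in sequentially. 1 / \<delta> \<le> real m"
      by (rule eventually_compose_filterlim[OF eventually_ge_at_top filterlim_real_sequentially])
    then show ?thesis
    proof eventually_elim
      fix m assume m: "1 / \<delta> \<le> real m"
      have "1 / real (Suc m) \<le> \<delta>"
      proof -
        have "1 \<le> real m * \<delta>" using m \<delta>(1) by (simp add: pos_divide_le_eq)
        also have "\<dots> \<le> real (Suc m) * \<delta>" using \<delta>(1) by (intro mult_right_mono) auto
        finally show ?thesis by (simp add: pos_divide_le_eq mult.commute del: of_nat_Suc)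
      qed
      then have gap: "1 / real (Suc m) \<le> \<bar>x\<bar>" if "x \<in> ?A" "x \<noteq> 0" for x
        using \<delta>(2)[OF that] by linarith
      have "1 / real (Suc m) \<le> 1" by simp
      then have "1 / real (Suc m) \<le> r m" using r1[of m] by linarith
      then show "pv_approx m \<omega> = 2 * sharp_sum ?A (2 * r m) - sharp_sum ?A (r m) - (imbalance ?A (2 * r m) - imbalance ?A (r m)) / r m"
        unfolding pv_approx_def Let_def r_def[symmetric]
        by (intro pv_statistic_eq[OF fin _ _ gap]) auto
    qed
  qed
  ultimately have "(\<lambda>m. pv_approx m \<omega>) \<longlonglongrightarrow> S" by (simp add: tendsto_cong)
  with S show "\<exists>S. (sharp_sum ?A \<longlongrightarrow> S) at_top \<and> (\<lambda>m. pv_approx m \<omega>) \<longlonglongrightarrow> S" by blast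
qed

text \<open>Taken as the limit of the measurable sequence \<open>pv_approx\<close>, which makes its
  measurability immediate; almost surely it is also the limit of the sharp sums.\<close>

definition pv_sum :: "'a \<Rightarrow> real" where
  "pv_sum \<omega> = lim (\<lambda>m. pv_approx m \<omega>)"

lemma measurable_pv_sum [measurable]: "pv_sum \<in> borel_measurable M"
  unfolding pv_sum_def by (rule borel_measurable_lim_metric) simp

lemma AE_pv_sum: "AE \<omega> in M. (sharp_sum (\<Lambda> \<omega>) \<longlongrightarrow> pv_sum \<omega>) at_top \<and> (\<lambda>m. pv_approx m \<omega>) \<longlonglongrightarrow> pv_sum \<omega>"
  using AE_pv_limit by eventually_elim (auto simp: pv_sum_def limI)

lemma pv_sum_characteristic_function:
  assumes xi: "0 < \<xi>"
  shows "(\<integral>\<omega>. cis (\<xi> * pv_sum \<omega>) \<partial>M) = exp (- \<xi> / 2)"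
proof -
  have "(\<lambda>m. \<integral>\<omega>. cis (\<xi> * pv_approx m \<omega>) \<partial>M) \<longlonglongrightarrow> (\<integral>\<omega>. cis (\<xi> * pv_sum \<omega>) \<partial>M)"
  proof (rule integral_dominated_convergence[where w = "\<lambda>_. 1"])
    show "integrable M (\<lambda>_. 1 :: real)" by (rule integrable_M_bounded[where B = 1]) auto
    show "AE \<omega> in M. (\<lambda>m. cis (\<xi> * pv_approx m \<omega>)) \<longlonglongrightarrow> cis (\<xi> * pv_sum \<omega>)"
      using AE_pv_sum by eventually_elim (intro tendsto_intros, simp)
  qed auto
  moreover have "(\<lambda>m. \<integral>\<omega>. cis (\<xi> * pv_approx m \<omega>) \<partial>M) \<longlonglongrightarrow> exp (- \<xi> / 2)"
  proof (rule LIM_zero_cancel, rule Lim_null_comparison[OF always_eventually])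
    show "\<forall>m. norm ((\<integral>\<omega>. cis (\<xi> * pv_approx m \<omega>) \<partial>M) - exp (- \<xi> / 2)) \<le> (2 + \<xi> * (64 * count_bound \<beta>)) * (1 / real (Suc m))"
    proof
      fix m
      have "1 / real (Suc m) \<le> 1" by simp
      also have "1 \<le> real (Suc m) ^ 3" by (intro one_le_power) simp
      finally have "1 / real (Suc m) \<le> real (Suc m) ^ 3" .
      from pv_characteristic_function[OF _ _ this xi]
      have "norm ((\<integral>\<omega>. cis (\<xi> * pv_approx m \<omega>) \<partial>M) - exp (- \<xi> / 2)) \<le> 2 * (1 / real (Suc m)) + \<xi> * (64 * count_bound \<beta> / real (Suc m))"
        unfolding pv_approx_def Let_def by simp
      then show "norm ((\<integral>\<omega>. cis (\<xi> * pv_approx m \<omega>) \<partial>M) - exp (- \<xi> / 2)) \<le> (2 + \<xi> * (64 * count_bound \<beta>)) * (1 / real (Suc m))"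
        by (simp add: distrib_right add_divide_distrib del: of_nat_Suc)
    qed
    have "(\<lambda>m. 1 / real (Suc m)) \<longlonglongrightarrow> 0"
      using LIMSEQ_inverse_real_of_nat by (simp add: inverse_eq_divide)
    then show "(\<lambda>m. (2 + \<xi> * (64 * count_bound \<beta>)) * (1 / real (Suc m))) \<longlonglongrightarrow> 0"
      by (rule tendsto_mult_right_zero)
  qed
  ultimately show ?thesis by (rule LIMSEQ_unique)
qed

lemma distributed_pv_sum: "distributed M lborel pv_sum (\<lambda>x. ennreal (cauchy_density x))"
proof -
  define Q where "Q = density lborel (\<lambda>x. ennreal (cauchy_density x))"
  have intc: "integrable lborel cauchy_density"
    by (rule cauchy_density_substitution(1)[of "\<lambda>_. 1"]) auto
  have "emeasure Q (space Q) = (\<integral>\<^sup>+x. ennreal (cauchy_density x) \<partial>lborel)"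
    unfolding Q_def by (subst emeasure_density) auto
  also have "\<dots> = 1"
    using nn_integral_eq_integral[OF intc] cauchy_mass cauchy_density_nonneg by simp
  finally have PQ: "prob_space Q" by (rule prob_spaceI)
  have RQ: "real_distribution Q"
    unfolding real_distribution_def real_distribution_axioms_def using PQ by (simp add: Q_def)
  have RS: "real_distribution (distr M borel pv_sum)"
    by (rule prob_space.real_distribution_distr[OF prob_M]) simp
  have charQ: "char Q t = (\<integral>x. cauchy_density x *\<^sub>R cis (t * x) \<partial>lborel)" for t
    unfolding char_eq_integral_cis Q_def by (intro integral_density) (auto simp: cauchy_density_nonneg)
  have charS: "char (distr M borel pv_sum) t = (\<integral>\<omega>. cis (t * pv_sum \<omega>) \<partial>M)" for t
    unfolding char_eq_integral_cis by (rule integral_distr) measurable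
  have nonneg: "char (distr M borel pv_sum) t = char Q t" if "0 \<le> t" for t
  proof (cases "t = 0")
    case True
    then show ?thesis
      using real_distribution.char_zero[OF RQ] real_distribution.char_zero[OF RS] by simp
  next
    case False
    then have "0 < t" using that by simp
    then show ?thesis
      unfolding charS charQ using pv_sum_characteristic_function[of t] cauchy_char[OF that] by simp
  qed
  \<comment> \<open>The characteristic function has been computed for positive arguments;
    conjugation, which holds for every real law, supplies the negative ones.\<close>
  have cnj: "char N (- t) = cnj (char N t)" for N t
    unfolding char_eq_integral_cis by (simp add: cis_cnj flip: Bochner_Integration.integral_cnj)
  have "char (distr M borel pv_sum) t = char Q t" for t
  proof (cases "0 \<le> t")
    case True then show ?thesis by (rule nonneg)
  next
    case False
    then have "char (distr M borel pv_sum) (- t) = char Q (- t)" by (intro nonneg) simp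
    then show ?thesis unfolding cnj by simp
  qed
  then have "distr M borel pv_sum = Q"
    by (intro Levy_uniqueness RS RQ) auto
  moreover have "distr M lborel pv_sum = distr M borel pv_sum"
    by (rule distr_cong) auto
  ultimately show ?thesis
    unfolding distributed_def Q_def by simp
qed

end

theorem theorem6p3:
  fixes \<beta> :: real and M :: "'a measure" and \<Lambda> :: "'a \<Rightarrow> real set"
  assumes "\<beta> > 0"
    and "sine_beta_process \<beta> M \<Lambda>"
  shows "\<exists>S. distributed M lborel S (\<lambda>x. ennreal (1 / (2 * pi * (x\<^sup>2 + 1/4)))) \<and>
             (AE \<omega> in M. ((\<lambda>r. \<Sum>x\<in>{x\<in>\<Lambda> \<omega>. \<bar>x\<bar> \<le> r}. 1 / x) \<longlongrightarrow> S \<omega>) at_top)"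
proof -
  interpret sine_process \<beta> M \<Lambda> using assms by unfold_locales
  have "AE \<omega> in M. ((\<lambda>r. \<Sum>x\<in>{x\<in>\<Lambda> \<omega>. \<bar>x\<bar> \<le> r}. 1 / x) \<longlongrightarrow> pv_sum \<omega>) at_top"
    using AE_pv_sum by eventually_elim (simp add: sharp_sum_def[abs_def])
  then show ?thesis
    using distributed_pv_sum unfolding cauchy_density_def by blast
qed

end
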